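(* Fix any $b>1$. Then the range of the mapping $\Phi_b$ is the class $L(b,\mathbb{R}^d)$ of all semi-selfdecomposable distributions with span $b$ on $\mathbb{R}^d$; namely, $$\Phi_b\left(I_{\log}(\mathbb{R}^d)\right)=L(b,\mathbb{R}^d).$$
   Context: $I(\mathbb{R}^d)$ is the class of all infinitely divisible distributions on $\mathbb{R}^d$; $\widehat\mu$ is the characteristic function of $\mu$; $\mathcal{L}(X)$ is the law of $X$; $[x]$ is the largest integer not greater than $x$; $|x|$ is the Euclidean norm. $I_{\log}(\mathbb{R}^d)=\{\mu\in I(\mathbb{R}^d):\int_{\mathbb{R}^d}\log^+|x|\,\mu(dx)<\infty\}$ with $\log^+|x|=(\log|x|)\vee 0$. For $\mu\in I(\mathbb{R}^d)$, $\{X_t^{(\mu)},t\ge 0\}$ denotes an $\mathbb{R}^d$-valued Lévy process with $\mathcal{L}(X_1^{(\mu)})=\mu$. For $b>1$, $$\Phi_b(\mu):=\mathcal{L}\left(\int_0^\infty b^{-[t]}\,dX_t^{(\mu)}\right),$$ where the improper stochastic integral is the limit in probability, as $t\to\infty$ (through the reals), of $\int_0^t b^{-[s]}dX_s^{(\mu)}=\sum_{j=0}^{[t]-1}b^{-j}(X^{(\mu)}_{j+1}-X^{(\mu)}_j)+b^{-[t]}(X^{(\mu)}_t-X^{(\mu)}_{[t]})$; $\Phi_b(\mu)$ is defined exactly when this limit exists. It is known that the domain of $\Phi_b$ is $I_{\log}(\mathbb{R}^d)$. A distribution $\mu\in I(\mathbb{R}^d)$ is semi-selfdecomposable with span $b>1$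 if there exists $\rho\in I(\mathbb{R}^d)$ such that $\widehat\mu(z)=\widehat\mu(b^{-1}z)\widehat\rho(z)$ for all $z\in\mathbb{R}^d$; $L(b,\mathbb{R}^d)$ is the class of all such $\mu$. *)

theory Defs
  imports "HOL-Probability.Probability"
begin

definition char_fun :: "'a::euclidean_space measure \<Rightarrow> 'a \<Rightarrow> complex" where
  "char_fun \<mu> z = (\<integral>x. iexp (z \<bullet> x) \<partial>\<mu>)"

definition distributions :: "'a::euclidean_space measure set" where
  "distributions = {\<mu>. prob_space \<mu> \<and> sets \<mu> = sets borel}"

definition convolution_power :: "'a::ordered_euclidean_space measure \<Rightarrow> nat \<Rightarrow> 'a measure" where
  "convolution_power \<nu> n = (((\<star>) \<nu>) ^^ n) (return borel 0)"

definition inf_divisible :: "'a::ordered_euclidean_space measure set" where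
  "inf_divisible =
    {\<mu> \<in> distributions. \<forall>n\<ge>1. \<exists>\<nu>\<in>distributions. \<mu> = convolution_power \<nu> n}"

(* In HOL ln 0 = 0, so the integrand has the correct value 0 at x = 0. *)
definition inf_divisible_log :: "'a::ordered_euclidean_space measure set" where
  "inf_divisible_log =
    {\<mu> \<in> inf_divisible. (\<integral>\<^sup>+x. ennreal (max (ln (norm x)) 0) \<partial>\<mu>) < \<infinity>}"

definition semi_selfdecomposable :: "real \<Rightarrow> 'a::ordered_euclidean_space measure set" where
  "semi_selfdecomposable b =
    {\<mu> \<in> inf_divisible. \<exists>\<rho>\<in>inf_divisible. \<forall>z.
       char_fun \<mu> z = char_fun \<mu> (inverse b *\<^sub>R z) * char_fun \<rho> z}"

definition tendsto_in_prob ::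
  "'w measure \<Rightarrow> ('i \<Rightarrow> 'w \<Rightarrow> 'a::euclidean_space) \<Rightarrow> ('w \<Rightarrow> 'a) \<Rightarrow> 'i filter \<Rightarrow> bool" where
  "tendsto_in_prob M X Y F \<longleftrightarrow>
    (\<forall>\<epsilon>>0. ((\<lambda>i. measure M {\<omega> \<in> space M. norm (X i \<omega> - Y \<omega>) > \<epsilon>}) \<longlongrightarrow> 0) F)"

definition cadlag_path :: "(real \<Rightarrow> 'a::euclidean_space) \<Rightarrow> bool" where
  "cadlag_path x \<longleftrightarrow>
    (\<forall>t\<ge>0. (x \<longlongrightarrow> x t) (at_right t)) \<and> (\<forall>t>0. \<exists>l. (x \<longlongrightarrow> l) (at_left t))"

(* The time set is [0, \<infinity>); the values of X at negative times play no role. *)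
definition levy_process :: "'w measure \<Rightarrow> (real \<Rightarrow> 'w \<Rightarrow> 'a::euclidean_space) \<Rightarrow> bool" where
  "levy_process M X \<longleftrightarrow>
    prob_space M \<and>
    (\<forall>t\<ge>0. X t \<in> borel_measurable M) \<and>
    (AE \<omega> in M. X 0 \<omega> = 0) \<and>
    (\<forall>n (t :: nat \<Rightarrow> real). 0 \<le> t 0 \<and> (\<forall>i<n. t i < t (Suc i)) \<longrightarrow>
       prob_space.indep_vars M (\<lambda>_. borel) (\<lambda>i \<omega>. X (t (Suc i)) \<omega> - X (t i) \<omega>) {..<n}) \<and>
    (\<forall>s\<ge>0. \<forall>t\<ge>0. distr M borel (\<lambda>\<omega>. X (s + t) \<omega> - X s \<omega>) =
                    distr M borel (\<lambda>\<omega>. X t \<omega> - X 0 \<omega>)) \<and>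
    (\<forall>s\<ge>0. tendsto_in_prob M X (X s) (at s within {0..})) \<and>
    (AE \<omega> in M. cadlag_path (\<lambda>t. X t \<omega>))"

(* The integral over [0, t] of the step function s \<mapsto> b^(-[s]) with respect to X. *)
definition step_integral ::
  "real \<Rightarrow> (real \<Rightarrow> 'w \<Rightarrow> 'a::euclidean_space) \<Rightarrow> real \<Rightarrow> 'w \<Rightarrow> 'a" where
  "step_integral b X t \<omega> =
    (\<Sum>j<nat \<lfloor>t\<rfloor>. inverse b ^ j *\<^sub>R (X (real j + 1) \<omega> - X (real j) \<omega>))
    + inverse b ^ nat \<lfloor>t\<rfloor> *\<^sub>R (X t \<omega> - X (of_int \<lfloor>t\<rfloor>) \<omega>)"

(* \<nu> is the law of the improper integral for a Levy process X with law of X_1 equal to \<mu>.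
   HOL cannot quantify over the type of the sample space inside a formula. Fixing it to be
   the type of paths loses nothing: a process on any other space can be transported to
   path space (with the push-forward sigma-algebra and the coordinate process), and the
   limit in probability is almost surely a function of the path. *)
definition law_of_integral ::
  "real \<Rightarrow> 'a::euclidean_space measure \<Rightarrow> 'a measure \<Rightarrow> bool" where
  "law_of_integral b \<mu> \<nu> \<longleftrightarrow>
    (\<exists>(M :: (real \<Rightarrow> 'a) measure) X Y.
       levy_process M X \<and> distr M borel (X 1) = \<mu> \<and>
       Y \<in> borel_measurable M \<and> tendsto_in_prob M (step_integral b X) Y at_top \<and>
       \<nu> = distr M borel Y)"

(* A partial map: None where the improper integral does not exist. The law does not
   depend on the choice of the process, so THE denotes that unique law. *)
definition Phi :: "real \<Rightarrow> 'a::ordered_euclidean_space measure \<rightharpoonup> 'a measure" where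
  "Phi b \<mu> =
    (if \<mu> \<in> inf_divisible \<and> (\<exists>\<nu>. law_of_integral b \<mu> \<nu>)
     then Some (THE \<nu>. law_of_integral b \<mu> \<nu>) else None)"

end

theory Submission
  imports Defs
begin

text \<open>Let \<open>\<phi>\<close> be the characteristic function of \<open>\<mu>\<close>. If the improper integral exists, its law \<open>\<nu>\<close>
  has characteristic function \<open>\<Prod>j. \<phi> (z / b ^ j)\<close>, so \<open>\<nu>\<close> satisfies the semi-selfdecomposability
  equation with \<open>\<rho> = \<mu>\<close>; the same product for the \<open>n\<close>-th roots of \<open>\<mu>\<close> gives the roots of \<open>\<nu>\<close>.
  Conversely, iterating the equation for \<open>\<nu>\<close> shows that the product over \<open>\<rho>\<close> converges to the
  characteristic function of \<open>\<nu>\<close>. Convergence of the product near \<open>0\<close> bounds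
  \<open>\<Sum>j. 1 - \<bar>\<phi> (z / b ^ j)\<bar>\<^sup>2\<close>, which forces a finite logarithmic moment, and by the Borel-Cantelli
  lemma a finite logarithmic moment makes the series \<open>\<Sum>j. (X (j + 1) - X j) / b ^ j\<close> converge almost
  surely.

  A cadlag Levy process for a given infinitely divisible law is obtained from Kolmogorov's extension
  theorem on the dyadic rationals. Its paths have finitely many large oscillations in bounded
  intervals, and the right limits along dyadic times form the process.\<close>

section \<open>Characteristic functions\<close>

text \<open>The pivot is the modulus of the partial products near 0. The moduli decrease to the
  modulus of a characteristic function, which is continuous with value 1 at 0; so a lower bound 1/2
  is at hand in all three situations: for \<mu> when the integral exists, for the n-th roots of such
  a \<mu>, and for the factor \<rho> of a semi-selfdecomposable law. The modulus ignores shifts and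
  phases, hence the symmetrization. For the roots, convergence of the product does not follow by
  simply taking roots, and a limit of characteristic functions must still be shown to belong to a
  law. Both are settled by constructing the integral for the root itself, whose logarithmic moment
  is finite because p^n >= 1/2 with 0 <= p <= 1 gives p >= 1/2. Existence of an integral requires an
  actual process, on a sample space of type \<open>real \<Rightarrow> 'a\<close>; functions of
  dyadic times fit this type. Dyadic times are countable, so that oscillation events are measurable,
  and the laws of their increments come from a single continuous exponent \<psi>.\<close>

lemma (in finite_measure) integrable_iexp [simp]:
  assumes [measurable]: "g \<in> borel_measurable M"
  shows "integrable M (\<lambda>x. iexp (g x))"
  by (rule integrable_const_bound[where B=1]) auto

lemma char_fun_distr:
  assumes [measurable]: "X \<in> borel_measurable M"
  shows "char_fun (distr M borel X) z = (\<integral>\<omega>. iexp (z \<bullet> X \<omega>) \<partial>M)"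
  unfolding char_fun_def by (subst integral_distr) auto

lemma distributionsD:
  assumes "\<mu> \<in> distributions"
  shows "prob_space \<mu>" "sets \<mu> = sets borel" "space \<mu> = UNIV"
proof -
  show "prob_space \<mu>" and s: "sets \<mu> = sets borel" using assms by (auto simp: distributions_def)
  show "space \<mu> = UNIV" using sets_eq_imp_space_eq[OF s] by simp
qed

lemma distr_in_distributions:
  assumes "prob_space M" and "X \<in> borel_measurable M"
  shows "distr M borel X \<in> distributions"
  using assms by (auto simp: distributions_def intro!: prob_space.prob_space_distr)

lemma char_fun_zero:
  assumes "\<mu> \<in> distributions" shows "char_fun \<mu> 0 = 1"
proof -
  interpret prob_space \<mu> using assms by (rule distributionsD)
  show ?thesis by (simp add: char_fun_def prob_space)
qed

lemma norm_char_fun_le_1: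
  assumes "\<mu> \<in> distributions" shows "norm (char_fun \<mu> z) \<le> 1"
proof -
  interpret prob_space \<mu> using assms by (rule distributionsD)
  have "norm (char_fun \<mu> z) \<le> (\<integral>x. norm (iexp (z \<bullet> x)) \<partial>\<mu>)"
    unfolding char_fun_def by (rule integral_norm_bound)
  then show ?thesis by (simp add: prob_space)
qed

lemma char_fun_uminus: "char_fun \<mu> (- z) = cnj (char_fun \<mu> z)"
proof -
  have "iexp (- z \<bullet> x) = cnj (iexp (z \<bullet> x))" for x by (simp add: exp_cnj)
  then show ?thesis unfolding char_fun_def by simp
qed

lemma continuous_char_fun:
  assumes "\<mu> \<in> distributions" shows "continuous_on UNIV (char_fun \<mu>)"
proof -
  interpret prob_space \<mu> using assms by (rule distributionsD)
  note [measurable_cong] = distributionsD(2)[OF assms]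
  show ?thesis unfolding continuous_on_eq_continuous_at[OF open_UNIV]
  proof safe
    fix z
    show "isCont (char_fun \<mu>) z"
    proof (rule continuous_at_sequentiallyI)
      fix u :: "nat \<Rightarrow> 'a" assume "u \<longlonglongrightarrow> z"
      then show "(\<lambda>n. char_fun \<mu> (u n)) \<longlonglongrightarrow> char_fun \<mu> z"
        unfolding char_fun_def
        by (intro integral_dominated_convergence[where w="\<lambda>_. 1"]) (auto intro!: tendsto_intros)
    qed
  qed
qed

lemma char_fun_scaleR:
  assumes "\<mu> \<in> distributions"
  shows "char_fun (distr \<mu> borel (\<lambda>x. c *\<^sub>R x)) z = char_fun \<mu> (c *\<^sub>R z)"
proof -
  note [measurable_cong] = distributionsD(2)[OF assms]
  show ?thesis by (subst char_fun_distr) (auto simp: char_fun_def)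
qed

lemma char_fun_convolution:
  assumes "\<mu> \<in> distributions" "\<nu> \<in> distributions"
  shows "char_fun (\<mu> \<star> \<nu>) z = char_fun \<mu> z * char_fun \<nu> z"
proof -
  interpret M: prob_space \<mu> using assms(1) by (rule distributionsD)
  interpret N: prob_space \<nu> using assms(2) by (rule distributionsD)
  interpret P: pair_prob_space \<mu> \<nu> ..
  note [measurable_cong] = distributionsD(2)[OF assms(1)] distributionsD(2)[OF assms(2)]
  have "char_fun (\<mu> \<star> \<nu>) z = (\<integral>p. iexp (z \<bullet> (fst p + snd p)) \<partial>(\<mu> \<Otimes>\<^sub>M \<nu>))"
    unfolding convolution_def by (subst char_fun_distr) (auto simp: case_prod_beta)
  also have "\<dots> = (\<integral>x. (\<integral>y. iexp (z \<bullet> (x + y)) \<partial>\<nu>) \<partial>\<mu>)"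
    by (subst P.integral_fst'[symmetric]) (auto intro!: P.integrable_iexp)
  also have "\<dots> = (\<integral>x. iexp (z \<bullet> x) * char_fun \<nu> z \<partial>\<mu>)"
    unfolding char_fun_def
    by (subst integral_mult_right_zero[symmetric])
       (simp add: inner_add_right exp_add[symmetric] distrib_left)
  also have "\<dots> = char_fun \<mu> z * char_fun \<nu> z"
    by (simp add: char_fun_def)
  finally show ?thesis .
qed

lemma convolution_in_distributions:
  assumes "\<mu> \<in> distributions" "\<nu> \<in> distributions"
  shows "(\<mu> \<star> \<nu>) \<in> distributions"
proof -
  interpret M: prob_space \<mu> using assms(1) by (rule distributionsD)
  interpret N: prob_space \<nu> using assms(2) by (rule distributionsD)
  interpret P: pair_prob_space \<mu> \<nu> ..
  note [measurable_cong] = distributionsD(2)[OF assms(1)] distributionsD(2)[OF assms(2)]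
  show ?thesis unfolding convolution_def
    by (rule distr_in_distributions) (auto simp: P.prob_space_axioms)
qed

lemma convolution_power_Suc: "convolution_power \<nu> (Suc n) = (\<nu> \<star> convolution_power \<nu> n)"
  by (simp add: convolution_power_def)

lemma return_in_distributions: "return borel x \<in> distributions"
  by (auto simp: distributions_def prob_space_return)

lemma char_fun_return: "char_fun (return borel x) z = iexp (z \<bullet> x)"
  unfolding char_fun_def by (subst integral_return) auto

lemma convolution_power_in_distributions:
  assumes "\<nu> \<in> distributions" shows "convolution_power \<nu> n \<in> distributions"
proof (induction n)
  case 0 show ?case by (simp add: convolution_power_def return_in_distributions)
qed (simp add: convolution_power_Suc convolution_in_distributions assms)

lemma char_fun_convolution_power:
  assumes "\<nu> \<in> distributions"
  shows "char_fun (convolution_power \<nu> n) z = char_fun \<nu> z ^ n"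
proof (induction n)
  case 0 show ?case by (simp add: convolution_power_def char_fun_return)
qed (simp add: convolution_power_Suc char_fun_convolution convolution_power_in_distributions assms)

lemma (in prob_space) char_fun_sum_indep:
  assumes "finite I" and ind: "indep_vars (\<lambda>_. borel) X I"
  shows "char_fun (distr M borel (\<lambda>\<omega>. \<Sum>i\<in>I. X i \<omega>)) z = (\<Prod>i\<in>I. char_fun (distr M borel (X i)) z)"
proof -
  have [measurable]: "X i \<in> borel_measurable M" if "i \<in> I" for i
    using ind that by (auto simp: indep_vars_def)
  have "char_fun (distr M borel (\<lambda>\<omega>. \<Sum>i\<in>I. X i \<omega>)) z = (\<integral>\<omega>. (\<Prod>i\<in>I. iexp (z \<bullet> X i \<omega>)) \<partial>M)"
    by (subst char_fun_distr)
       (auto simp: inner_sum_right sum_distrib_left exp_sum[OF \<open>finite I\<close>])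
  also have "\<dots> = (\<Prod>i\<in>I. (\<integral>\<omega>. iexp (z \<bullet> X i \<omega>) \<partial>M))"
  proof (rule indep_vars_lebesgue_integral[OF \<open>finite I\<close>])
    show "indep_vars (\<lambda>_. borel) (\<lambda>i \<omega>. iexp (z \<bullet> X i \<omega>)) I"
      by (rule indep_vars_compose2[OF ind]) auto
  qed auto
  also have "\<dots> = (\<Prod>i\<in>I. char_fun (distr M borel (X i)) z)"
    by (intro prod.cong refl char_fun_distr[symmetric]) auto
  finally show ?thesis .
qed

section \<open>Uniqueness of the law with a given characteristic function\<close>

lemma closed_indicator_approx:
  fixes C :: "'a::metric_space set"
  assumes "closed C"
  obtains f :: "nat \<Rightarrow> 'a \<Rightarrow> real" where
    "\<And>n. continuous_on UNIV (f n)" "\<And>n x. 0 \<le> f n x" "\<And>n x. f n x \<le> 1"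
    "\<And>x. (\<lambda>n. f n x) \<longlonglongrightarrow> indicator C x"
proof (cases "C = {}")
  \<comment> \<open>The distance to the empty set is 0 by convention, so the functions below would
    tend to 1 instead of 0.\<close>
  case True
  show ?thesis by (rule that[of "\<lambda>_ _. 0"]) (auto simp: True)
next
  case False
  define f where "f n x = max 0 (1 - real n * infdist x C)" for n :: nat and x
  show ?thesis
  proof (rule that[of f])
    show "(\<lambda>n. f n x) \<longlonglongrightarrow> indicator C x" for x
    proof (cases "x \<in> C")
      case True
      then show ?thesis by (simp add: f_def)
    next
      case out: False
      then have pos: "infdist x C > 0"
        using in_closed_iff_infdist_zero[OF \<open>closed C\<close> False] infdist_nonneg[of x C] by force
      obtain N :: nat where N: "1 / infdist x C \<le> real N" using real_arch_simple by blast
      have "f n x = 0" if "n \<ge> N" for n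
      proof -
        have "1 / infdist x C \<le> real n" using N that by linarith
        then show ?thesis using pos by (simp add: f_def field_simps)
      qed
      then have "eventually (\<lambda>n. f n x = 0) sequentially" by (auto simp: eventually_sequentially)
      then have "(\<lambda>n. f n x) \<longlonglongrightarrow> 0" by (rule tendsto_eventually)
      with out show ?thesis by simp
    qed
  qed (auto simp: f_def infdist_nonneg intro!: continuous_intros)
qed

text \<open>Closed sets generate the Borel sets and are stable under intersection, and their
  indicators are limits of continuous functions into [0, 1].\<close>

lemma measure_eqI_continuous:
  fixes \<mu> \<nu> :: "'a::euclidean_space measure"
  assumes \<mu>: "\<mu> \<in> distributions" and \<nu>: "\<nu> \<in> distributions"
    and eq: "\<And>h :: 'a \<Rightarrow> real. continuous_on UNIV h \<Longrightarrow> (\<And>x. 0 \<le> h x) \<Longrightarrow> (\<And>x. h x \<le> 1) \<Longrightarrow>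
      integral\<^sup>L \<mu> h = integral\<^sup>L \<nu> h"
  shows "\<mu> = \<nu>"
proof -
  interpret M: prob_space \<mu> using \<mu> by (rule distributionsD)
  interpret N: prob_space \<nu> using \<nu> by (rule distributionsD)
  note [measurable_cong] = distributionsD(2)[OF \<mu>] distributionsD(2)[OF \<nu>]
  have closed_eq: "measure \<mu> C = measure \<nu> C" if C: "closed C" for C
  proof -
    have [measurable]: "C \<in> sets borel" using C by simp
    obtain f :: "nat \<Rightarrow> 'a \<Rightarrow> real" where f: "\<And>n. continuous_on UNIV (f n)" "\<And>n x. 0 \<le> f n x" "\<And>n x. f n x \<le> 1"
      "\<And>x. (\<lambda>n. f n x) \<longlonglongrightarrow> indicator C x" using closed_indicator_approx[OF C] by blast
    have [measurable]: "f n \<in> borel_measurable borel" for n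
      using f(1) by (rule borel_measurable_continuous_onI)
    have "(\<lambda>n. integral\<^sup>L \<mu> (f n)) \<longlonglongrightarrow> integral\<^sup>L \<mu> (indicator C)"
      by (rule integral_dominated_convergence[where w="\<lambda>_. 1"]) (use f in auto)
    moreover have "(\<lambda>n. integral\<^sup>L \<nu> (f n)) \<longlonglongrightarrow> integral\<^sup>L \<nu> (indicator C)"
      by (rule integral_dominated_convergence[where w="\<lambda>_. 1"]) (use f in auto)
    moreover have "integral\<^sup>L \<mu> (f n) = integral\<^sup>L \<nu> (f n)" for n by (rule eq) (use f in auto)
    ultimately have "integral\<^sup>L \<mu> (indicator C :: 'a \<Rightarrow> real) = integral\<^sup>L \<nu> (indicator C)"
      using LIMSEQ_unique by simp
    then show ?thesis by (simp add: distributionsD(3)[OF \<mu>] distributionsD(3)[OF \<nu>])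
  qed
  show ?thesis
  proof (rule measure_eqI_generator_eq[where E="Collect closed" and \<Omega>=UNIV and A="\<lambda>_. UNIV"])
    show "Int_stable (Collect closed :: 'a set set)" by (auto simp: Int_stable_def)
    show "sets \<mu> = sigma_sets UNIV (Collect closed)" "sets \<nu> = sigma_sets UNIV (Collect closed)"
      using \<mu> \<nu> by (auto simp: distributions_def borel_eq_closed)
    fix C :: "'a set" assume "C \<in> Collect closed"
    then show "emeasure \<mu> C = emeasure \<nu> C"
      by (simp add: M.emeasure_eq_measure N.emeasure_eq_measure closed_eq)
  qed auto
qed

text \<open>The complex coefficient supplies both cosine and sine terms. Taking real parts yields a
  real algebra, as Stone-Weierstrass wants, and the characteristic function determines the integrals
  of its members.\<close>

inductive_set trig_poly :: "('a::euclidean_space \<Rightarrow> real) set" where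
  base: "(\<lambda>x. Re (c * iexp (z \<bullet> x))) \<in> trig_poly"
| add: "f \<in> trig_poly \<Longrightarrow> g \<in> trig_poly \<Longrightarrow> (\<lambda>x. f x + g x) \<in> trig_poly"

text \<open>Frequencies z and w combine to z + w and z - w, by 2 Re a Re b = Re (a b) + Re (a cnj
  b).\<close>

lemma trig_poly_mult_base:
  assumes "f \<in> trig_poly"
  shows "(\<lambda>x. Re (c * iexp (z \<bullet> x)) * f x) \<in> trig_poly"
  using assms
proof induction
  case (base d w)
  have "(\<lambda>x. Re (c * iexp (z \<bullet> x)) * Re (d * iexp (w \<bullet> x))) =
    (\<lambda>x. Re ((c * d / 2) * iexp ((z + w) \<bullet> x)) + Re ((c * cnj d / 2) * iexp ((z - w) \<bullet> x)))"
  proof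
    fix x
    let ?a = "c * iexp (z \<bullet> x)" and ?b = "d * iexp (w \<bullet> x)"
    have "Re ?a * Re ?b = Re (?a * ?b / 2) + Re (?a * cnj ?b / 2)" by (simp add: field_simps)
    also have "?a * ?b / 2 = (c * d / 2) * iexp ((z + w) \<bullet> x)"
      by (simp add: inner_add_left distrib_left exp_add)
    also have "?a * cnj ?b / 2 = (c * cnj d / 2) * iexp ((z - w) \<bullet> x)"
      by (simp add: inner_diff_left right_diff_distrib exp_diff exp_cnj exp_minus field_simps)
    finally show "Re ?a * Re ?b = Re ((c * d / 2) * iexp ((z + w) \<bullet> x)) + Re ((c * cnj d / 2) * iexp ((z - w) \<bullet> x))" .
  qed
  then show ?case by (simp only:) (intro trig_poly.intros)
next
  case (add f g)
  have "(\<lambda>x. Re (c * iexp (z \<bullet> x)) * (f x + g x)) =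
    (\<lambda>x. Re (c * iexp (z \<bullet> x)) * f x + Re (c * iexp (z \<bullet> x)) * g x)" by (simp add: distrib_left)
  with add.IH show ?case by (simp only:) (rule trig_poly.add)
qed

lemma trig_poly_mult:
  assumes "f \<in> trig_poly" "g \<in> trig_poly" shows "(\<lambda>x. f x * g x) \<in> trig_poly"
  using assms(1)
proof induction
  case (base c z) show ?case using assms(2) by (rule trig_poly_mult_base)
next
  case (add f h)
  then show ?case using trig_poly.add by (simp add: distrib_right)
qed

lemma trig_poly_const: "(\<lambda>_. c) \<in> trig_poly"
  using trig_poly.base[of "of_real c" 0] by simp

lemma trig_poly_continuous: "f \<in> trig_poly \<Longrightarrow> continuous_on S f"
  by (induction rule: trig_poly.induct) (auto intro!: continuous_intros)

text \<open>The bound is global, so all values lie in one compact interval, on which a polynomial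
  can approximate the truncation to [0, 1].\<close>

lemma trig_poly_bounded: "f \<in> trig_poly \<Longrightarrow> \<exists>B. \<forall>x. \<bar>f x\<bar> \<le> B"
proof (induction rule: trig_poly.induct)
  case (base c z)
  have "\<bar>Re (c * iexp (z \<bullet> x))\<bar> \<le> norm c" for x
    by (rule order_trans[OF abs_Re_le_cmod]) (simp add: norm_mult)
  then show ?case by blast
next
  case (add f g)
  then obtain B C where "\<forall>x. \<bar>f x\<bar> \<le> B" "\<forall>x. \<bar>g x\<bar> \<le> C" by blast
  then have "\<forall>x. \<bar>f x + g x\<bar> \<le> B + C" by (meson abs_triangle_ineq add_mono order_trans)
  then show ?case by blast
qed

lemma trig_poly_integral:
  assumes \<mu>: "\<mu> \<in> distributions" and \<nu>: "\<nu> \<in> distributions"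
    and eq: "\<And>z. char_fun \<mu> z = char_fun \<nu> z" and "f \<in> trig_poly"
  shows "integrable \<mu> f \<and> integrable \<nu> f \<and> integral\<^sup>L \<mu> f = integral\<^sup>L \<nu> f"
proof -
  interpret M: prob_space \<mu> using \<mu> by (rule distributionsD)
  interpret N: prob_space \<nu> using \<nu> by (rule distributionsD)
  note [measurable_cong] = distributionsD(2)[OF \<mu>] distributionsD(2)[OF \<nu>]
  show ?thesis using assms(4)
  proof induction
    case (base c z)
    have "integral\<^sup>L \<mu> (\<lambda>x. Re (c * iexp (z \<bullet> x))) = Re (c * char_fun \<mu> z)"
      unfolding char_fun_def by (subst integral_Re) auto
    moreover have "integral\<^sup>L \<nu> (\<lambda>x. Re (c * iexp (z \<bullet> x))) = Re (c * char_fun \<nu> z)"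
      unfolding char_fun_def by (subst integral_Re) auto
    ultimately show ?case using eq by (auto intro!: integrable_Re)
  qed auto
qed

lemma trig_poly_compose_polynomial:
  assumes "real_polynomial_function q" "f \<in> trig_poly"
  shows "(\<lambda>x. q (f x)) \<in> trig_poly"
  using assms(1)
proof induction
  case (linear q)
  \<comment> \<open>A linear functional on the reals is multiplication by its value at 1.\<close>
  have "q (f x) = f x * q 1" for x
    using linear.scaleR[OF bounded_linear.linear[OF linear], of "f x" 1] by simp
  then show ?case using trig_poly_mult[OF assms(2) trig_poly_const[of "q 1"]] by simp
qed (auto intro: trig_poly_const trig_poly.add trig_poly_mult)

lemma function_ring_trig_poly: "function_ring_on (trig_poly :: ('a::euclidean_space \<Rightarrow> real) set) (cball 0 R)"
proof
  fix x y :: 'a assume "x \<noteq> y"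
  \<comment> \<open>The scaling makes the phases at x and y differ by exactly 1, and c rotates the
    phase at y to 0. The real parts are then cos 1 at x and 1 at y.\<close>
  define z where "z = (1 / (norm (x - y))\<^sup>2) *\<^sub>R (x - y)"
  have z: "z \<bullet> (x - y) = 1" using \<open>x \<noteq> y\<close> by (simp add: z_def power2_norm_eq_inner)
  define c where "c = cnj (iexp (z \<bullet> y))"
  have c: "c * iexp (z \<bullet> y) = 1" by (simp add: c_def exp_cnj exp_minus)
  have "c * iexp (z \<bullet> x) = (c * iexp (z \<bullet> y)) * iexp (z \<bullet> (x - y))"
    by (simp add: inner_diff_right right_diff_distrib exp_diff)
  also have "\<dots> = iexp 1" using z c by simp
  finally have "Re (c * iexp (z \<bullet> x)) = Re (iexp 1)" by (rule arg_cong)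
  also have "Re (iexp 1) = cos 1" by (simp add: Re_exp)
  finally have "Re (c * iexp (z \<bullet> x)) = cos 1" .
  moreover have "cos (1::real) < cos 0" by (rule cos_monotone_0_pi) (use pi_gt3 in auto)
  moreover have "Re (c * iexp (z \<bullet> y)) = 1" by (simp only: c one_complex.sel)
  ultimately have "Re (c * iexp (z \<bullet> x)) \<noteq> Re (c * iexp (z \<bullet> y))" by (metis cos_zero less_irrefl)
  then show "\<exists>f\<in>trig_poly. f x \<noteq> f y" by (rule bexI[OF _ trig_poly.base[of c z]])
qed (auto intro: trig_poly_continuous trig_poly.add trig_poly_mult trig_poly_const)

text \<open>The bound is stated for all larger radii, so that two laws can share one ball.\<close>

lemma distribution_tight:
  assumes "\<mu> \<in> distributions" "e > 0"
  obtains R where "\<And>r. r \<ge> R \<Longrightarrow> measure \<mu> {x. norm x > r} < e"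
proof -
  interpret M: prob_space \<mu> using assms(1) by (rule distributionsD)
  note [measurable_cong] = distributionsD(2)[OF assms(1)]
  have "(\<lambda>n. measure \<mu> {x. norm x > real n}) \<longlonglongrightarrow> measure \<mu> (\<Inter>n. {x. norm x > real n})"
    by (rule M.finite_Lim_measure_decseq) (auto simp: decseq_def)
  moreover have "(\<Inter>n. {x::'a. norm x > real n}) = {}"
  proof (intro equals0I)
    fix x :: 'a assume "x \<in> (\<Inter>n. {x. norm x > real n})"
    moreover obtain n where "norm x < real n" using reals_Archimedean2 by blast
    ultimately show False by (auto dest!: spec[of _ n])
  qed
  ultimately have "(\<lambda>n. measure \<mu> {x. norm x > real n}) \<longlonglongrightarrow> 0" by simp
  then obtain n where n: "measure \<mu> {x. norm x > real n} < e"
    using assms(2) order_tendstoD(2) eventually_happens' sequentially_bot by blast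
  show ?thesis
  proof (rule that[of n])
    fix r assume "r \<ge> real n"
    then have "measure \<mu> {x. norm x > r} \<le> measure \<mu> {x. norm x > real n}"
      by (intro M.finite_measure_mono) auto
    with n show "measure \<mu> {x. norm x > r} < e" by simp
  qed
qed

text \<open>A trigonometric polynomial \<open>p\<close> that approximates \<open>h\<close> on a large ball may be large outside of
  it. Composing \<open>p\<close> with a polynomial that approximates the truncation to \<open>[0, 1]\<close> cures this
  without leaving the algebra of trigonometric polynomials.\<close>

theorem char_fun_unique:
  assumes \<mu>: "\<mu> \<in> distributions" and \<nu>: "\<nu> \<in> distributions"
    and eq: "\<And>z. char_fun \<mu> z = char_fun \<nu> z"
  shows "\<mu> = \<nu>"
proof (rule measure_eqI_continuous[OF \<mu> \<nu>])
  fix h :: "'a \<Rightarrow> real" assume h: "continuous_on UNIV h" "\<And>x. 0 \<le> h x" "\<And>x. h x \<le> 1"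
  interpret M: prob_space \<mu> using \<mu> by (rule distributionsD)
  interpret N: prob_space \<nu> using \<nu> by (rule distributionsD)
  note [measurable_cong] = distributionsD(2)[OF \<mu>] distributionsD(2)[OF \<nu>]
  have [measurable]: "h \<in> borel_measurable borel"
    using h(1) by (rule borel_measurable_continuous_onI)
  have main: "\<bar>integral\<^sup>L \<mu> h - integral\<^sup>L \<nu> h\<bar> \<le> 8 * e" if e: "0 < e" "e \<le> 1" for e
  proof -
    obtain R1 where R1: "\<And>r. r \<ge> R1 \<Longrightarrow> measure \<mu> {x. norm x > r} < e"
      using distribution_tight[OF \<mu> e(1)] by blast
    obtain R2 where R2: "\<And>r. r \<ge> R2 \<Longrightarrow> measure \<nu> {x. norm x > r} < e"
      using distribution_tight[OF \<nu> e(1)] by blast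
    define R where "R = max R1 R2"
    interpret function_ring_on trig_poly "cball 0 R :: 'a set" by (rule function_ring_trig_poly)
    have "continuous_on (cball 0 R) h" using h(1) continuous_on_subset by blast
    from Stone_Weierstrass[OF this] obtain F where F: "F \<in> UNIV \<rightarrow> trig_poly"
      "LIM n sequentially. F n :> uniformly_on (cball 0 R) h" by blast
    from uniform_limitD[OF F(2) e(1)] obtain n where n: "\<forall>x\<in>cball 0 R. dist (F n x) (h x) < e"
      using eventually_happens' sequentially_bot by blast
    define p where "p = F n"
    have p: "p \<in> trig_poly" "\<And>x. norm x \<le> R \<Longrightarrow> \<bar>p x - h x\<bar> < e"
      using F(1) n by (auto simp: p_def dist_real_def)
    obtain B where B: "\<And>x. \<bar>p x\<bar> \<le> B" using trig_poly_bounded[OF p(1)] by blast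
    have "continuous_on {-B..B} (\<lambda>t::real. max 0 (min 1 t))" by (intro continuous_intros)
    from Stone_Weierstrass_real_polynomial_function[OF _ this e(1)]
    obtain q where q: "real_polynomial_function q"
      "\<And>t. t \<in> {-B..B} \<Longrightarrow> \<bar>max 0 (min 1 t) - q t\<bar> < e" by auto
    define g where "g = (\<lambda>x. q (p x))"
    have g: "g \<in> trig_poly" unfolding g_def by (rule trig_poly_compose_polynomial[OF q(1) p(1)])
    have qp: "\<bar>max 0 (min 1 (p x)) - g x\<bar> < e" for x
      unfolding g_def using B[of x] by (intro q(2)) auto
    \<comment> \<open>Inside the ball the errors of p and of q add up to 2 e. Outside, h lies in
      [0, 1] and g in [-e, 1 + e], which gives at most 1 + e <= 2.\<close>
    have close: "\<bar>h x - g x\<bar> \<le> 2 * e + 2 * indicator {x. norm x > R} x" for x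
    proof (cases "norm x \<le> R")
      case True
      then show ?thesis using p(2)[OF True] qp[of x] h(2,3)[of x] by (auto simp: max_def min_def split: if_splits)
    next
      case False
      then show ?thesis using qp[of x] h(2,3)[of x] e by (auto simp: max_def min_def split: if_splits)
    qed
    \<comment> \<open>The uniform error contributes 2 e, and twice the mass outside the ball another
      2 e. With two laws the total is 8 e.\<close>
    have est: "\<bar>integral\<^sup>L \<kappa> h - integral\<^sup>L \<kappa> g\<bar> \<le> 4 * e"
      if \<kappa>: "\<kappa> \<in> distributions" "integrable \<kappa> g" "measure \<kappa> {x. norm x > R} < e" for \<kappa>
    proof -
      interpret L: prob_space \<kappa> using \<kappa>(1) by (rule distributionsD)
      note [measurable_cong] = distributionsD(2)[OF \<kappa>(1)]
      have ih: "integrable \<kappa> h" by (rule L.integrable_const_bound[where B=1]) (use h in auto)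
      have "\<bar>integral\<^sup>L \<kappa> h - integral\<^sup>L \<kappa> g\<bar> = \<bar>\<integral>x. h x - g x \<partial>\<kappa>\<bar>" using ih \<kappa> by simp
      also have "\<dots> \<le> (\<integral>x. \<bar>h x - g x\<bar> \<partial>\<kappa>)" by (rule integral_abs_bound)
      also have "\<dots> \<le> (\<integral>x. 2 * e + 2 * indicator {x. norm x > R} x \<partial>\<kappa>)"
        by (rule integral_mono) (use ih \<kappa> close in \<open>auto simp: L.emeasure_eq_measure\<close>)
      also have "\<dots> = 2 * e + 2 * measure \<kappa> {x. norm x > R}"
        by (simp add: L.emeasure_eq_measure distributionsD(3)[OF \<kappa>(1)] L.prob_space[unfolded distributionsD(3)[OF \<kappa>(1)]])
      finally show ?thesis using \<kappa>(3) by simp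
    qed
    have "integrable \<mu> g" "integrable \<nu> g" "integral\<^sup>L \<mu> g = integral\<^sup>L \<nu> g"
      using trig_poly_integral[OF \<mu> \<nu> eq g] by auto
    with est[OF \<mu>] est[OF \<nu>] R1[of R] R2[of R] show ?thesis by (simp add: R_def)
  qed
  show "integral\<^sup>L \<mu> h = integral\<^sup>L \<nu> h"
  proof (rule ccontr)
    assume "integral\<^sup>L \<mu> h \<noteq> integral\<^sup>L \<nu> h"
    then have d: "\<bar>integral\<^sup>L \<mu> h - integral\<^sup>L \<nu> h\<bar> > 0" (is "?d > 0") by simp
    define e where "e = min 1 (?d / 16)"
    have "0 < e" "e \<le> 1" "16 * e \<le> ?d" using d by (auto simp: e_def min_def)
    then show False using main[of e] by linarith
  qed
qed

section \<open>Truncation inequality and infinitely divisible distributions\<close>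

lemma one_minus_Re_char_fun:
  assumes "\<mu> \<in> distributions"
  shows "1 - Re (char_fun \<mu> z) = (\<integral>x. 1 - cos (z \<bullet> x) \<partial>\<mu>)"
    and "ennreal (1 - Re (char_fun \<mu> z)) = (\<integral>\<^sup>+x. ennreal (1 - cos (z \<bullet> x)) \<partial>\<mu>)"
proof -
  interpret prob_space \<mu> using assms by (rule distributionsD)
  note [measurable_cong] = distributionsD(2)[OF assms]
  have "Re (char_fun \<mu> z) = (\<integral>x. Re (iexp (z \<bullet> x)) \<partial>\<mu>)"
    unfolding char_fun_def by (subst integral_Re) auto
  then have re: "Re (char_fun \<mu> z) = (\<integral>x. cos (z \<bullet> x) \<partial>\<mu>)" by (simp add: Re_exp)
  have int: "integrable \<mu> (\<lambda>x. cos (z \<bullet> x))"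
    by (rule integrable_const_bound[where B=1]) auto
  show 1: "1 - Re (char_fun \<mu> z) = (\<integral>x. 1 - cos (z \<bullet> x) \<partial>\<mu>)"
    using int by (simp add: re prob_space)
  show "ennreal (1 - Re (char_fun \<mu> z)) = (\<integral>\<^sup>+x. ennreal (1 - cos (z \<bullet> x)) \<partial>\<mu>)"
    unfolding 1 by (rule nn_integral_eq_integral[symmetric]) (use int in auto)
qed

lemma prob_space_uniform_Icc:
  assumes "(0::real) < u" shows "prob_space (uniform_measure lborel {0..u})"
  using assms by (intro prob_space_uniform_measure) auto

text \<open>The average is 1 - sin (u y) / (u y), and u |y| >= 2 leaves at least 1/2.\<close>

lemma average_one_minus_cos:
  assumes u: "0 < u" and y: "2 / u \<le> \<bar>y\<bar>"
  shows "(\<integral>\<^sup>+s. ennreal (1 - cos (s * y)) \<partial>uniform_measure lborel {0..u}) \<ge> ennreal (1 / 2)"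
proof -
  have y0: "y \<noteq> 0" using assms by auto
  have "(\<integral>\<^sup>+s. ennreal (1 - cos (s * y)) * indicator {0..u} s \<partial>lborel)
      = ennreal ((u - sin (u * y) / y) - (0 - sin (0 * y) / y))"
    by (rule nn_integral_FTC_Icc) (use u y0 in \<open>auto intro!: derivative_eq_intros\<close>)
  then have "(\<integral>\<^sup>+s. ennreal (1 - cos (s * y)) \<partial>uniform_measure lborel {0..u})
      = ennreal (u - sin (u * y) / y) / ennreal u"
    using u by (subst nn_integral_uniform_measure) auto
  also have "u / 2 \<le> u - sin (u * y) / y"
  proof -
    have "\<bar>sin (u * y) / y\<bar> \<le> 1 / \<bar>y\<bar>" using y0 by (auto simp: abs_divide divide_right_mono)
    also have "\<dots> \<le> u / 2" using y u y0 by (auto simp: field_simps)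
    finally show ?thesis by linarith
  qed
  then have "ennreal (u - sin (u * y) / y) / ennreal u \<ge> ennreal (u / 2) / ennreal u"
    using u by (intro divide_right_mono_ennreal ennreal_leI)
  moreover have "ennreal (u / 2) / ennreal u = ennreal (1 / 2)"
    using u by (simp add: divide_ennreal)
  ultimately show ?thesis by simp
qed

text \<open>By Fubini the integral on the right is the \<mu>-integral of the mean of 1 - cos (s (e .
  x)) over 0 <= s <= u, which is at least 1/2 on the event. Averaging along one direction e keeps
  the integral in s one-dimensional.\<close>

lemma char_fun_truncation:
  fixes \<mu> :: "'a::euclidean_space measure"
  assumes \<mu>: "\<mu> \<in> distributions" and u: "0 < u"
  shows "emeasure \<mu> {x. 2 / u \<le> \<bar>x \<bullet> e\<bar>} \<le>
    2 * (\<integral>\<^sup>+s. ennreal (1 - Re (char_fun \<mu> (s *\<^sub>R e))) \<partial>uniform_measure lborel {0..u})"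
proof -
  let ?U = "uniform_measure lborel {0..u}"
  interpret M: prob_space \<mu> using \<mu> by (rule distributionsD)
  interpret U: prob_space ?U using u by (rule prob_space_uniform_Icc)
  interpret P: pair_prob_space ?U \<mu> ..
  note [measurable_cong] = distributionsD(2)[OF \<mu>]
  have "emeasure \<mu> {x. 2 / u \<le> \<bar>x \<bullet> e\<bar>} = 2 * (\<integral>\<^sup>+x. ennreal (1/2) * indicator {x. 2 / u \<le> \<bar>x \<bullet> e\<bar>} x \<partial>\<mu>)"
  proof (subst nn_integral_cmult_indicator)
    have "ennreal 2 * ennreal (1 / 2) = ennreal (2 * (1 / 2))" by (rule ennreal_mult[symmetric]) auto
    then show "emeasure \<mu> {x. 2 / u \<le> \<bar>x \<bullet> e\<bar>} = 2 * (ennreal (1 / 2) * emeasure \<mu> {x. 2 / u \<le> \<bar>x \<bullet> e\<bar>})"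
      by (simp only: mult.assoc[symmetric]) simp
  qed measurable
  also have "(\<integral>\<^sup>+x. ennreal (1/2) * indicator {x. 2 / u \<le> \<bar>x \<bullet> e\<bar>} x \<partial>\<mu>)
      \<le> (\<integral>\<^sup>+x. (\<integral>\<^sup>+s. ennreal (1 - cos (s * (e \<bullet> x))) \<partial>?U) \<partial>\<mu>)"
    using average_one_minus_cos[OF u]
    by (intro nn_integral_mono) (auto split: split_indicator simp: inner_commute)
  also have "\<dots> = (\<integral>\<^sup>+s. (\<integral>\<^sup>+x. ennreal (1 - cos (s * (e \<bullet> x))) \<partial>\<mu>) \<partial>?U)"
    by (subst P.Fubini') auto
  also have "\<dots> = (\<integral>\<^sup>+s. ennreal (1 - Re (char_fun \<mu> (s *\<^sub>R e))) \<partial>?U)"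
    by (simp add: one_minus_Re_char_fun(2)[OF \<mu>])
  finally show ?thesis by (simp add: mult_left_mono)
qed

text \<open>A quantitative continuity theorem at the unit mass at 0. The numbers u and \<eta> do not
  depend on \<mu>; this uniformity is what the later estimates for small times and for the remainder
  of the integral use.\<close>

lemma char_fun_near_1_imp_small:
  assumes "0 < \<epsilon>" "0 < \<alpha>"
  obtains u \<eta> where "0 < u" "0 < \<eta>"
    "\<And>\<mu> :: 'a::euclidean_space measure. \<mu> \<in> distributions \<Longrightarrow>
      (\<And>z. norm z \<le> u \<Longrightarrow> norm (char_fun \<mu> z - 1) \<le> \<eta>) \<Longrightarrow> measure \<mu> {x. norm x > \<epsilon>} \<le> \<alpha>"
proof -
  define d where "d = real DIM('a)"
  have d: "d > 0" by (simp add: d_def)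
  \<comment> \<open>Here 2 / u = \<epsilon> / d: a vector longer than \<epsilon> has a coordinate of
    size at least \<epsilon> / d. Each of the d coordinates costs at most 2 \<eta> = \<alpha> /
    d.\<close>
  define u \<eta> where "u = 2 * d / \<epsilon>" and "\<eta> = \<alpha> / (2 * d)"
  show ?thesis
  proof (rule that[of u \<eta>])
    show u: "0 < u" and \<eta>: "0 < \<eta>" using assms d by (auto simp: u_def \<eta>_def)
    fix \<mu> :: "'a measure"
    assume \<mu>: "\<mu> \<in> distributions" and near: "\<And>z. norm z \<le> u \<Longrightarrow> norm (char_fun \<mu> z - 1) \<le> \<eta>"
    interpret M: prob_space \<mu> using \<mu> by (rule distributionsD)
    interpret U: prob_space "uniform_measure lborel {0..u}" using u by (rule prob_space_uniform_Icc)
    note [measurable_cong] = distributionsD(2)[OF \<mu>]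
    have one: "measure \<mu> {x. 2 / u \<le> \<bar>x \<bullet> e\<bar>} \<le> 2 * \<eta>" if e: "e \<in> Basis" for e
    proof -
      have "AE s in uniform_measure lborel {0..u}. ennreal (1 - Re (char_fun \<mu> (s *\<^sub>R e))) \<le> ennreal \<eta>"
      proof (rule AE_uniform_measureI)
        show "AE s in lborel. s \<in> {0..u} \<longrightarrow> ennreal (1 - Re (char_fun \<mu> (s *\<^sub>R e))) \<le> ennreal \<eta>"
        proof (intro AE_I2 impI ennreal_leI)
          fix s assume "s \<in> {0..u}"
          then have "norm (char_fun \<mu> (s *\<^sub>R e) - 1) \<le> \<eta>" using e by (intro near) auto
          then show "1 - Re (char_fun \<mu> (s *\<^sub>R e)) \<le> \<eta>"
            using abs_Re_le_cmod[of "char_fun \<mu> (s *\<^sub>R e) - 1"] by simp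
        qed
      qed simp
      then have "(\<integral>\<^sup>+s. ennreal (1 - Re (char_fun \<mu> (s *\<^sub>R e))) \<partial>uniform_measure lborel {0..u})
         \<le> (\<integral>\<^sup>+s. ennreal \<eta> \<partial>uniform_measure lborel {0..u})"
        by (rule nn_integral_mono_AE)
      also have "\<dots> = ennreal \<eta>" using U.emeasure_space_1 by simp
      finally have "emeasure \<mu> {x. 2 / u \<le> \<bar>x \<bullet> e\<bar>} \<le> 2 * ennreal \<eta>"
        using char_fun_truncation[OF \<mu> u, of e] by (meson mult_left_mono order_trans zero_le)
      also have "\<dots> = ennreal (2 * \<eta>)" using \<eta> by (simp add: ennreal_mult)
      finally show ?thesis using \<eta> by (simp add: M.emeasure_eq_measure)
    qed
    have "{x. norm x > \<epsilon>} \<subseteq> (\<Union>e\<in>Basis. {x::'a. 2 / u \<le> \<bar>x \<bullet> e\<bar>})"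
    proof (rule subsetI, rule ccontr)
      fix x :: 'a assume x: "x \<in> {x. norm x > \<epsilon>}" and "x \<notin> (\<Union>e\<in>Basis. {x. 2 / u \<le> \<bar>x \<bullet> e\<bar>})"
      then have "\<bar>x \<bullet> e\<bar> \<le> \<epsilon> / d" if "e \<in> Basis" for e using that d assms by (auto simp: u_def not_le)
      then have "(\<Sum>e\<in>Basis. \<bar>x \<bullet> e\<bar>) \<le> (\<Sum>e\<in>(Basis::'a set). \<epsilon> / d)" by (intro sum_mono)
      also have "\<dots> = \<epsilon>" using d by (simp add: d_def)
      finally show False using x norm_le_l1[of x] by simp
    qed
    then have "measure \<mu> {x. norm x > \<epsilon>} \<le> measure \<mu> (\<Union>e\<in>Basis. {x. 2 / u \<le> \<bar>x \<bullet> e\<bar>})"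
      by (intro M.finite_measure_mono) auto
    also have "\<dots> \<le> (\<Sum>e\<in>Basis. measure \<mu> {x. 2 / u \<le> \<bar>x \<bullet> e\<bar>})"
      by (rule M.finite_measure_subadditive_finite) auto
    also have "\<dots> \<le> (\<Sum>e\<in>(Basis::'a set). 2 * \<eta>)" by (intro sum_mono one)
    also have "\<dots> = \<alpha>" using d by (simp add: d_def \<eta>_def)
    finally show "measure \<mu> {x. norm x > \<epsilon>} \<le> \<alpha>" .
  qed
qed

section \<open>Symmetrization and the continuous logarithm of an infinitely divisible law\<close>

definition symmetrization :: "'a::euclidean_space measure \<Rightarrow> 'a measure" where
  "symmetrization \<mu> = distr (\<mu> \<Otimes>\<^sub>M \<mu>) borel (\<lambda>(x, y). x - y)"

lemma symmetrization_in_distributions: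
  assumes "\<mu> \<in> distributions" shows "symmetrization \<mu> \<in> distributions"
proof -
  interpret M: prob_space \<mu> using assms by (rule distributionsD)
  interpret P: pair_prob_space \<mu> \<mu> ..
  note [measurable_cong] = distributionsD(2)[OF assms]
  show ?thesis unfolding symmetrization_def
    by (rule distr_in_distributions) (auto simp: P.prob_space_axioms)
qed

text \<open>The point of the construction: shifts and phases cancel, and 1 - Re becomes a function
  of the modulus alone.\<close>

lemma char_fun_symmetrization:
  assumes "\<mu> \<in> distributions"
  shows "char_fun (symmetrization \<mu>) z = of_real ((norm (char_fun \<mu> z))\<^sup>2)"
proof -
  interpret M: prob_space \<mu> using assms by (rule distributionsD)
  interpret P: pair_prob_space \<mu> \<mu> ..
  note [measurable_cong] = distributionsD(2)[OF assms]
  have "char_fun (symmetrization \<mu>) z = (\<integral>p. iexp (z \<bullet> (fst p - snd p)) \<partial>(\<mu> \<Otimes>\<^sub>M \<mu>))"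
    unfolding symmetrization_def by (subst char_fun_distr) (auto simp: case_prod_beta)
  also have "\<dots> = (\<integral>x. (\<integral>y. iexp (z \<bullet> (x - y)) \<partial>\<mu>) \<partial>\<mu>)"
    by (subst P.integral_fst'[symmetric]) (auto intro!: P.integrable_iexp)
  also have "\<dots> = (\<integral>x. iexp (z \<bullet> x) * char_fun \<mu> (- z) \<partial>\<mu>)"
    unfolding char_fun_def
    by (subst integral_mult_right_zero[symmetric])
       (simp add: inner_diff_right exp_diff right_diff_distrib exp_minus field_simps)
  also have "\<dots> = char_fun \<mu> z * cnj (char_fun \<mu> z)"
    by (simp add: char_fun_def[of _ z] char_fun_uminus)
  also have "\<dots> = of_real ((norm (char_fun \<mu> z))\<^sup>2)" by (simp only: complex_norm_square)
  finally show ?thesis .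
qed

text \<open>Integrate 1 - cos (2 t) <= 4 (1 - cos t) against the symmetrization.\<close>

lemma char_fun_doubling:
  assumes "\<mu> \<in> distributions"
  shows "1 - (norm (char_fun \<mu> (2 *\<^sub>R z)))\<^sup>2 \<le> 4 * (1 - (norm (char_fun \<mu> z))\<^sup>2)"
proof -
  let ?s = "symmetrization \<mu>"
  have s: "?s \<in> distributions" using assms by (rule symmetrization_in_distributions)
  interpret prob_space ?s using s by (rule distributionsD)
  note [measurable_cong] = distributionsD(2)[OF s]
  have "1 - cos (2 * t) \<le> 4 * (1 - cos t)" for t :: real
  proof -
    have "1 - cos (2 * t) = 2 * (1 - cos t) * (1 + cos t)"
      using cos_double_cos[of t] by (simp add: power2_eq_square algebra_simps)
    also have "\<dots> \<le> 2 * (1 - cos t) * 2" by (intro mult_left_mono) auto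
    finally show ?thesis by simp
  qed
  then have *: "1 - cos ((2 *\<^sub>R z) \<bullet> x) \<le> 4 * (1 - cos (z \<bullet> x))" for x by simp
  have int: "integrable ?s (\<lambda>x. cos (w \<bullet> x))" for w
    by (rule integrable_const_bound[where B=1]) auto
  have "(\<integral>x. 1 - cos ((2 *\<^sub>R z) \<bullet> x) \<partial>?s) \<le> (\<integral>x. 4 * (1 - cos (z \<bullet> x)) \<partial>?s)"
    by (rule integral_mono) (use int[of z] int[of "2 *\<^sub>R z"] * in auto)
  also have "\<dots> = 4 * (\<integral>x. 1 - cos (z \<bullet> x) \<partial>?s)" by (rule integral_mult_right_zero)
  finally show ?thesis
    unfolding one_minus_Re_char_fun(1)[OF s, symmetric] char_fun_symmetrization[OF assms] by simp
qed

lemma inf_divisibleD: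
  assumes "\<mu> \<in> inf_divisible"
  shows "\<mu> \<in> distributions"
    and "n \<ge> 1 \<Longrightarrow> \<exists>\<nu>\<in>distributions. \<forall>z. char_fun \<mu> z = char_fun \<nu> z ^ n"
  using assms by (auto simp: inf_divisible_def char_fun_convolution_power)
     (metis char_fun_convolution_power)

text \<open>The n-th root law has modulus \<open>root n c\<close> at z, which tends to 1. Once its
  square exceeds 3/4, the factor 4 of \<open>char_fun_doubling\<close> still keeps 1 minus the
  squared modulus at 2 z below 1.\<close>

lemma inf_divisible_nonzero_double:
  assumes \<mu>: "\<mu> \<in> inf_divisible" and nz: "char_fun \<mu> z \<noteq> 0"
  shows "char_fun \<mu> (2 *\<^sub>R z) \<noteq> 0"
proof -
  define c where "c = norm (char_fun \<mu> z)"
  have c: "c > 0" using nz by (simp add: c_def)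
  have "(\<lambda>n. (root n c)\<^sup>2) \<longlonglongrightarrow> 1\<^sup>2" using c by (intro tendsto_intros LIMSEQ_root_const)
  then have "eventually (\<lambda>n. (root n c)\<^sup>2 > 3/4) sequentially"
    by (rule order_tendstoD) simp
  with eventually_ge_at_top[of 1] have "eventually (\<lambda>n. n \<ge> 1 \<and> (root n c)\<^sup>2 > 3/4) sequentially"
    by (rule eventually_conj)
  then obtain n where n: "n \<ge> 1" "(root n c)\<^sup>2 > 3/4"
    using eventually_happens' sequentially_bot by blast
  obtain \<nu> where \<nu>: "\<nu> \<in> distributions" "\<And>z. char_fun \<mu> z = char_fun \<nu> z ^ n"
    using inf_divisibleD(2)[OF \<mu> n(1)] by blast
  have "norm (char_fun \<nu> z) = root n c"
    unfolding c_def \<nu>(2) norm_power using n(1) by (simp add: real_root_pos2)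
  then have "char_fun \<nu> (2 *\<^sub>R z) \<noteq> 0"
    using char_fun_doubling[OF \<nu>(1), of z] n(2) by (auto simp del: zero_less_power2)
  then show ?thesis by (simp add: \<nu>(2))
qed

text \<open>Continuity at 0 gives a nonzero value at z / 2^k for some k, and k doublings lead back
  to z.\<close>

lemma inf_divisible_char_fun_nonzero:
  assumes \<mu>: "\<mu> \<in> inf_divisible" shows "char_fun \<mu> z \<noteq> 0"
proof -
  have d: "\<mu> \<in> distributions" using \<mu> by (rule inf_divisibleD)
  have "(\<lambda>k. inverse ((2::real) ^ k)) \<longlonglongrightarrow> 0" by (rule LIMSEQ_inverse_realpow_zero) simp
  then have "(\<lambda>k. inverse ((2::real) ^ k) *\<^sub>R z) \<longlonglongrightarrow> 0 *\<^sub>R z" by (intro tendsto_intros)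
  then have "(\<lambda>k. char_fun \<mu> (inverse ((2::real) ^ k) *\<^sub>R z)) \<longlonglongrightarrow> 1"
    using continuous_on_tendsto_compose[OF continuous_char_fun[OF d], of _ 0] by (simp add: char_fun_zero[OF d])
  then have "eventually (\<lambda>k. char_fun \<mu> (inverse ((2::real) ^ k) *\<^sub>R z) \<noteq> 0) sequentially"
    by (rule tendsto_imp_eventually_ne) simp
  then obtain k where k: "char_fun \<mu> (inverse ((2::real) ^ k) *\<^sub>R z) \<noteq> 0"
    using eventually_happens' sequentially_bot by blast
  have "char_fun \<mu> (inverse ((2::real) ^ (k - j)) *\<^sub>R z) \<noteq> 0" if "j \<le> k" for j
    using that
  proof (induction j)
    case (Suc j)
    define m where "m = k - Suc j"
    have "k - j = Suc m" "k - Suc j = m" using Suc.prems by (auto simp: m_def)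
    then have eq: "2 *\<^sub>R (inverse ((2::real) ^ (k - j)) *\<^sub>R z) = inverse (2 ^ (k - Suc j)) *\<^sub>R z"
      by simp
    have "char_fun \<mu> (inverse ((2::real) ^ (k - j)) *\<^sub>R z) \<noteq> 0" using Suc by simp
    from inf_divisible_nonzero_double[OF \<mu> this] show ?case unfolding eq .
  qed (simp add: k)
  from this[of k] show ?thesis by simp
qed

text \<open>The distinguished logarithm. Continuity and the value at 0 single it out among all
  logarithms, so that dividing it by n yields the characteristic function of an n-th root rather
  than some branch of the complex root.\<close>

definition levy_exponent :: "'a::euclidean_space measure \<Rightarrow> ('a \<Rightarrow> complex) \<Rightarrow> bool" where
  "levy_exponent \<mu> \<psi> \<longleftrightarrow>
    continuous_on UNIV \<psi> \<and> \<psi> 0 = 0 \<and> (\<forall>z. char_fun \<mu> z = exp (\<psi> z))"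

lemma levy_exponent_exists:
  assumes \<mu>: "\<mu> \<in> inf_divisible"
  obtains \<psi> where "levy_exponent \<mu> \<psi>"
proof -
  have d: "\<mu> \<in> distributions" using \<mu> by (rule inf_divisibleD)
  obtain g where g: "continuous_on UNIV g" "\<And>z. char_fun \<mu> z = exp (g z)"
  proof (rule continuous_logarithm_on_contractible[OF continuous_char_fun[OF d]])
    show "contractible (UNIV :: 'a set)" by (rule convex_imp_contractible[OF convex_UNIV])
  qed (auto simp: inf_divisible_char_fun_nonzero[OF \<mu>])
  have "exp (g 0) = 1" using char_fun_zero[OF d] g(2)[of 0] by simp
  then have "levy_exponent \<mu> (\<lambda>z. g z - g 0)"
    using g by (auto simp: levy_exponent_def exp_diff intro!: continuous_intros)
  then show ?thesis by (rule that)
qed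

text \<open>The quotient of the two sides is continuous with values among the finitely many n-th
  roots of unity, hence constant on a connected space, and it is 1 at 0.\<close>

lemma levy_exponent_root:
  assumes \<psi>: "levy_exponent \<mu> \<psi>" and n: "n \<ge> 1"
    and \<nu>: "\<nu> \<in> distributions" "\<And>z. char_fun \<mu> z = char_fun \<nu> z ^ n"
  shows "char_fun \<nu> z = exp (\<psi> z / of_nat n)"
proof -
  define h where "h z = char_fun \<nu> z * exp (- \<psi> z / of_nat n)" for z
  have "h z ^ n = 1" for z
  proof -
    have "h z ^ n = char_fun \<nu> z ^ n * exp (of_nat n * (- \<psi> z / of_nat n))"
      unfolding h_def power_mult_distrib exp_of_nat_mult by (rule refl)
    also have "\<dots> = 1" using n \<psi> by (simp add: \<nu>(2)[symmetric] levy_exponent_def exp_minus)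
    finally show ?thesis .
  qed
  then have "range h \<subseteq> {z. z ^ n = 1}" by auto
  then have "finite (range h)" using finite_roots_unity[OF n] finite_subset by blast
  moreover have "continuous_on UNIV h"
    unfolding h_def using \<psi> n continuous_char_fun[OF \<nu>(1)]
    by (auto simp: levy_exponent_def intro!: continuous_intros)
  ultimately have "h constant_on UNIV"
    using continuous_finite_range_constant connected_UNIV by blast
  then have "h z = h 0" by (auto simp: constant_on_def)
  moreover have "h 0 = 1" using \<psi> by (simp add: h_def levy_exponent_def char_fun_zero[OF \<nu>(1)])
  ultimately show ?thesis by (simp add: h_def exp_minus field_simps)
qed

lemma levy_exponent_root_exists:
  assumes "\<mu> \<in> inf_divisible" "levy_exponent \<mu> \<psi>" "n \<ge> 1"
  obtains \<nu> where "\<nu> \<in> distributions" "\<And>z. char_fun \<nu> z = exp (\<psi> z / of_nat n)"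
  using inf_divisibleD(2)[OF assms(1,3)] levy_exponent_root[OF assms(2,3)] that by metis

section \<open>Logarithmic moments and geometric series\<close>

text \<open>With l = ln (y / a) / ln b >= 0, the indices 0, ..., floor l all satisfy the condition,
  and there are floor l + 1 >= l of them. Written as a series of indicators, the count can be
  integrated term by term.\<close>

lemma ln_le_geometric_count:
  fixes b a y :: real
  assumes b: "1 < b" and a: "0 < a" and y: "0 \<le> y"
  shows "ennreal (max (ln y) 0) \<le>
    ennreal \<bar>ln a\<bar> + ennreal (ln b) * (\<Sum>j. indicator {j. a \<le> inverse b ^ j * y} j)"
proof (cases "y < a \<or> y = 0")
  \<comment> \<open>At y = 0 the left-hand side is 0 because ln 0 = 0 in HOL.\<close>
  case True
  then have "y = 0 \<or> ln y \<le> ln a" using a y by (cases "y = 0") auto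
  then have "max (ln y) 0 \<le> \<bar>ln a\<bar>" by auto
  then have "ennreal (max (ln y) 0) \<le> ennreal \<bar>ln a\<bar>" by (rule ennreal_leI)
  then show ?thesis by (rule order_trans) simp
next
  case False
  define l where "l = ln (y / a) / ln b"
  have y0: "y > 0" and l: "l \<ge> 0" using False a b y by (auto simp: l_def)
  define n where "n = Suc (nat \<lfloor>l\<rfloor>)"
  have ln: "l \<le> real n" using l by (simp add: n_def) linarith
  have "a \<le> inverse b ^ j * y" if "j < n" for j
  proof -
    have "j \<le> nat \<lfloor>l\<rfloor>" using that by (simp add: n_def)
    then have "int j \<le> \<lfloor>l\<rfloor>" using l by linarith
    then have "real j \<le> l" using le_floor_iff[of "int j" l] by simp
    then have "real j * ln b \<le> ln (y / a)" using b by (simp add: l_def field_simps)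
    then have "ln (b ^ j) \<le> ln (y / a)" using b by (simp add: ln_realpow)
    then have "b ^ j \<le> y / a" using b a y0 by simp
    then show ?thesis using a b by (simp add: field_simps power_inverse)
  qed
  then have "(\<Sum>j<n. indicator {j. a \<le> inverse b ^ j * y} j) = (of_nat n :: ennreal)" by simp
  then have cnt: "of_nat n \<le> (\<Sum>j. indicator {j. a \<le> inverse b ^ j * y} j :: ennreal)"
    by (metis sum_le_suminf summableI zero_le finite_lessThan)
  have "ln y = ln a + ln b * l" using b a y0 by (simp add: l_def ln_div)
  also have "\<dots> \<le> \<bar>ln a\<bar> + ln b * real n" using b ln by (intro add_mono mult_left_mono) auto
  finally have "max (ln y) 0 \<le> \<bar>ln a\<bar> + ln b * real n" using b by auto
  then have "ennreal (max (ln y) 0) \<le> ennreal (\<bar>ln a\<bar> + ln b * real n)" by (rule ennreal_leI)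
  also have "\<dots> = ennreal \<bar>ln a\<bar> + ennreal (ln b) * of_nat n"
    using b by (simp add: ennreal_mult ennreal_of_nat_eq_real_of_nat)
  also have "\<dots> \<le> ennreal \<bar>ln a\<bar> + ennreal (ln b) * (\<Sum>j. indicator {j. a \<le> inverse b ^ j * y} j)"
    using cnt by (intro add_left_mono mult_left_mono) auto
  finally show ?thesis .
qed

text \<open>Only exponents j < ln y / ln r can count, and the summand 1 pays for j = 0. This is the
  estimate in the direction that Borel-Cantelli needs.\<close>

lemma geometric_count_le_ln:
  fixes r y :: real
  assumes r: "1 < r" and y: "0 \<le> y"
  shows "(\<Sum>j. indicator {j. r ^ j < y} j) \<le> 1 + ennreal (1 / ln r) * ennreal (max (ln y) 0)"
proof (rule suminf_le_const[OF summableI])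
  fix n
  define L where "L = max (ln y) 0 / ln r"
  have L: "L \<ge> 0" using r by (simp add: L_def)
  have "{j. j < n \<and> r ^ j < y} \<subseteq> {..nat \<lfloor>L\<rfloor>}"
  proof safe
    fix j assume j: "r ^ j < y"
    then have "y > 0" using r by (meson less_trans zero_less_power zero_less_one)
    then have "ln (r ^ j) < ln y" using j r by simp
    then have "real j * ln r \<le> max (ln y) 0" using r by (simp add: ln_realpow)
    then have "real j \<le> L" using r by (simp add: L_def field_simps)
    then show "j \<le> nat \<lfloor>L\<rfloor>" using L by (simp add: le_nat_floor)
  qed
  then have "card {j. j < n \<and> r ^ j < y} \<le> Suc (nat \<lfloor>L\<rfloor>)"
    by (metis card_mono finite_atMost card_atMost)
  also have "real (Suc (nat \<lfloor>L\<rfloor>)) \<le> 1 + L" using L by simp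
  finally have "real (card {j. j < n \<and> r ^ j < y}) \<le> 1 + L" by simp
  have "(\<Sum>j<n. indicator {j. r ^ j < y} j :: ennreal) = of_nat (card {j. j < n \<and> r ^ j < y})"
    by (simp add: sum.inter_filter[symmetric] indicator_def lessThan_def sum.If_cases Int_def)
  also have "\<dots> \<le> ennreal (1 + L)"
    using \<open>real (card {j. j < n \<and> r ^ j < y}) \<le> 1 + L\<close> by (simp add: ennreal_of_nat_eq_real_of_nat ennreal_leI)
  also have "\<dots> = 1 + ennreal (1 / ln r) * ennreal (max (ln y) 0)"
  proof -
    have "ennreal (1 + L) = 1 + ennreal (1 / ln r * max (ln y) 0)" using L by (simp add: L_def)
    also have "ennreal (1 / ln r * max (ln y) 0) = ennreal (1 / ln r) * ennreal (max (ln y) 0)"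
      using r by (intro ennreal_mult) auto
    finally show ?thesis .
  qed
  finally show "(\<Sum>j<n. indicator {j. r ^ j < y} j) \<le> 1 + ennreal (1 / ln r) * ennreal (max (ln y) 0)" .
qed

definition log_moment :: "'a::euclidean_space measure \<Rightarrow> ennreal" where
  "log_moment \<mu> = (\<integral>\<^sup>+x. ennreal (max (ln (norm x)) 0) \<partial>\<mu>)"

text \<open>The longer of x - y and y has at least half the length of x, whence ln 2.\<close>

lemma ln_plus_triangle:
  fixes x y :: "'a::real_normed_vector"
  shows "max (ln (norm x)) 0 \<le> max (ln (norm (x - y))) 0 + (max (ln (norm y)) 0 + ln 2)"
proof (cases "norm x \<le> 1")
  case True
  then have "ln (norm x) \<le> 0" by (cases "x = 0") auto
  then show ?thesis by auto
next
  case False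
  define m where "m = max (norm (x - y)) (norm y)"
  have "norm x \<le> norm (x - y) + norm y" using norm_triangle_ineq[of "x - y" y] by simp
  then have m: "norm x \<le> 2 * m" by (simp add: m_def)
  then have m0: "m > 0" using False by linarith
  have "ln (norm x) \<le> ln (2 * m)" using m False m0 by (subst ln_le_cancel_iff) auto
  also have "\<dots> = ln 2 + ln m" using m0 by (simp add: ln_mult)
  finally have "ln (norm x) \<le> ln 2 + ln m" .
  moreover have "ln m \<le> max (ln (norm (x - y))) 0 + max (ln (norm y)) 0"
    by (cases "norm (x - y) \<le> norm y") (auto simp: m_def max_def)
  ultimately have "ln (norm x) \<le> ln 2 + (max (ln (norm (x - y))) 0 + max (ln (norm y)) 0)" by linarith
  then show ?thesis by auto
qed

text \<open>By Fubini the shifted law of x - y has a finite moment for almost every y. One such y is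
  enough, since undoing the shift costs only a constant.\<close>

lemma log_moment_desymmetrization:
  assumes \<mu>: "\<mu> \<in> distributions" and fin: "log_moment (symmetrization \<mu>) < \<infinity>"
  shows "log_moment \<mu> < \<infinity>"
proof -
  interpret M: prob_space \<mu> using \<mu> by (rule distributionsD)
  interpret P: pair_prob_space \<mu> \<mu> ..
  note [measurable_cong] = distributionsD(2)[OF \<mu>]
  have "log_moment (symmetrization \<mu>) = (\<integral>\<^sup>+y. (\<integral>\<^sup>+x. ennreal (max (ln (norm (x - y))) 0) \<partial>\<mu>) \<partial>\<mu>)"
    unfolding log_moment_def symmetrization_def
    by (subst nn_integral_distr) (auto simp: case_prod_beta P.nn_integral_snd[symmetric])
  then have "AE y in \<mu>. (\<integral>\<^sup>+x. ennreal (max (ln (norm (x - y))) 0) \<partial>\<mu>) \<noteq> \<infinity>"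
    using fin by (intro nn_integral_PInf_AE) auto
  then obtain y where y: "(\<integral>\<^sup>+x. ennreal (max (ln (norm (x - y))) 0) \<partial>\<mu>) \<noteq> \<infinity>"
    using M.AE_False eventually_mono[of _ "ae_filter \<mu>" "\<lambda>_. False"] by blast
  have "log_moment \<mu> \<le> (\<integral>\<^sup>+x. ennreal (max (ln (norm (x - y))) 0) + ennreal (max (ln (norm y)) 0 + ln 2) \<partial>\<mu>)"
    unfolding log_moment_def
  proof (rule nn_integral_mono)
    fix x
    have "ennreal (max (ln (norm x)) 0) \<le> ennreal (max (ln (norm (x - y))) 0 + (max (ln (norm y)) 0 + ln 2))"
      by (rule ennreal_leI[OF ln_plus_triangle])
    also have "\<dots> = ennreal (max (ln (norm (x - y))) 0) + ennreal (max (ln (norm y)) 0 + ln 2)"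
      by (rule ennreal_plus) auto
    finally show "ennreal (max (ln (norm x)) 0) \<le>
      ennreal (max (ln (norm (x - y))) 0) + ennreal (max (ln (norm y)) 0 + ln 2)" .
  qed
  also have "\<dots> = (\<integral>\<^sup>+x. ennreal (max (ln (norm (x - y))) 0) \<partial>\<mu>) + ennreal (max (ln (norm y)) 0 + ln 2)"
    by (subst nn_integral_add) (auto simp: M.emeasure_space_1)
  also have "\<dots> < \<infinity>" using y by (simp add: less_top)
  finally show ?thesis .
qed

lemma one_minus_square_le_ln:
  fixes a :: real assumes "0 < a" shows "1 - a\<^sup>2 \<le> - 2 * ln a"
proof -
  have "ln (a\<^sup>2) \<le> a\<^sup>2 - 1" using assms by (intro ln_le_minus_one) simp
  then show ?thesis using assms by (simp add: ln_realpow)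
qed

text \<open>For small \<open>z\<close> the assumption bounds \<open>\<Sum>j. 1 - \<bar>char_fun \<mu> (z / b ^ j)\<bar>\<^sup>2\<close>. By the truncation
  inequality for the symmetrization this bounds the expected number of \<open>j\<close> with \<open>b ^ j \<le> c \<bar>x\<bar>\<close>,
  which is \<open>ln \<bar>x\<bar> / ln b\<close> up to a constant.\<close>

lemma log_moment_finite:
  fixes \<mu> :: "'a::euclidean_space measure"
  assumes \<mu>: "\<mu> \<in> distributions" and b: "1 < b" and \<delta>: "0 < \<delta>" and c: "0 < c"
    and lower: "\<And>N z. norm z \<le> \<delta> \<Longrightarrow> c \<le> (\<Prod>j<N. norm (char_fun \<mu> (inverse b ^ j *\<^sub>R z)))"
  shows "log_moment \<mu> < \<infinity>"
proof (rule log_moment_desymmetrization[OF \<mu>])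
  let ?s = "symmetrization \<mu>" and ?U = "uniform_measure lborel {0..\<delta>}"
  have s: "?s \<in> distributions" using \<mu> by (rule symmetrization_in_distributions)
  interpret S: prob_space ?s using s by (rule distributionsD)
  interpret U: prob_space ?U using \<delta> by (rule prob_space_uniform_Icc)
  note [measurable_cong] = distributionsD(2)[OF s]
  \<comment> \<open>Summing 1 - a^2 <= -2 ln a over the factors turns the lower bound c of the
    product into the upper bound -2 ln c of the sum.\<close>
  define K where "K = - 2 * ln c"
  have K: "(\<Sum>j<N. 1 - Re (char_fun ?s (inverse b ^ j *\<^sub>R z))) \<le> K" if z: "norm z \<le> \<delta>" for N z
  proof -
    define a where "a j = norm (char_fun \<mu> (inverse b ^ j *\<^sub>R z))" for j
    have prod: "(\<Prod>j<N. a j) \<ge> c" using lower[OF z] by (simp add: a_def)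
    have pos: "a j > 0" if "j < N" for j
    proof (rule ccontr)
      assume "\<not> a j > 0"
      then have "(\<Prod>j<N. a j) = 0" using that by (auto simp: a_def)
      with prod c show False by simp
    qed
    have "(\<Sum>j<N. 1 - Re (char_fun ?s (inverse b ^ j *\<^sub>R z))) = (\<Sum>j<N. 1 - (a j)\<^sup>2)"
      by (simp add: char_fun_symmetrization[OF \<mu>] a_def)
    also have "\<dots> \<le> (\<Sum>j<N. - 2 * ln (a j))" by (intro sum_mono one_minus_square_le_ln pos) auto
    also have "\<dots> = - 2 * ln (\<Prod>j<N. a j)"
      unfolding sum_distrib_left[symmetric] using pos by (subst ln_prod) (auto, force)
    also have "\<dots> \<le> K" using prod c by (simp add: K_def)
    finally show ?thesis .
  qed
  have [measurable]: "char_fun ?s \<in> borel_measurable borel"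
    using continuous_char_fun[OF s] by (rule borel_measurable_continuous_onI)
  have nonneg: "0 \<le> 1 - Re (char_fun ?s z)" for z
    using norm_char_fun_le_1[OF s, of z] complex_Re_le_cmod[of "char_fun ?s z"] by linarith
  define d where "d = real DIM('a)"
  have d: "d > 0" by (simp add: d_def)
  \<comment> \<open>A vector of length at least 2 d / \<delta> has a coordinate of size at least 2 /
    \<delta>, the threshold of the truncation inequality on [0, \<delta>].\<close>
  define A where "A j = {x::'a. 2 * d / \<delta> \<le> inverse b ^ j * norm x}" for j
  have [measurable]: "A j \<in> sets borel" for j unfolding A_def by measurable
  \<comment> \<open>The truncation inequality is applied to the law rescaled by b^-j. Every j is
    then averaged over the same interval [0, \<delta>], and the sum over j can be taken inside the
    integral, where K bounds it.\<close>
  have one: "emeasure ?s {x. 2 / \<delta> \<le> inverse b ^ j * \<bar>x \<bullet> e\<bar>} \<le>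
      2 * (\<integral>\<^sup>+t. ennreal (1 - Re (char_fun ?s (inverse b ^ j *\<^sub>R (t *\<^sub>R e)))) \<partial>?U)" for j e
  proof -
    let ?d = "distr ?s borel (\<lambda>x. inverse b ^ j *\<^sub>R x)"
    have "?d \<in> distributions" by (rule distr_in_distributions) (auto simp: S.prob_space_axioms)
    from char_fun_truncation[OF this \<delta>, of e]
    have "emeasure ?d {x. 2 / \<delta> \<le> \<bar>x \<bullet> e\<bar>} \<le>
      2 * (\<integral>\<^sup>+t. ennreal (1 - Re (char_fun ?s (inverse b ^ j *\<^sub>R (t *\<^sub>R e)))) \<partial>?U)"
      by (simp add: char_fun_scaleR[OF s])
    also have "emeasure ?d {x. 2 / \<delta> \<le> \<bar>x \<bullet> e\<bar>} = emeasure ?s {x. 2 / \<delta> \<le> inverse b ^ j * \<bar>x \<bullet> e\<bar>}"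
      using b by (subst emeasure_distr) (auto simp: distributionsD(3)[OF s] abs_mult vimage_def)
    finally show ?thesis .
  qed
  have sumA: "(\<Sum>j<N. emeasure ?s (A j)) \<le> ennreal (d * (2 * K))" for N
  proof -
    have "emeasure ?s (A j) \<le> (\<Sum>e\<in>Basis. emeasure ?s {x. 2 / \<delta> \<le> inverse b ^ j * \<bar>x \<bullet> e\<bar>})" for j
    proof -
      have "A j \<subseteq> (\<Union>e\<in>Basis. {x. 2 / \<delta> \<le> inverse b ^ j * \<bar>x \<bullet> e\<bar>})"
      proof (rule subsetI, rule ccontr)
        fix x assume x: "x \<in> A j" and "x \<notin> (\<Union>e\<in>Basis. {x. 2 / \<delta> \<le> inverse b ^ j * \<bar>x \<bullet> e\<bar>})"
        then have "(\<Sum>e\<in>Basis. inverse b ^ j * \<bar>x \<bullet> e\<bar>) < (\<Sum>e\<in>(Basis::'a set). 2 / \<delta>)"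
          by (intro sum_strict_mono) (auto simp: not_le)
        moreover have "inverse b ^ j * norm x \<le> inverse b ^ j * (\<Sum>e\<in>Basis. \<bar>x \<bullet> e\<bar>)"
          using b norm_le_l1 by (intro mult_left_mono) auto
        ultimately show False using x by (simp add: A_def sum_distrib_left d_def) (simp add: mult.commute)
      qed
      then have "emeasure ?s (A j) \<le> emeasure ?s (\<Union>e\<in>Basis. {x. 2 / \<delta> \<le> inverse b ^ j * \<bar>x \<bullet> e\<bar>})"
        by (intro emeasure_mono) auto
      also have "\<dots> \<le> (\<Sum>e\<in>Basis. emeasure ?s {x. 2 / \<delta> \<le> inverse b ^ j * \<bar>x \<bullet> e\<bar>})"
        by (rule emeasure_subadditive_finite) auto
      finally show ?thesis .
    qed
    then have "(\<Sum>j<N. emeasure ?s (A j)) \<le>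
        (\<Sum>j<N. \<Sum>e\<in>Basis. emeasure ?s {x. 2 / \<delta> \<le> inverse b ^ j * \<bar>x \<bullet> e\<bar>})"
      by (rule sum_mono)
    also have "\<dots> = (\<Sum>e\<in>Basis. \<Sum>j<N. emeasure ?s {x. 2 / \<delta> \<le> inverse b ^ j * \<bar>x \<bullet> e\<bar>})"
      by (rule sum.swap)
    also have "\<dots> \<le> (\<Sum>e\<in>(Basis::'a set). 2 * ennreal K)"
    proof (rule sum_mono)
      fix e :: 'a assume e: "e \<in> Basis"
      have "(\<Sum>j<N. emeasure ?s {x. 2 / \<delta> \<le> inverse b ^ j * \<bar>x \<bullet> e\<bar>}) \<le>
        (\<Sum>j<N. 2 * (\<integral>\<^sup>+t. ennreal (1 - Re (char_fun ?s (inverse b ^ j *\<^sub>R (t *\<^sub>R e)))) \<partial>?U))"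
        by (intro sum_mono one)
      also have "\<dots> = 2 * (\<integral>\<^sup>+t. (\<Sum>j<N. ennreal (1 - Re (char_fun ?s (inverse b ^ j *\<^sub>R (t *\<^sub>R e))))) \<partial>?U)"
        unfolding sum_distrib_left[symmetric] by (subst nn_integral_sum) auto
      also have "(\<integral>\<^sup>+t. (\<Sum>j<N. ennreal (1 - Re (char_fun ?s (inverse b ^ j *\<^sub>R (t *\<^sub>R e))))) \<partial>?U) \<le> (\<integral>\<^sup>+t. ennreal K \<partial>?U)"
      proof (rule nn_integral_mono_AE, rule AE_uniform_measureI, simp, intro AE_I2 impI)
        fix t assume "t \<in> {0..\<delta>}"
        then have "norm (t *\<^sub>R e) \<le> \<delta>" using e by simp
        from K[OF this, of N]
        show "(\<Sum>j<N. ennreal (1 - Re (char_fun ?s (inverse b ^ j *\<^sub>R (t *\<^sub>R e))))) \<le> ennreal K"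
          by (subst sum_ennreal[OF nonneg]) (rule ennreal_leI)
      qed
      also have "\<dots> = ennreal K" using U.emeasure_space_1 by simp
      finally show "(\<Sum>j<N. emeasure ?s {x. 2 / \<delta> \<le> inverse b ^ j * \<bar>x \<bullet> e\<bar>}) \<le> 2 * ennreal K"
        by (simp add: mult_left_mono)
    qed
    also have "\<dots> = ennreal d * (2 * ennreal K)"
      by (simp add: d_def ennreal_of_nat_eq_real_of_nat)
    also have "\<dots> = ennreal (d * (2 * K))"
      using d by (simp add: ennreal_mult' )
    finally show ?thesis .
  qed
  have "log_moment ?s \<le> (\<integral>\<^sup>+x. ennreal \<bar>ln (2 * d / \<delta>)\<bar> + ennreal (ln b) * (\<Sum>j. indicator (A j) x) \<partial>?s)"
    unfolding log_moment_def
  proof (rule nn_integral_mono)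
    fix x
    have "(\<Sum>j. indicator {j. 2 * d / \<delta> \<le> inverse b ^ j * norm x} j) = (\<Sum>j. indicator (A j) x :: ennreal)"
      by (simp add: A_def indicator_def)
    then show "ennreal (max (ln (norm x)) 0) \<le>
        ennreal \<bar>ln (2 * d / \<delta>)\<bar> + ennreal (ln b) * (\<Sum>j. indicator (A j) x)"
      using ln_le_geometric_count[OF b, of "2 * d / \<delta>" "norm x"] d \<delta> by simp
  qed
  also have "\<dots> = ennreal \<bar>ln (2 * d / \<delta>)\<bar> + ennreal (ln b) * (\<Sum>j. emeasure ?s (A j))"
    by (subst nn_integral_add) (auto simp: nn_integral_cmult nn_integral_suminf S.emeasure_space_1)
  also have "\<dots> \<le> ennreal \<bar>ln (2 * d / \<delta>)\<bar> + ennreal (ln b) * ennreal (d * (2 * K))"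
    by (intro add_left_mono mult_left_mono suminf_le_const[OF summableI] sumA) auto
  also have "\<dots> < \<infinity>" by (simp add: ennreal_mult_less_top)
  finally show "log_moment ?s < \<infinity>" .
qed

lemma log_moment_imp_summable:
  fixes \<mu> :: "'a::euclidean_space measure"
  assumes \<mu>: "\<mu> \<in> distributions" and fin: "log_moment \<mu> < \<infinity>" and b: "1 < b"
    and M: "prob_space M" and X: "\<And>j. X j \<in> borel_measurable M" "\<And>j. distr M borel (X j) = \<mu>"
  shows "AE \<omega> in M. summable (\<lambda>j. inverse b ^ j *\<^sub>R X j \<omega>)"
proof -
  interpret prob_space M by fact
  note [measurable] = X(1)
  note [measurable_cong] = distributionsD(2)[OF \<mu>]
  interpret \<mu>: prob_space \<mu> using \<mu> by (rule distributionsD)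
  \<comment> \<open>Half of the decay absorbs the variables: eventually |X j| <= r^j, and r^j / b^j
    = r^-j is summable.\<close>
  define r where "r = sqrt b"
  have r: "1 < r" "r * r = b" using b by (auto simp: r_def)
  define A where "A j = {\<omega>\<in>space M. r ^ j < norm (X j \<omega>)}" for j
  have [measurable]: "A j \<in> sets M" for j unfolding A_def by measurable
  have eA: "emeasure M (A j) = (\<integral>\<^sup>+x. indicator {j. r ^ j < norm x} j \<partial>\<mu>)" for j
  proof -
    have "emeasure M (A j) = emeasure (distr M borel (X j)) {x. r ^ j < norm x}"
      by (subst emeasure_distr) (auto simp: A_def vimage_def intro!: arg_cong[where f="emeasure M"])
    also have "\<dots> = (\<integral>\<^sup>+x. indicator {x. r ^ j < norm x} x \<partial>\<mu>)" by (simp add: X(2))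
    finally show ?thesis by (simp add: indicator_def)
  qed
  have "(\<Sum>j. emeasure M (A j)) = (\<integral>\<^sup>+x. (\<Sum>j. indicator {j. r ^ j < norm x} j) \<partial>\<mu>)"
    unfolding eA by (subst nn_integral_suminf) (auto simp: indicator_def)
  also have "\<dots> \<le> (\<integral>\<^sup>+x. 1 + ennreal (1 / ln r) * ennreal (max (ln (norm x)) 0) \<partial>\<mu>)"
    using r by (intro nn_integral_mono geometric_count_le_ln) auto
  also have "\<dots> = 1 + ennreal (1 / ln r) * log_moment \<mu>"
    by (subst nn_integral_add) (auto simp: nn_integral_cmult log_moment_def \<mu>.emeasure_space_1)
  also have "\<dots> < \<infinity>" using fin by (simp add: ennreal_mult_less_top)
  finally have "(\<Sum>j. emeasure M (A j)) < \<infinity>" .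
  then have ne: "(\<Sum>j. emeasure M (A j)) \<noteq> \<infinity>" by simp
  have "summable (\<lambda>j. measure M (A j))"
    using ne by (intro summable_suminf_not_top) (auto simp: emeasure_eq_measure)
  then have "AE \<omega> in M. eventually (\<lambda>j. \<omega> \<in> space M - A j) sequentially"
    by (intro borel_cantelli_AE1) (auto simp: less_top[symmetric])
  then show ?thesis
  proof (rule AE_mp, intro AE_I2 impI)
    fix \<omega> assume "\<omega> \<in> space M" and ev: "eventually (\<lambda>j. \<omega> \<in> space M - A j) sequentially"
    show "summable (\<lambda>j. inverse b ^ j *\<^sub>R X j \<omega>)"
    proof (rule summable_comparison_test_ev)
      show "eventually (\<lambda>j. norm (inverse b ^ j *\<^sub>R X j \<omega>) \<le> inverse r ^ j) sequentially"
        using ev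
      proof eventually_elim
        case (elim j)
        then have "norm (X j \<omega>) \<le> r ^ j" by (auto simp: A_def)
        then have "inverse b ^ j * norm (X j \<omega>) \<le> inverse b ^ j * r ^ j"
          using b by (intro mult_left_mono) auto
        also have "\<dots> = (inverse b * r) ^ j" by (simp add: power_mult_distrib)
        also have "inverse b * r = inverse r" using r by (simp add: field_simps flip: r(2))
        finally show ?case using b by simp
      qed
      show "summable (\<lambda>j. inverse r ^ j)" using r by (intro summable_geometric) (auto simp: field_simps)
    qed
  qed
qed

section \<open>Limits in probability and the characteristic function of the integral\<close>

lemma norm_iexp_diff_le: "norm (iexp s - iexp t) \<le> \<bar>s - t\<bar>"
proof -
  have "iexp s - iexp t = iexp t * (iexp (s - t) - 1)"
    by (simp add: algebra_simps flip: exp_add)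
  then have "norm (iexp s - iexp t) = norm (iexp (s - t) - 1)" by (simp add: norm_mult)
  also have "\<dots> \<le> \<bar>s - t\<bar>" using iexp_approx1[of "s - t" 0] by simp
  finally show ?thesis .
qed

lemma tendsto_in_prob_char_fun:
  fixes X :: "'i \<Rightarrow> 'w \<Rightarrow> 'a::euclidean_space"
  assumes M: "prob_space M" and X: "eventually (\<lambda>i. X i \<in> borel_measurable M) F"
    and Y[measurable]: "Y \<in> borel_measurable M" and lim: "tendsto_in_prob M X Y F"
  shows "((\<lambda>i. char_fun (distr M borel (X i)) z) \<longlongrightarrow> char_fun (distr M borel Y) z) F"
proof (rule tendstoI)
  interpret prob_space M by fact
  fix e :: real assume e: "e > 0"
  \<comment> \<open>Where X i is \<epsilon>-close to Y the error is at most |z| \<epsilon> <= e / 2.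
    Elsewhere it is at most 2, with probability below e / 4. The summand 1 in the denominator covers
    z = 0.\<close>
  define \<epsilon> where "\<epsilon> = e / (2 * (norm z + 1))"
  have nz: "norm z + 1 > 0" by (simp add: add_nonneg_pos)
  then have \<epsilon>: "\<epsilon> > 0" using e by (simp add: \<epsilon>_def)
  have "norm z * \<epsilon> \<le> (norm z + 1) * \<epsilon>" using \<epsilon> by (intro mult_right_mono) auto
  also have "\<dots> = e / 2" using nz by (simp add: \<epsilon>_def field_simps)
  finally have ze: "norm z * \<epsilon> \<le> e / 2" .
  have "((\<lambda>i. measure M {\<omega> \<in> space M. norm (X i \<omega> - Y \<omega>) > \<epsilon>}) \<longlongrightarrow> 0) F"
    using lim \<epsilon> by (simp add: tendsto_in_prob_def)
  then have "eventually (\<lambda>i. measure M {\<omega> \<in> space M. norm (X i \<omega> - Y \<omega>) > \<epsilon>} < e / 4) F"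
    using e by (intro order_tendstoD) auto
  with X show "eventually (\<lambda>i. dist (char_fun (distr M borel (X i)) z) (char_fun (distr M borel Y) z) < e) F"
  proof eventually_elim
    case (elim i)
    note [measurable] = elim(1)
    let ?A = "{\<omega> \<in> space M. norm (X i \<omega> - Y \<omega>) > \<epsilon>}"
    have pt: "norm (iexp (z \<bullet> X i \<omega>) - iexp (z \<bullet> Y \<omega>)) \<le> norm z * \<epsilon> + 2 * indicator ?A \<omega>"
      if "\<omega> \<in> space M" for \<omega>
    proof (cases "norm (X i \<omega> - Y \<omega>) > \<epsilon>")
      case True
      have "norm (iexp (z \<bullet> X i \<omega>) - iexp (z \<bullet> Y \<omega>)) \<le> 1 + 1"
        by (rule order_trans[OF norm_triangle_ineq4]) simp
      then show ?thesis using True that \<epsilon> by (simp add: add_increasing)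
    next
      case False
      have "norm (iexp (z \<bullet> X i \<omega>) - iexp (z \<bullet> Y \<omega>)) \<le> \<bar>z \<bullet> (X i \<omega> - Y \<omega>)\<bar>"
        using norm_iexp_diff_le by (simp add: inner_diff_right)
      also have "\<dots> \<le> norm z * norm (X i \<omega> - Y \<omega>)" by (rule Cauchy_Schwarz_ineq2)
      also have "\<dots> \<le> norm z * \<epsilon>" using False by (intro mult_left_mono) auto
      finally show ?thesis using False by simp
    qed
    have "dist (char_fun (distr M borel (X i)) z) (char_fun (distr M borel Y) z)
        = norm (\<integral>\<omega>. iexp (z \<bullet> X i \<omega>) - iexp (z \<bullet> Y \<omega>) \<partial>M)"
      by (simp add: char_fun_distr dist_norm)
    also have "\<dots> \<le> (\<integral>\<omega>. norm (iexp (z \<bullet> X i \<omega>) - iexp (z \<bullet> Y \<omega>)) \<partial>M)"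
      by (rule integral_norm_bound)
    also have "\<dots> \<le> (\<integral>\<omega>. norm z * \<epsilon> + 2 * indicator ?A \<omega> \<partial>M)"
      by (rule integral_mono) (auto simp: emeasure_eq_measure intro!: pt)
    also have "\<dots> = norm z * \<epsilon> + 2 * measure M ?A"
      by (simp add: emeasure_eq_measure prob_space)
    also have "\<dots> < e" using elim(2) ze by simp
    finally show ?case .
  qed
qed

lemma levy_processD:
  assumes "levy_process M X"
  shows "prob_space M" "t \<ge> 0 \<Longrightarrow> X t \<in> borel_measurable M" "AE \<omega> in M. X 0 \<omega> = 0"
    "0 \<le> u 0 \<Longrightarrow> (\<And>i. i < n \<Longrightarrow> u i < u (Suc i)) \<Longrightarrow>
       prob_space.indep_vars M (\<lambda>_. borel) (\<lambda>i \<omega>. X (u (Suc i)) \<omega> - X (u i) \<omega>) {..<n}"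
  using assms by (auto simp: levy_process_def)

lemma levy_process_increment_law:
  assumes L: "levy_process M X" and "s \<ge> 0" "t \<ge> 0"
  shows "distr M borel (\<lambda>\<omega>. X (s + t) \<omega> - X s \<omega>) = distr M borel (X t)"
proof -
  note [measurable] = levy_processD(2)[OF L \<open>t \<ge> 0\<close>] levy_processD(2)[OF L order.refl]
  have "distr M borel (\<lambda>\<omega>. X (s + t) \<omega> - X s \<omega>) = distr M borel (\<lambda>\<omega>. X t \<omega> - X 0 \<omega>)"
    using assms by (simp add: levy_process_def)
  also have "\<dots> = distr M borel (X t)"
    by (rule distr_cong_AE) (use levy_processD(3)[OF L] in auto)
  finally show ?thesis .
qed

lemma char_fun_geometric_sum:
  assumes M: "prob_space M" and ind: "prob_space.indep_vars M (\<lambda>_. borel) X {..<n}"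
    and \<mu>: "\<mu> \<in> distributions" and law: "\<And>j. j < n \<Longrightarrow> distr M borel (X j) = \<mu>"
  shows "char_fun (distr M borel (\<lambda>\<omega>. \<Sum>j<n. inverse b ^ j *\<^sub>R X j \<omega>)) z =
    (\<Prod>j<n. char_fun \<mu> (inverse b ^ j *\<^sub>R z))"
proof -
  interpret prob_space M by fact
  have X: "X j \<in> borel_measurable M" if "j < n" for j using ind that by (auto simp: indep_vars_def)
  have "indep_vars (\<lambda>_. borel) (\<lambda>j \<omega>. inverse b ^ j *\<^sub>R X j \<omega>) {..<n}"
    by (rule indep_vars_compose2[OF ind]) auto
  then have "char_fun (distr M borel (\<lambda>\<omega>. \<Sum>j<n. inverse b ^ j *\<^sub>R X j \<omega>)) z =
    (\<Prod>j<n. char_fun (distr M borel (\<lambda>\<omega>. inverse b ^ j *\<^sub>R X j \<omega>)) z)"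
    by (rule char_fun_sum_indep[OF finite_lessThan])
  also have "\<dots> = (\<Prod>j<n. char_fun \<mu> (inverse b ^ j *\<^sub>R z))"
  proof (rule prod.cong[OF refl])
    fix j assume "j \<in> {..<n}"
    then have j: "j < n" by simp
    have "distr M borel (\<lambda>\<omega>. inverse b ^ j *\<^sub>R X j \<omega>) = distr \<mu> borel (\<lambda>x. inverse b ^ j *\<^sub>R x)"
      unfolding law[OF j, symmetric] using X[OF j] by (subst distr_distr) (auto simp: o_def)
    then show "char_fun (distr M borel (\<lambda>\<omega>. inverse b ^ j *\<^sub>R X j \<omega>)) z = char_fun \<mu> (inverse b ^ j *\<^sub>R z)"
      by (simp add: char_fun_scaleR[OF \<mu>])
  qed
  finally show ?thesis .
qed

lemma step_integral_of_nat:
  "step_integral b X (real n) \<omega> = (\<Sum>j<n. inverse b ^ j *\<^sub>R (X (real (Suc j)) \<omega> - X (real j) \<omega>))"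
  by (simp add: step_integral_def add.commute)

text \<open>At integer times the step integral is a sum of independent scaled copies of
  \<open>X 1\<close>, and the limit along the reals is also the limit along the integers. Every
  later statement about an existing integral uses this product formula.\<close>

lemma law_of_integral_char_fun:
  fixes \<mu> :: "'a::euclidean_space measure"
  assumes "law_of_integral b \<mu> \<nu>"
  shows "\<mu> \<in> distributions" "\<nu> \<in> distributions"
    "(\<lambda>n. \<Prod>j<n. char_fun \<mu> (inverse b ^ j *\<^sub>R z)) \<longlonglongrightarrow> char_fun \<nu> z"
proof -
  obtain M :: "(real \<Rightarrow> 'a) measure" and X Y where
    L: "levy_process M X" and \<mu>_eq: "distr M borel (X 1) = \<mu>" and Y: "Y \<in> borel_measurable M"
    and lim: "tendsto_in_prob M (step_integral b X) Y at_top" and \<nu>_eq: "\<nu> = distr M borel Y"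
    using assms unfolding law_of_integral_def by blast
  interpret prob_space M using L by (rule levy_processD)
  have X[measurable]: "X (real n) \<in> borel_measurable M" for n using levy_processD(2)[OF L] by simp
  show \<mu>: "\<mu> \<in> distributions" unfolding \<mu>_eq[symmetric]
    using X[of 1] by (intro distr_in_distributions prob_space_axioms) simp
  show "\<nu> \<in> distributions" unfolding \<nu>_eq by (intro distr_in_distributions prob_space_axioms Y)
  let ?S = "\<lambda>n. step_integral b X (real n)"
  have S_eq: "?S n = (\<lambda>\<omega>. \<Sum>j<n. inverse b ^ j *\<^sub>R (X (real (Suc j)) \<omega> - X (real j) \<omega>))" for n
    by (rule ext) (rule step_integral_of_nat)
  have limn: "tendsto_in_prob M ?S Y sequentially"
    unfolding tendsto_in_prob_def
  proof safe
    fix \<epsilon> :: real assume "\<epsilon> > 0"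
    then have "((\<lambda>t. measure M {\<omega> \<in> space M. norm (step_integral b X t \<omega> - Y \<omega>) > \<epsilon>}) \<longlongrightarrow> 0) at_top"
      using lim by (simp add: tendsto_in_prob_def)
    from filterlim_compose[OF this filterlim_real_sequentially]
    show "(\<lambda>n. measure M {\<omega> \<in> space M. norm (?S n \<omega> - Y \<omega>) > \<epsilon>}) \<longlonglongrightarrow> 0" .
  qed
  have "(\<lambda>n. char_fun (distr M borel (?S n)) z) \<longlonglongrightarrow> char_fun \<nu> z"
    unfolding \<nu>_eq by (rule tendsto_in_prob_char_fun[OF prob_space_axioms _ Y limn])
       (auto simp: S_eq simp del: of_nat_Suc)
  moreover have "char_fun (distr M borel (?S n)) z = (\<Prod>j<n. char_fun \<mu> (inverse b ^ j *\<^sub>R z))" for n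
    unfolding S_eq
  proof (rule char_fun_geometric_sum[OF prob_space_axioms _ \<mu>])
    show "indep_vars (\<lambda>_. borel) (\<lambda>j \<omega>. X (real (Suc j)) \<omega> - X (real j) \<omega>) {..<n}"
      by (rule levy_processD(4)[OF L, of real]) auto
    fix j
    show "distr M borel (\<lambda>\<omega>. X (real (Suc j)) \<omega> - X (real j) \<omega>) = \<mu>"
      using levy_process_increment_law[OF L, of "real j" 1] by (simp add: \<mu>_eq add.commute)
  qed
  ultimately show "(\<lambda>n. \<Prod>j<n. char_fun \<mu> (inverse b ^ j *\<^sub>R z)) \<longlonglongrightarrow> char_fun \<nu> z" by simp
qed

text \<open>The products depend on \<mu> only, whatever process realizes it. This justifies THE in
  \<open>Phi\<close>.\<close>

lemma law_of_integral_unique: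
  assumes "law_of_integral b \<mu> \<nu>" "law_of_integral b \<mu> \<nu>'"
  shows "\<nu> = \<nu>'"
  by (rule char_fun_unique[OF law_of_integral_char_fun(2)[OF assms(1)] law_of_integral_char_fun(2)[OF assms(2)]
        LIMSEQ_unique[OF law_of_integral_char_fun(3)[OF assms(1)] law_of_integral_char_fun(3)[OF assms(2)]]])

section \<open>Random walks on the dyadic grid\<close>

definition grid :: "nat \<Rightarrow> real set" where
  "grid n = range (\<lambda>k::nat. real k / 2 ^ n)"

definition walk :: "nat \<Rightarrow> (nat \<Rightarrow> 'a::comm_monoid_add) \<Rightarrow> real \<Rightarrow> 'a" where
  "walk n \<xi> q = (\<Sum>k<nat \<lfloor>q * 2 ^ n\<rfloor>. \<xi> k)"

lemma walk_grid [simp]: "walk n \<xi> (real k / 2 ^ n) = (\<Sum>i<k. \<xi> i)"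
  by (simp add: walk_def)

lemma grid_Suc: "grid n \<subseteq> grid (Suc n)"
proof
  fix q assume "q \<in> grid n"
  then obtain k where "q = real k / 2 ^ n" by (auto simp: grid_def)
  then have "q = real (2 * k) / 2 ^ Suc n" by simp
  then show "q \<in> grid (Suc n)" unfolding grid_def by (rule range_eqI)
qed

lemma grid_mono: "n \<le> m \<Longrightarrow> grid n \<subseteq> grid m"
  by (rule lift_Suc_mono_le[of grid]) (rule grid_Suc)

lemma finite_subset_grid:
  assumes "finite J" "J \<subseteq> (\<Union>n. grid n)"
  shows "\<exists>n. J \<subseteq> grid n"
  using assms
proof (induction J)
  case (insert q J)
  then obtain n m where "J \<subseteq> grid n" "q \<in> grid m" by auto
  then have "insert q J \<subseteq> grid (max n m)"
    using grid_mono[of n "max n m"] grid_mono[of m "max n m"] by auto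
  then show ?case by blast
qed simp

text \<open>Consistency of the levels, path by path: two steps of length 2^-(n+1) make one step of
  length 2^-n.\<close>

lemma walk_Suc_grid:
  assumes "q \<in> grid n"
  shows "walk (Suc n) \<xi> q = walk n (\<lambda>k. \<xi> (2 * k) + \<xi> (2 * k + 1)) q"
proof -
  obtain k where k: "q = real k / 2 ^ n" using assms by (auto simp: grid_def)
  then have "q = real (2 * k) / 2 ^ Suc n" by simp
  then have "walk (Suc n) \<xi> q = (\<Sum>i<2 * k. \<xi> i)" by (simp only: walk_grid)
  also have "\<dots> = (\<Sum>i<k. \<xi> (2 * i) + \<xi> (2 * i + 1))"
    by (induction k) (auto simp: add.assoc)
  finally show ?thesis by (simp add: k)
qed

section \<open>Kolmogorov extension of the walks to all dyadic times\<close>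

lemma measurable_restrict_UNIV:
  assumes "\<And>k. f k \<in> measurable M (N k)"
  shows "(\<lambda>x k. f k x) \<in> measurable M (PiM UNIV N)"
  using measurable_restrict[of UNIV f M N] assms by (simp add: restrict_UNIV)

lemma measurable_walk [measurable]: "(\<lambda>\<xi>. walk n \<xi> q) \<in> borel_measurable (PiM UNIV (\<lambda>_. borel :: 'a::euclidean_space measure))"
  unfolding walk_def by measurable

text \<open>The law \<open>\<nu> n\<close> is meant for increments over a time of length
  2^-n.\<close>

locale dyadic_roots =
  fixes \<nu> :: "nat \<Rightarrow> 'a::euclidean_space measure"
  assumes \<nu>: "\<nu> n \<in> distributions"
    and square: "char_fun (\<nu> (Suc n)) z ^ 2 = char_fun (\<nu> n) z"
begin

definition iid :: "nat \<Rightarrow> (nat \<Rightarrow> 'a) measure" where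
  "iid n = PiM UNIV (\<lambda>_. \<nu> n)"

lemma product_prob_space: "product_prob_space (\<lambda>_::nat. \<nu> n)"
proof -
  interpret prob_space "\<nu> n" using \<nu> by (rule distributionsD)
  show ?thesis by unfold_locales
qed

lemma sets_iid [measurable_cong]: "sets (iid n) = sets (PiM UNIV (\<lambda>_. borel))"
  unfolding iid_def by (rule sets_PiM_cong) (auto simp: distributionsD[OF \<nu>])

lemma prob_space_iid: "prob_space (iid n)"
  unfolding iid_def by (rule prob_space_PiM) (rule distributionsD[OF \<nu>])

lemma distr_iid_coordinate: "distr (iid n) borel (\<lambda>\<xi>. \<xi> k) = \<nu> n"
proof -
  interpret product_prob_space "\<lambda>_::nat. \<nu> n" UNIV by (rule product_prob_space)
  have "distr (iid n) borel (\<lambda>\<xi>. \<xi> k) = distr (iid n) (\<nu> n) (\<lambda>\<xi>. \<xi> k)"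
    by (rule distr_cong) (auto simp: distributionsD[OF \<nu>])
  then show ?thesis using PiM_component[of k] by (simp add: iid_def)
qed

lemma indep_iid: "prob_space.indep_vars (iid n) (\<lambda>_. borel) (\<lambda>k \<xi>. \<xi> k) UNIV"
proof -
  interpret prob_space "iid n" by (rule prob_space_iid)
  have "distr (iid n) (PiM UNIV (\<lambda>_. borel)) (\<lambda>\<xi>. \<xi>) = iid n"
    by (rule distr_id2) (simp add: sets_iid)
  then show ?thesis
    by (subst indep_vars_iff_distr_eq_PiM')
       (auto simp: distr_iid_coordinate restrict_UNIV iid_def[symmetric])
qed

text \<open>Disjoint pairs of independent coordinates have independent sums, and the condition
  \<open>square\<close> identifies the law of each sum.\<close>

lemma distr_iid_pairs:
  "distr (iid (Suc n)) (PiM UNIV (\<lambda>_. borel)) (\<lambda>\<xi> k. \<xi> (2 * k) + \<xi> (2 * k + 1)) = iid n"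
proof -
  let ?Q = "iid (Suc n)" and ?Y = "\<lambda>k \<xi>. \<xi> (2 * k) + \<xi> (2 * k + 1) :: 'a"
  interpret prob_space ?Q by (rule prob_space_iid)
  have "{2 * j, 2 * j + 1} \<inter> {2 * k, 2 * k + 1} = {}" if "j \<noteq> k" for j k :: nat
    using that by (cases "j < k") auto
  then have disj: "disjoint_family (\<lambda>k::nat. {2 * k, 2 * k + 1})"
    unfolding disjoint_family_on_def by blast
  have "indep_vars (\<lambda>k. PiM {2 * k, 2 * k + 1} (\<lambda>_. borel)) (\<lambda>k \<xi>. restrict (\<lambda>i. \<xi> i) {2 * k, 2 * k + 1}) UNIV"
    by (rule indep_vars_restrict[OF indep_iid _ disj]) auto
  then have "indep_vars (\<lambda>_. borel) (\<lambda>k \<xi>. (\<lambda>x. x (2 * k) + x (2 * k + 1)) (restrict (\<lambda>i. \<xi> i) {2 * k, 2 * k + 1})) UNIV"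
    by (rule indep_vars_compose2) measurable
  then have ind: "indep_vars (\<lambda>_. borel) ?Y UNIV" by simp
  have law: "distr ?Q borel (?Y k) = \<nu> n" for k
  proof (rule char_fun_unique[OF _ \<nu>])
    show "distr ?Q borel (?Y k) \<in> distributions"
      by (rule distr_in_distributions) (auto simp: prob_space_axioms)
    fix z
    have "indep_vars (\<lambda>_. borel) (\<lambda>k \<xi>. \<xi> k :: 'a) {2 * k, 2 * k + 1}"
      by (rule indep_vars_subset[OF indep_iid]) auto
    from char_fun_sum_indep[OF _ this, of z]
    have "char_fun (distr ?Q borel (?Y k)) z = char_fun (\<nu> (Suc n)) z * char_fun (\<nu> (Suc n)) z"
      by (simp add: distr_iid_coordinate)
    then show "char_fun (distr ?Q borel (?Y k)) z = char_fun (\<nu> n) z"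
      using square[of n z] by (simp add: power2_eq_square)
  qed
  have "distr ?Q (PiM UNIV (\<lambda>_. borel)) (\<lambda>\<xi>. \<lambda>k\<in>UNIV. ?Y k \<xi>) = PiM UNIV (\<lambda>k. distr ?Q borel (?Y k))"
    using ind by (subst indep_vars_iff_distr_eq_PiM'[symmetric]) auto
  then show ?thesis unfolding law iid_def[of n] by (simp add: restrict_UNIV)
qed

text \<open>For J inside \<open>grid n\<close> this is the intended finite-dimensional law; at other
  times \<open>walk\<close> rounds down to the grid.\<close>

definition marginal :: "nat \<Rightarrow> real set \<Rightarrow> (real \<Rightarrow> 'a) measure" where
  "marginal n J = distr (iid n) (PiM J (\<lambda>_. borel)) (\<lambda>\<xi>. restrict (walk n \<xi>) J)"

lemma marginal_Suc:
  assumes "J \<subseteq> grid n"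
  shows "marginal (Suc n) J = marginal n J"
proof -
  have "marginal n J = distr (iid (Suc n)) (PiM J (\<lambda>_. borel))
      (\<lambda>\<xi>. restrict (walk n (\<lambda>k. \<xi> (2 * k) + \<xi> (2 * k + 1))) J)"
    unfolding marginal_def distr_iid_pairs[symmetric, of n]
    by (subst distr_distr) (auto simp: o_def intro!: measurable_restrict_UNIV)
  also have "\<dots> = marginal (Suc n) J"
    unfolding marginal_def using assms
    by (intro distr_cong refl restrict_ext) (auto simp: walk_Suc_grid)
  finally show ?thesis ..
qed

lemma marginal_mono:
  assumes "J \<subseteq> grid n" "n \<le> m"
  shows "marginal m J = marginal n J"
  using assms(2)
proof (induction m rule: dec_induct)
  case (step m)
  then have "J \<subseteq> grid m" using grid_mono assms(1) by blast
  then show ?case using marginal_Suc step.IH by simp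
qed simp

lemma marginal_restrict:
  assumes "J \<subseteq> H"
  shows "marginal n J = distr (marginal n H) (PiM J (\<lambda>_. borel)) (\<lambda>f. restrict f J)"
proof -
  have "J \<inter> H = J" "H \<inter> J = J" using assms by auto
  then show ?thesis unfolding marginal_def
    by (subst distr_distr) (use assms in \<open>auto simp: o_def restrict_restrict intro!: measurable_restrict_subset\<close>)
qed

lemma prob_space_marginal: "prob_space (marginal n J)"
  unfolding marginal_def by (rule prob_space.prob_space_distr[OF prob_space_iid]) measurable

text \<open>Kolmogorov's theorem wants one law for each finite set of times, so a grid has to be
  singled out for J. By \<open>marginal_mono\<close> every grid that contains J gives the same
  law.\<close>

definition level :: "real set \<Rightarrow> nat" where
  "level J = (LEAST n. J \<subseteq> grid n)"

lemma level:
  assumes "finite J" "J \<subseteq> (\<Union>n. grid n)"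
  shows "J \<subseteq> grid (level J)"
  unfolding level_def using finite_subset_grid[OF assms] by (rule LeastI_ex)

definition family :: "real set \<Rightarrow> (real \<Rightarrow> 'a) measure" where
  "family J = marginal (level J) J"

lemma family_eq_marginal:
  assumes "J \<subseteq> grid n"
  shows "family J = marginal n J"
proof -
  have "level J \<le> n" unfolding level_def using assms by (rule Least_le)
  moreover have "J \<subseteq> grid (level J)" unfolding level_def using assms by (rule LeastI)
  ultimately show ?thesis unfolding family_def using marginal_mono by metis
qed

lemma polish_projective_family: "polish_projective (\<Union>n. grid n) family"
proof (unfold polish_projective_def, rule projective_family.intro)
  fix J H :: "real set" assume JH: "J \<subseteq> H" "finite H" "H \<subseteq> (\<Union>n. grid n)"
  then obtain n where n: "H \<subseteq> grid n" using finite_subset_grid by blast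
  show "family J = distr (family H) (PiM J (\<lambda>_. borel)) (\<lambda>f. restrict f J)"
    unfolding family_eq_marginal[OF n] family_eq_marginal[OF order_trans[OF JH(1) n]]
    by (rule marginal_restrict[OF JH(1)])
next
  fix J :: "real set" assume "finite J" "J \<subseteq> (\<Union>n. grid n)"
  then show "prob_space (family J)" unfolding family_def by (intro prob_space_marginal)
qed

sublocale K: polish_projective "\<Union>n. grid n" family
  by (rule polish_projective_family)

lemma distr_lim_restrict:
  assumes J: "finite J" "J \<subseteq> grid n"
  shows "distr K.lim (PiM J (\<lambda>_. borel)) (\<lambda>\<omega>. restrict \<omega> J) = marginal n J"
proof (rule measure_eqI)
  have sub: "J \<subseteq> (\<Union>n. grid n)" using J by blast
  show "sets (distr K.lim (PiM J (\<lambda>_. borel)) (\<lambda>\<omega>. restrict \<omega> J)) = sets (marginal n J)"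
    by (simp add: marginal_def)
  fix A assume "A \<in> sets (distr K.lim (PiM J (\<lambda>_. borel)) (\<lambda>\<omega>. restrict \<omega> J))"
  then have A: "A \<in> sets (PiM J (\<lambda>_. borel))" by simp
  have "(\<lambda>\<omega>. restrict \<omega> J) \<in> measurable K.lim (PiM J (\<lambda>_. borel))"
    using measurable_restrict_subset[OF sub] by (simp cong: measurable_cong_sets)
  then have "emeasure (distr K.lim (PiM J (\<lambda>_. borel)) (\<lambda>\<omega>. restrict \<omega> J)) A =
      emeasure K.lim (prod_emb (\<Union>n. grid n) (\<lambda>_. borel) J A)"
    using A by (subst emeasure_distr) (auto simp: prod_emb_def space_PiM)
  also have "\<dots> = emeasure (family J) A" by (rule K.emeasure_lim_emb[OF sub J(1) A])
  finally show "emeasure (distr K.lim (PiM J (\<lambda>_. borel)) (\<lambda>\<omega>. restrict \<omega> J)) A = emeasure (marginal n J) A"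
    by (simp add: family_eq_marginal[OF J(2)])
qed

lemma measurable_lim_coordinate:
  assumes "q \<in> (\<Union>n. grid n)" shows "(\<lambda>\<omega>. \<omega> q) \<in> borel_measurable K.lim"
  using measurable_component_singleton[OF assms, of "\<lambda>_. borel"] by (simp cong: measurable_cong_sets)

lemma lim_increments:
  "prob_space.indep_vars K.lim (\<lambda>_. borel) (\<lambda>k \<omega>. \<omega> (real (Suc k) / 2 ^ n) - \<omega> (real k / 2 ^ n)) {..<m}" (is ?ind)
  "distr K.lim borel (\<lambda>\<omega>. \<omega> (real (Suc k) / 2 ^ n) - \<omega> (real k / 2 ^ n)) = \<nu> n" (is ?law)
proof -
  note of_nat_Suc [simp del]
  let ?D = "\<lambda>k \<omega>. \<omega> (real (Suc k) / 2 ^ n) - \<omega> (real k / 2 ^ n) :: 'a"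
  have grid: "real k / 2 ^ n \<in> grid n" for k by (auto simp: grid_def)
  then have [measurable]: "?D k \<in> borel_measurable K.lim" for k
    by (intro borel_measurable_diff measurable_lim_coordinate) (use grid in blast)+
  interpret Q: product_prob_space "\<lambda>_::nat. \<nu> n" UNIV by (rule product_prob_space)
  have joint: "distr K.lim (PiM {..<m} (\<lambda>_. borel)) (\<lambda>\<omega>. \<lambda>k\<in>{..<m}. ?D k \<omega>) = PiM {..<m} (\<lambda>_. \<nu> n)" for m
  proof -
    \<comment> \<open>These finitely many times determine the first m increments, and on them the
      extension has the law of the walk by construction.\<close>
    define J where "J = (\<lambda>k. real k / 2 ^ n) ` {..m}"
    have J: "finite J" "J \<subseteq> grid n" using grid by (auto simp: J_def)
    have inJ: "real k / 2 ^ n \<in> J" if "k \<le> m" for k using that by (auto simp: J_def)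
    have sub: "J \<subseteq> (\<Union>n. grid n)" using J by blast
    have res[measurable]: "(\<lambda>\<omega>. restrict \<omega> J) \<in> measurable K.lim (PiM J (\<lambda>_. borel))"
      using measurable_restrict_subset[OF sub] by (simp cong: measurable_cong_sets)
    have D[measurable]: "(\<lambda>\<omega>. \<lambda>k\<in>{..<m}. ?D k \<omega>) \<in> measurable (PiM J (\<lambda>_. borel)) (PiM {..<m} (\<lambda>_. borel))"
      by (intro measurable_restrict borel_measurable_diff measurable_component_singleton inJ) auto
    have "distr K.lim (PiM {..<m} (\<lambda>_. borel)) (\<lambda>\<omega>. \<lambda>k\<in>{..<m}. ?D k \<omega>) =
        distr K.lim (PiM {..<m} (\<lambda>_. borel)) (\<lambda>\<omega>. \<lambda>k\<in>{..<m}. ?D k (restrict \<omega> J))"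
    proof (intro distr_cong refl restrict_ext)
      fix \<omega> k assume "k \<in> {..<m}"
      then have "real k / 2 ^ n \<in> J" "real (Suc k) / 2 ^ n \<in> J" using inJ[of k] inJ[of "Suc k"] by auto
      then show "?D k \<omega> = ?D k (restrict \<omega> J)" by (simp only: restrict_apply')
    qed
    also have "\<dots> = distr (marginal n J) (PiM {..<m} (\<lambda>_. borel)) (\<lambda>\<omega>. \<lambda>k\<in>{..<m}. ?D k \<omega>)"
      unfolding distr_lim_restrict[OF J, symmetric] by (subst distr_distr) (auto simp: o_def)
    also have "\<dots> = distr (iid n) (PiM {..<m} (\<lambda>_. borel)) (\<lambda>\<xi>. \<lambda>k\<in>{..<m}. ?D k (restrict (walk n \<xi>) J))"
      unfolding marginal_def by (subst distr_distr) (auto simp: o_def)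
    also have "\<dots> = distr (iid n) (PiM {..<m} (\<lambda>_. \<nu> n)) (\<lambda>\<xi>. restrict \<xi> {..<m})"
    proof (rule distr_cong)
      show "sets (PiM {..<m} (\<lambda>_. borel)) = sets (PiM {..<m} (\<lambda>_. \<nu> n))"
        by (rule sets_PiM_cong) (auto simp: distributionsD[OF \<nu>])
      fix \<xi> :: "nat \<Rightarrow> 'a"
      show "(\<lambda>k\<in>{..<m}. ?D k (restrict (walk n \<xi>) J)) = restrict \<xi> {..<m}"
      proof (rule restrict_ext)
        fix k assume "k \<in> {..<m}"
        then have "?D k (restrict (walk n \<xi>) J) = (\<Sum>i<Suc k. \<xi> i) - (\<Sum>i<k. \<xi> i)"
          by (simp only: restrict_apply' inJ walk_grid lessThan_iff Suc_leI less_imp_le)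
        then show "?D k (restrict (walk n \<xi>) J) = \<xi> k" by simp
      qed
    qed simp
    also have "\<dots> = PiM {..<m} (\<lambda>_. \<nu> n)"
      unfolding iid_def by (rule Q.distr_PiM_restrict_finite) auto
    finally show ?thesis .
  qed
  have law: "distr K.lim borel (?D k) = \<nu> n" for k
  proof -
    have "distr K.lim borel (?D k) =
        distr (distr K.lim (PiM {..<Suc k} (\<lambda>_. borel)) (\<lambda>\<omega>. \<lambda>k\<in>{..<Suc k}. ?D k \<omega>)) borel (\<lambda>x. x k)"
      by (subst distr_distr) (auto simp: o_def)
    also have "\<dots> = distr (PiM {..<Suc k} (\<lambda>_. \<nu> n)) (\<nu> n) (\<lambda>x. x k)"
      unfolding joint by (rule distr_cong) (auto simp: distributionsD[OF \<nu>])
    also have "\<dots> = \<nu> n" by (rule distr_PiM_component) (auto simp: distributionsD[OF \<nu>])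
    finally show ?thesis .
  qed
  from law[of k] show ?law .
  show ?ind
  proof (cases "m = 0")
    case True
    then show ?thesis by (simp add: K.P.indep_vars_def K.P.indep_sets_def)
  next
    case False
    then show ?thesis
      using joint[of m] by (subst K.P.indep_vars_iff_distr_eq_PiM') (auto simp: law)
  qed
qed

end

lemma dyadic_levy_walk_exists:
  fixes \<nu> :: "nat \<Rightarrow> 'a::euclidean_space measure"
  assumes "\<And>n. \<nu> n \<in> distributions" "\<And>n z. char_fun (\<nu> (Suc n)) z ^ 2 = char_fun (\<nu> n) z"
  obtains M :: "(real \<Rightarrow> 'a) measure" and W :: "real \<Rightarrow> (real \<Rightarrow> 'a) \<Rightarrow> 'a" where
    "prob_space M" "\<And>q n. q \<in> grid n \<Longrightarrow> W q \<in> borel_measurable M" "\<And>\<omega>. W 0 \<omega> = 0"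
    "\<And>n m. prob_space.indep_vars M (\<lambda>_. borel) (\<lambda>k \<omega>. W (real (Suc k) / 2 ^ n) \<omega> - W (real k / 2 ^ n) \<omega>) {..<m}"
    "\<And>n k. distr M borel (\<lambda>\<omega>. W (real (Suc k) / 2 ^ n) \<omega> - W (real k / 2 ^ n) \<omega>) = \<nu> n"
proof -
  interpret dyadic_roots \<nu> using assms by unfold_locales
  \<comment> \<open>Subtracting the value at 0 changes no increment and makes \<open>W 0\<close>
    vanish everywhere, not only almost surely.\<close>
  define W where "W q \<omega> = \<omega> q - \<omega> 0" for q and \<omega> :: "real \<Rightarrow> 'a"
  have "0 \<in> grid 0" by (auto simp: grid_def)
  show ?thesis
  proof (rule that[of K.lim W])
    show "prob_space K.lim" by (rule K.P.prob_space_axioms)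
    show "W q \<in> borel_measurable K.lim" if "q \<in> grid n" for q n
      unfolding W_def using that \<open>0 \<in> grid 0\<close>
      by (intro borel_measurable_diff measurable_lim_coordinate) auto
  qed (auto simp: W_def lim_increments simp del: of_nat_Suc)
qed

section \<open>Oscillations of random walks\<close>

text \<open>\<open>osc \<epsilon> D T p a\<close> says that after time \<open>a\<close> there are \<open>p\<close> successive non-overlapping pairs of
  times in \<open>T\<close> with an increment of size more than \<open>\<epsilon>\<close>. Increments rather than paths are the
  argument because only increments are determined by the part of a random walk after \<open>a\<close>.\<close>

primrec osc :: "real \<Rightarrow> ('t::linorder \<Rightarrow> 't \<Rightarrow> 'a::real_normed_vector) \<Rightarrow> 't set \<Rightarrow> nat \<Rightarrow> 't \<Rightarrow> bool" where
  "osc \<epsilon> D T 0 a \<longleftrightarrow> True"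
| "osc \<epsilon> D T (Suc p) a \<longleftrightarrow>
    (\<exists>s\<in>T. \<exists>t\<in>T. a \<le> s \<and> s < t \<and> \<epsilon> < norm (D s t) \<and> osc \<epsilon> D T p t)"

lemma osc_mono:
  assumes "osc \<epsilon> D T p a" "T \<subseteq> T'" "a' \<le> a"
  shows "osc \<epsilon> D T' p a'"
  using assms
proof (induction p arbitrary: a a')
  case (Suc p)
  then obtain s t where "s \<in> T" "t \<in> T" "a \<le> s" "s < t" "\<epsilon> < norm (D s t)" "osc \<epsilon> D T p t" by auto
  moreover have "osc \<epsilon> D T' p t" using Suc.IH[of t t] calculation Suc.prems by simp
  ultimately show ?case unfolding osc.simps using Suc.prems
    by (intro bexI[of _ s] bexI[of _ t] conjI) auto
qed simp

text \<open>Only increments after the starting time enter. Combined with the walk, this makes the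
  event a function of the steps after a, as independence from the past requires.\<close>

lemma osc_cong:
  assumes "\<And>s t. s \<in> T \<Longrightarrow> t \<in> T \<Longrightarrow> a \<le> s \<Longrightarrow> s < t \<Longrightarrow> D s t = D' s t"
  shows "osc \<epsilon> D T p a \<longleftrightarrow> osc \<epsilon> D' T p a"
  using assms
proof (induction p arbitrary: a)
  case (Suc p)
  have "osc \<epsilon> D T p t \<longleftrightarrow> osc \<epsilon> D' T p t" if "a \<le> s" "s < t" for s t
    by (rule Suc.IH) (use Suc.prems that in auto)
  then show ?case using Suc.prems by (auto intro!: bex_cong)
qed simp

lemma osc_image:
  assumes "strict_mono g"
  shows "osc \<epsilon> D (g ` T) p (g a) \<longleftrightarrow> osc \<epsilon> (\<lambda>s t. D (g s) (g t)) T p a"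
  using strict_mono_less[OF assms] strict_mono_less_eq[OF assms]
  by (induction p arbitrary: a) auto

text \<open>A pattern of p pairs involves finitely many times, so it occurs already in one member of
  the sequence. This reduces all dyadic times to grids.\<close>

lemma osc_incseq:
  assumes "incseq T" "osc \<epsilon> D (\<Union>n. T n) p a"
  shows "\<exists>n. osc \<epsilon> D (T n) p a"
  using assms(2)
proof (induction p arbitrary: a)
  case (Suc p)
  then obtain s t i j where st: "s \<in> T i" "t \<in> T j" "a \<le> s" "s < t" "\<epsilon> < norm (D s t)" "osc \<epsilon> D (\<Union>n. T n) p t" by auto
  from Suc.IH[OF st(6)] obtain n where n: "osc \<epsilon> D (T n) p t" by blast
  define m where "m = max n (max i j)"
  have sub: "T i \<subseteq> T m" "T j \<subseteq> T m" "T n \<subseteq> T m" using assms(1) by (auto simp: m_def incseq_def)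
  have "osc \<epsilon> D (T m) p t" by (rule osc_mono[OF n sub(3)]) simp
  then have "osc \<epsilon> D (T m) (Suc p) a" using st sub by auto
  then show ?case by blast
qed simp

lemma osc_measurable:
  fixes D :: "'w \<Rightarrow> 't::linorder \<Rightarrow> 't \<Rightarrow> 'a::euclidean_space"
  assumes "countable T" and "\<And>s t. s \<in> T \<Longrightarrow> t \<in> T \<Longrightarrow> a \<le> s \<Longrightarrow> s < t \<Longrightarrow> (\<lambda>x. D x s t) \<in> borel_measurable M"
  shows "{x \<in> space M. osc \<epsilon> (D x) T p a} \<in> sets M"
  using assms(2)
proof (induction p arbitrary: a)
  case (Suc p)
  let ?S = "{s \<in> T. a \<le> s}" and ?T = "\<lambda>s. {t \<in> T. s < t}"
  have "{x \<in> space M. osc \<epsilon> (D x) T (Suc p) a} =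
    {x \<in> space M. \<exists>s\<in>?S. \<exists>t\<in>?T s. \<epsilon> < norm (D x s t) \<and> osc \<epsilon> (D x) T p t}" by auto
  also have "\<dots> \<in> sets M"
  proof (intro sets.sets_Collect_countable_Ex' sets.sets_Collect_conj)
    fix s t assume st: "s \<in> ?S" "t \<in> ?T s"
    have [measurable]: "(\<lambda>x. D x s t) \<in> borel_measurable M" by (rule Suc.prems) (use st in auto)
    show "{x \<in> space M. \<epsilon> < norm (D x s t)} \<in> sets M" by measurable
    show "{x \<in> space M. osc \<epsilon> (D x) T p t} \<in> sets M"
      by (rule Suc.IH, rule Suc.prems) (use st in auto)
  qed (use assms(1) in \<open>auto intro: countable_subset\<close>)
  finally show ?case .
qed simp

lemma (in prob_space) indep_past_future:
  fixes \<xi> :: "nat \<Rightarrow> 'a \<Rightarrow> 'b::euclidean_space"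
  assumes ind: "indep_vars (\<lambda>_. borel) \<xi> {..<m}" and "k \<le> m"
    and P: "{x \<in> space (PiM {..<k} (\<lambda>_. borel)). P x} \<in> sets (PiM {..<k} (\<lambda>_. borel))"
    and Q: "{x \<in> space (PiM {k..<m} (\<lambda>_. borel)). Q x} \<in> sets (PiM {k..<m} (\<lambda>_. borel))"
  shows "prob {\<omega>\<in>space M. P (restrict (\<lambda>i. \<xi> i \<omega>) {..<k}) \<and> Q (restrict (\<lambda>i. \<xi> i \<omega>) {k..<m})} =
    prob {\<omega>\<in>space M. P (restrict (\<lambda>i. \<xi> i \<omega>) {..<k})} * prob {\<omega>\<in>space M. Q (restrict (\<lambda>i. \<xi> i \<omega>) {k..<m})}"
proof -
  let ?A = "\<lambda>\<omega>. restrict (\<lambda>i. \<xi> i \<omega>) {..<k}" and ?B = "\<lambda>\<omega>. restrict (\<lambda>i. \<xi> i \<omega>) {k..<m}"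
  let ?P = "{x \<in> space (PiM {..<k} (\<lambda>_. borel)). P x}" and ?Q = "{x \<in> space (PiM {k..<m} (\<lambda>_. borel)). Q x}"
  have "indep_var (PiM {..<k} (\<lambda>_. borel)) ?A (PiM {k..<m} (\<lambda>_. borel)) ?B"
    by (rule indep_var_restrict[OF ind]) (use \<open>k \<le> m\<close> in auto)
  from indep_varD[OF this P Q]
  have "prob ((\<lambda>x. (?A x, ?B x)) -` (?P \<times> ?Q) \<inter> space M) = prob (?A -` ?P \<inter> space M) * prob (?B -` ?Q \<inter> space M)" .
  also have "(\<lambda>x. (?A x, ?B x)) -` (?P \<times> ?Q) \<inter> space M = {\<omega>\<in>space M. P (?A \<omega>) \<and> Q (?B \<omega>)}"
    by (auto simp: space_PiM)
  also have "?A -` ?P \<inter> space M = {\<omega>\<in>space M. P (?A \<omega>)}" by (auto simp: space_PiM)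
  also have "?B -` ?Q \<inter> space M = {\<omega>\<in>space M. Q (?B \<omega>)}" by (auto simp: space_PiM)
  finally show ?thesis .
qed

text \<open>Let \<open>\<tau>\<close> be the first time at which the walk is more than \<open>2 \<epsilon>\<close> away from its position at
  time \<open>a\<close>. Ottaviani's inequality bounds the probability that \<open>\<tau>\<close> occurs by \<open>\<alpha> / (1 - \<alpha>)\<close>.
  A first increment of size more than \<open>4 \<epsilon>\<close> forces \<open>\<tau>\<close> to occur before its end, and the remaining
  increments lie in the part of the walk after \<open>\<tau>\<close>, which is independent of the past.\<close>

lemma (in prob_space) prob_osc_le:
  fixes \<xi> :: "nat \<Rightarrow> 'a \<Rightarrow> 'b::euclidean_space"
  assumes ind: "indep_vars (\<lambda>_. borel) \<xi> {..<m}" and \<alpha>: "0 \<le> \<alpha>" "\<alpha> < 1" and \<epsilon>: "0 < \<epsilon>"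
    and small: "\<And>j k. a0 \<le> j \<Longrightarrow> j \<le> k \<Longrightarrow> k \<le> m \<Longrightarrow>
      prob {\<omega>\<in>space M. \<epsilon> < norm (\<Sum>i\<in>{j..<k}. \<xi> i \<omega>)} \<le> \<alpha>"
    and "a0 \<le> a" "a \<le> m"
  shows "prob {\<omega>\<in>space M. osc (4 * \<epsilon>) (\<lambda>j k. \<Sum>i\<in>{j..<k}. \<xi> i \<omega>) {a0..m} p a} \<le> (\<alpha> / (1 - \<alpha>)) ^ p"
  using assms(6,7)
\<comment> \<open>The starting time a varies in the induction while the set of times
  \<open>{a0..m}\<close> stays the same; hence two parameters.\<close>
proof (induction p arbitrary: a)
  case 0
  then show ?case by (simp add: prob_space)
next
  case (Suc p)
  define \<beta> where "\<beta> = \<alpha> / (1 - \<alpha>)"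
  have \<beta>: "\<beta> \<ge> 0" using \<alpha> by (simp add: \<beta>_def)
  have \<xi>[measurable]: "\<xi> i \<in> borel_measurable M" if "i < m" for i using ind that by (auto simp: indep_vars_def)
  define D where "D x j k = (\<Sum>i\<in>{j..<k}. x i :: 'b)" for x :: "nat \<Rightarrow> 'b" and j k :: nat
  define X where "X \<omega> = (\<lambda>i. \<xi> i \<omega>)" for \<omega>
  have D_meas[measurable]: "(\<lambda>\<omega>. D (X \<omega>) j k) \<in> borel_measurable M" if "k \<le> m" for j k
    unfolding D_def X_def using that by (intro borel_measurable_sum \<xi>) auto
  \<comment> \<open>The event that k is the first exit time. Since \<open>D x a k\<close> adds the
    steps with index below k, the event depends on the steps in \<open>{..<k}\<close> only, and the
    walk after time k on those in \<open>{k..<m}\<close>.\<close>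
  define past where "past k x \<longleftrightarrow> 2 * \<epsilon> < norm (D x a k) \<and> (\<forall>i\<in>{a..<k}. norm (D x a i) \<le> 2 * \<epsilon>)" for k x
  define F where "F k = {\<omega>\<in>space M. past k (X \<omega>)}" for k
  have F_meas[measurable]: "F k \<in> sets M" if "k \<le> m" for k
  proof -
    have [measurable]: "(\<lambda>\<omega>. D (X \<omega>) a i) \<in> borel_measurable M" if "i \<in> {a..<k}" for i
      using that \<open>k \<le> m\<close> by (intro D_meas) auto
    have [measurable]: "(\<lambda>\<omega>. D (X \<omega>) a k) \<in> borel_measurable M" using \<open>k \<le> m\<close> by (rule D_meas)
    show ?thesis unfolding F_def past_def by measurable
  qed
  have past_res: "past k (restrict x {..<k}) \<longleftrightarrow> past k x" for k x
  proof -
    have "D (restrict x {..<k}) a i = D x a i" if "i \<le> k" for i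
      unfolding D_def using that by (intro sum.cong) auto
    then show ?thesis by (auto simp: past_def)
  qed
  have F_disj: "disjoint_family_on F {a..m}"
  proof -
    have "F j \<inter> F k = {}" if "j < k" "a \<le> j" for j k
      using that by (force simp: F_def past_def)
    then show ?thesis unfolding disjoint_family_on_def
      by (metis Int_commute atLeastAtMost_iff nat_neq_iff)
  qed
  have split: "prob {\<omega>\<in>space M. past k (X \<omega>) \<and> Q (X \<omega>)} = prob (F k) * prob {\<omega>\<in>space M. Q (X \<omega>)}"
    if k: "k \<in> {a..m}" and Q: "\<And>x. Q (restrict x {k..<m}) \<longleftrightarrow> Q x"
      "{x \<in> space (PiM {k..<m} (\<lambda>_. borel)). Q x} \<in> sets (PiM {k..<m} (\<lambda>_. borel))" for k Q
  proof -
    have [measurable]: "(\<lambda>x. D x a i) \<in> borel_measurable (PiM {..<k} (\<lambda>_. borel))" if "i \<le> k" for i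
      unfolding D_def using that by (intro borel_measurable_sum measurable_component_singleton) auto
    have "{x \<in> space (PiM {..<k} (\<lambda>_. borel)). past k x} \<in> sets (PiM {..<k} (\<lambda>_. borel))"
    proof -
      have [measurable]: "(\<lambda>x. D x a i) \<in> borel_measurable (PiM {..<k} (\<lambda>_. borel))" if "i \<in> {a..<k}" for i
        using that by simp
      show ?thesis unfolding past_def by measurable
    qed
    from indep_past_future[OF ind _ this Q(2)] show ?thesis
      using k by (simp add: past_res Q(1) F_def X_def)
  qed
  have ottaviani: "(\<Sum>k\<in>{a..m}. prob (F k)) \<le> \<beta>"
  proof -
    \<comment> \<open>If the walk exits at k and moves by at most \<epsilon> from k to m, it ends
      more than \<epsilon> away from its position at a. By independence this has at least 1 -
      \<alpha> times the probability of an exit at k, while the disjoint union over k has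
      probability at most \<alpha>.\<close>
    define G where "G k = {\<omega>\<in>space M. past k (X \<omega>) \<and> norm (D (X \<omega>) k m) \<le> \<epsilon>}" for k
    have [measurable]: "(\<lambda>\<omega>. D (X \<omega>) k m) \<in> borel_measurable M" for k by (rule D_meas) simp
    have G_meas: "G k \<in> sets M" if "k \<le> m" for k
    proof -
      have "G k = F k \<inter> {\<omega>\<in>space M. norm (D (X \<omega>) k m) \<le> \<epsilon>}" by (auto simp: G_def F_def)
      then show ?thesis using F_meas[OF that] by simp
    qed
    have one: "(1 - \<alpha>) * prob (F k) \<le> prob (G k)" if k: "k \<in> {a..m}" for k
    proof -
      have "prob (G k) = prob (F k) * prob {\<omega>\<in>space M. norm (D (X \<omega>) k m) \<le> \<epsilon>}"
        unfolding G_def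
      proof (rule split[OF k])
        show "norm (D (restrict x {k..<m}) k m) \<le> \<epsilon> \<longleftrightarrow> norm (D x k m) \<le> \<epsilon>" for x
          by (simp add: D_def)
        have [measurable]: "(\<lambda>x. D x k m) \<in> borel_measurable (PiM {k..<m} (\<lambda>_. borel))"
          unfolding D_def by (intro borel_measurable_sum measurable_component_singleton) auto
        show "{x \<in> space (PiM {k..<m} (\<lambda>_. borel)). norm (D x k m) \<le> \<epsilon>} \<in> sets (PiM {k..<m} (\<lambda>_. borel))"
          by measurable
      qed
      moreover have "{\<omega>\<in>space M. norm (D (X \<omega>) k m) \<le> \<epsilon>} = space M - {\<omega>\<in>space M. \<epsilon> < norm (D (X \<omega>) k m)}" by auto
      then have "prob {\<omega>\<in>space M. norm (D (X \<omega>) k m) \<le> \<epsilon>} = 1 - prob {\<omega>\<in>space M. \<epsilon> < norm (D (X \<omega>) k m)}"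
        by (simp add: prob_compl)
      moreover have "prob {\<omega>\<in>space M. \<epsilon> < norm (D (X \<omega>) k m)} \<le> \<alpha>"
        unfolding D_def X_def by (rule small) (use k Suc.prems in auto)
      ultimately show ?thesis by (simp add: mult.commute[of _ "prob (F k)"] mult_left_mono)
    qed
    have "(1 - \<alpha>) * (\<Sum>k\<in>{a..m}. prob (F k)) \<le> (\<Sum>k\<in>{a..m}. prob (G k))"
      unfolding sum_distrib_left by (intro sum_mono one)
    also have "\<dots> = prob (\<Union>k\<in>{a..m}. G k)"
    proof (rule finite_measure_finite_Union[symmetric])
      show "disjoint_family_on G {a..m}"
        using F_disj unfolding disjoint_family_on_def G_def F_def by blast
    qed (use G_meas in auto)
    also have "\<dots> \<le> prob {\<omega>\<in>space M. \<epsilon> < norm (D (X \<omega>) a m)}"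
    proof (rule finite_measure_mono)
      show "(\<Union>k\<in>{a..m}. G k) \<subseteq> {\<omega>\<in>space M. \<epsilon> < norm (D (X \<omega>) a m)}"
      proof (clarsimp simp: G_def past_def)
        fix \<omega> k assume k: "a \<le> k" "k \<le> m" and big: "2 * \<epsilon> < norm (D (X \<omega>) a k)" and sm: "norm (D (X \<omega>) k m) \<le> \<epsilon>"
        have "D (X \<omega>) a m = D (X \<omega>) a k + D (X \<omega>) k m"
          unfolding D_def using k by (simp add: sum.atLeastLessThan_concat)
        then have "norm (D (X \<omega>) a k) \<le> norm (D (X \<omega>) a m) + norm (D (X \<omega>) k m)"
          by (metis add_diff_cancel_right' norm_triangle_ineq4)
        then show "\<epsilon> < norm (D (X \<omega>) a m)" using big sm by simp
      qed
    qed measurable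
    also have "\<dots> \<le> \<alpha>" unfolding D_def X_def by (rule small) (use Suc.prems in auto)
    finally show ?thesis using \<alpha> by (simp add: \<beta>_def field_simps)
  qed
  define E where "E k = {\<omega>\<in>space M. osc (4 * \<epsilon>) (D (X \<omega>)) {a0..m} p k}" for k
  have FO_meas: "F k \<inter> E k \<in> sets M" if "k \<in> {a..m}" for k
    unfolding E_def using that by (intro sets.Int F_meas osc_measurable D_meas) auto
  have "prob {\<omega>\<in>space M. osc (4 * \<epsilon>) (D (X \<omega>)) {a0..m} (Suc p) a} \<le> prob (\<Union>k\<in>{a..m}. F k \<inter> E k)"
  proof (rule finite_measure_mono)
    show "{\<omega>\<in>space M. osc (4 * \<epsilon>) (D (X \<omega>)) {a0..m} (Suc p) a} \<subseteq> (\<Union>k\<in>{a..m}. F k \<inter> E k)"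
    proof safe
      fix \<omega> assume \<omega>: "\<omega> \<in> space M" and "osc (4 * \<epsilon>) (D (X \<omega>)) {a0..m} (Suc p) a"
      then obtain s t where st: "s \<in> {a0..m}" "t \<in> {a0..m}" "a \<le> s" "s < t" "4 * \<epsilon> < norm (D (X \<omega>) s t)"
        "osc (4 * \<epsilon>) (D (X \<omega>)) {a0..m} p t" by auto
      have "D (X \<omega>) a t = D (X \<omega>) a s + D (X \<omega>) s t"
        unfolding D_def using st by (simp add: sum.atLeastLessThan_concat)
      then have "norm (D (X \<omega>) s t) \<le> norm (D (X \<omega>) a t) + norm (D (X \<omega>) a s)"
        by (metis add_diff_cancel_left' norm_triangle_ineq4)
      then have "2 * \<epsilon> < norm (D (X \<omega>) a t) \<or> 2 * \<epsilon> < norm (D (X \<omega>) a s)" using st(5) by linarith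
      then have ex: "\<exists>k. a \<le> k \<and> k \<le> t \<and> 2 * \<epsilon> < norm (D (X \<omega>) a k)"
      proof
        assume "2 * \<epsilon> < norm (D (X \<omega>) a t)"
        then show ?thesis using st by (intro exI[of _ t]) auto
      next
        assume "2 * \<epsilon> < norm (D (X \<omega>) a s)"
        then show ?thesis using st by (intro exI[of _ s]) auto
      qed
      define k where "k = (LEAST k. a \<le> k \<and> k \<le> t \<and> 2 * \<epsilon> < norm (D (X \<omega>) a k))"
      have k: "a \<le> k" "k \<le> t" "2 * \<epsilon> < norm (D (X \<omega>) a k)" using LeastI_ex[OF ex] by (auto simp: k_def)
      have "norm (D (X \<omega>) a i) \<le> 2 * \<epsilon>" if "i \<in> {a..<k}" for i
        using not_less_Least[of i "\<lambda>k. a \<le> k \<and> k \<le> t \<and> 2 * \<epsilon> < norm (D (X \<omega>) a k)"] that k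
        by (auto simp: k_def[symmetric] not_less)
      then have "\<omega> \<in> F k" using \<omega> k by (auto simp: F_def past_def)
      \<comment> \<open>The remaining pairs come after t, hence after the exit time k as
        well.\<close>
      moreover have "\<omega> \<in> E k" using osc_mono[OF st(6) subset_refl k(2)] \<omega> by (simp add: E_def)
      ultimately show "\<omega> \<in> (\<Union>k\<in>{a..m}. F k \<inter> E k)" using k st by auto
    qed
  qed (use FO_meas in auto)
  also have "\<dots> \<le> (\<Sum>k\<in>{a..m}. prob (F k \<inter> E k))"
    by (rule finite_measure_subadditive_finite) (use FO_meas in auto)
  also have "\<dots> \<le> (\<Sum>k\<in>{a..m}. prob (F k) * \<beta> ^ p)"
  proof (rule sum_mono)
    fix k assume k: "k \<in> {a..m}"
    have "F k \<inter> E k = {\<omega>\<in>space M. past k (X \<omega>) \<and> osc (4 * \<epsilon>) (D (X \<omega>)) {a0..m} p k}"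
      by (auto simp: F_def E_def)
    also have "prob \<dots> = prob (F k) * prob (E k)"
      unfolding E_def
    proof (rule split[OF k])
      show "osc (4 * \<epsilon>) (D (restrict x {k..<m})) {a0..m} p k \<longleftrightarrow> osc (4 * \<epsilon>) (D x) {a0..m} p k" for x
        by (rule osc_cong) (auto simp: D_def intro!: sum.cong)
      show "{x \<in> space (PiM {k..<m} (\<lambda>_. borel)). osc (4 * \<epsilon>) (D x) {a0..m} p k} \<in> sets (PiM {k..<m} (\<lambda>_. borel))"
        unfolding D_def by (intro osc_measurable borel_measurable_sum measurable_component_singleton) auto
    qed
    also have "\<dots> \<le> prob (F k) * \<beta> ^ p"
      using Suc.IH[of k] k Suc.prems unfolding E_def D_def X_def \<beta>_def by (intro mult_left_mono) auto
    finally show "prob (F k \<inter> E k) \<le> prob (F k) * \<beta> ^ p" .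
  qed
  also have "\<dots> = (\<Sum>k\<in>{a..m}. prob (F k)) * \<beta> ^ p" by (simp add: sum_distrib_right)
  also have "\<dots> \<le> \<beta> * \<beta> ^ p" using ottaviani \<beta> by (intro mult_right_mono) auto
  finally have "prob {\<omega>\<in>space M. osc (4 * \<epsilon>) (D (X \<omega>)) {a0..m} (Suc p) a} \<le> \<beta> * \<beta> ^ p" .
  moreover have "D (X \<omega>) = (\<lambda>j k. \<Sum>i\<in>{j..<k}. \<xi> i \<omega>)" for \<omega>
    by (simp add: D_def X_def fun_eq_iff)
  ultimately show ?case by (simp only: power_Suc \<beta>_def)
qed

section \<open>Increments over small times, and independence of limits\<close>

lemma exp_near_1:
  assumes "0 < \<eta>"
  obtains r where "0 < r" "\<And>w::complex. norm w < r \<Longrightarrow> norm (exp w - 1) < \<eta>"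
proof -
  have "isCont (exp :: complex \<Rightarrow> complex) 0" by (rule isCont_exp)
  then show ?thesis
    using assms that unfolding continuous_at_eps_delta by (auto simp: dist_norm)
qed

text \<open>For small t, exp (t \<psi>) is close to 1 uniformly on a ball. The law \<kappa> is
  arbitrary, so that one \<delta> serves the partial sums on every grid and the increments of the
  limit process.\<close>

lemma exponent_small_time:
  fixes \<psi> :: "'a::euclidean_space \<Rightarrow> complex"
  assumes \<psi>: "continuous_on UNIV \<psi>" and "0 < \<epsilon>" "0 < \<alpha>"
  obtains \<delta> where "0 < \<delta>"
    "\<And>\<kappa> t. \<kappa> \<in> distributions \<Longrightarrow> 0 \<le> t \<Longrightarrow> t \<le> \<delta> \<Longrightarrow>
      (\<And>z. char_fun \<kappa> z = exp (of_real t * \<psi> z)) \<Longrightarrow> measure \<kappa> {x. \<epsilon> < norm x} \<le> \<alpha>"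
proof -
  obtain u \<eta> where u: "0 < u" "0 < \<eta>"
    "\<And>\<kappa> :: 'a measure. \<kappa> \<in> distributions \<Longrightarrow>
      (\<And>z. norm z \<le> u \<Longrightarrow> norm (char_fun \<kappa> z - 1) \<le> \<eta>) \<Longrightarrow> measure \<kappa> {x. norm x > \<epsilon>} \<le> \<alpha>"
    using char_fun_near_1_imp_small[OF assms(2,3)] by blast
  have "bounded (\<psi> ` cball 0 u)"
    using \<psi> by (intro compact_imp_bounded compact_continuous_image) (auto intro: continuous_on_subset)
  then obtain B where B: "0 < B" "\<And>z. norm z \<le> u \<Longrightarrow> norm (\<psi> z) \<le> B"
    by (auto simp: bounded_pos)
  obtain r where r: "0 < r" "\<And>w::complex. norm w < r \<Longrightarrow> norm (exp w - 1) < \<eta>"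
    using exp_near_1[OF u(2)] by blast
  show ?thesis
  \<comment> \<open>With B bounding \<psi> on the ball of radius u, this keeps t \<psi> within r /
    2, strictly inside the radius r.\<close>
  proof (rule that[of "r / (2 * B)"])
    show "0 < r / (2 * B)" using r B by simp
    fix \<kappa> :: "'a measure" and t
    assume \<kappa>: "\<kappa> \<in> distributions" and t: "0 \<le> t" "t \<le> r / (2 * B)"
      and eq: "\<And>z. char_fun \<kappa> z = exp (of_real t * \<psi> z)"
    show "measure \<kappa> {x. \<epsilon> < norm x} \<le> \<alpha>"
    proof (rule u(3)[OF \<kappa>])
      fix z :: 'a assume "norm z \<le> u"
      then have "t * norm (\<psi> z) \<le> r / (2 * B) * B" using t B r by (intro mult_mono) auto
      also have "\<dots> < r" using r B by simp
      finally have "norm (of_real t * \<psi> z) < r" using t by (simp add: norm_mult)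
      then show "norm (char_fun \<kappa> z - 1) \<le> \<eta>" using r(2) by (simp add: eq less_imp_le)
    qed
  qed
qed

text \<open>Dominated convergence carries the product formula over to the limit for continuous
  functions. Closed sets come second, through continuous approximations of their indicators, because
  an indicator need not converge along X.\<close>

lemma (in prob_space) indep_vars_limit:
  fixes X :: "nat \<Rightarrow> 'i \<Rightarrow> 'a \<Rightarrow> 'b::euclidean_space"
  assumes I: "finite I" and ind: "\<And>m. indep_vars (\<lambda>_. borel) (X m) I"
    and Y: "\<And>i. i \<in> I \<Longrightarrow> Y i \<in> borel_measurable M"
    and lim: "\<And>i. i \<in> I \<Longrightarrow> AE \<omega> in M. (\<lambda>m. X m i \<omega>) \<longlonglongrightarrow> Y i \<omega>"
  shows "indep_vars (\<lambda>_. borel) Y I"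
proof (cases "I = {}")
  case True
  then show ?thesis by (simp add: indep_vars_def indep_sets_def)
next
  case False
  have X: "X m i \<in> borel_measurable M" if "i \<in> I" for m i using ind that by (auto simp: indep_vars_def)
  have lims: "AE \<omega> in M. \<forall>i\<in>I. (\<lambda>m. X m i \<omega>) \<longlonglongrightarrow> Y i \<omega>"
    using I lim by (simp add: AE_finite_all)
  have cont: "(\<integral>\<omega>. (\<Prod>i\<in>I. f i (Y i \<omega>)) \<partial>M) = (\<Prod>i\<in>I. (\<integral>\<omega>. f i (Y i \<omega>) \<partial>M))"
    if f: "\<And>i. continuous_on UNIV (f i)" "\<And>i x. 0 \<le> f i x" "\<And>i x. f i x \<le> 1" for f :: "'i \<Rightarrow> 'b \<Rightarrow> real"
  proof -
    have [measurable]: "f i \<in> borel_measurable borel" for i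
      using f(1) by (rule borel_measurable_continuous_onI)
    have fX[measurable]: "(\<lambda>\<omega>. f i (X m i \<omega>)) \<in> borel_measurable M" if "i \<in> I" for i m
      using X[OF that] by measurable
    have fY[measurable]: "(\<lambda>\<omega>. f i (Y i \<omega>)) \<in> borel_measurable M" if "i \<in> I" for i
      using Y[OF that] by measurable
    have bounded: "\<bar>f i x\<bar> \<le> 1" for i x using f(2,3) by simp
    have prod_le: "\<bar>\<Prod>i\<in>I. f i (x i)\<bar> \<le> 1" for x
      unfolding abs_prod by (rule prod_le_1) (use bounded in auto)
    have eq: "(\<integral>\<omega>. (\<Prod>i\<in>I. f i (X m i \<omega>)) \<partial>M) = (\<Prod>i\<in>I. (\<integral>\<omega>. f i (X m i \<omega>) \<partial>M))" for m
    proof (rule indep_vars_lebesgue_integral[OF I])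
      show "indep_vars (\<lambda>_. borel) (\<lambda>i \<omega>. f i (X m i \<omega>)) I"
        by (rule indep_vars_compose2[OF ind]) auto
      show "integrable M (\<lambda>\<omega>. f i (X m i \<omega>))" if "i \<in> I" for i
        by (rule integrable_const_bound[where B=1]) (use fX[OF that] bounded in auto)
    qed
    have tends: "(\<lambda>m. f i (X m i \<omega>)) \<longlonglongrightarrow> f i (Y i \<omega>)" if "(\<lambda>m. X m i \<omega>) \<longlonglongrightarrow> Y i \<omega>" for i \<omega>
      by (rule continuous_on_tendsto_compose[OF f(1) that]) auto
    have "(\<lambda>m. \<integral>\<omega>. (\<Prod>i\<in>I. f i (X m i \<omega>)) \<partial>M) \<longlonglongrightarrow> (\<integral>\<omega>. (\<Prod>i\<in>I. f i (Y i \<omega>)) \<partial>M)"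
    proof (rule integral_dominated_convergence[where w="\<lambda>_. 1"])
      show "AE \<omega> in M. (\<lambda>m. \<Prod>i\<in>I. f i (X m i \<omega>)) \<longlonglongrightarrow> (\<Prod>i\<in>I. f i (Y i \<omega>))"
        using lims by eventually_elim (intro tendsto_prod tends, auto)
    qed (use prod_le in \<open>auto intro!: borel_measurable_prod\<close>)
    moreover have "(\<lambda>m. \<Prod>i\<in>I. (\<integral>\<omega>. f i (X m i \<omega>) \<partial>M)) \<longlonglongrightarrow> (\<Prod>i\<in>I. (\<integral>\<omega>. f i (Y i \<omega>) \<partial>M))"
    proof (intro tendsto_prod integral_dominated_convergence[where w="\<lambda>_. 1"])
      fix i assume i: "i \<in> I"
      show "AE \<omega> in M. (\<lambda>m. f i (X m i \<omega>)) \<longlonglongrightarrow> f i (Y i \<omega>)"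
        using lim[OF i] by eventually_elim (rule tends)
    qed (use bounded in auto)
    ultimately show ?thesis unfolding eq using LIMSEQ_unique by blast
  qed
  show ?thesis
  proof (subst indep_vars_finite[where E="\<lambda>_. Collect closed", OF False I])
    show "sets borel = sigma_sets (space borel) (Collect closed)" by (simp add: borel_eq_closed)
    show "Int_stable (Collect closed)" by (auto simp: Int_stable_def)
    show "\<forall>A\<in>I \<rightarrow> Collect closed. prob (\<Inter>j\<in>I. Y j -` A j \<inter> space M) = (\<Prod>j\<in>I. prob (Y j -` A j \<inter> space M))"
    proof
      fix A assume A: "A \<in> I \<rightarrow> Collect (closed :: 'b set \<Rightarrow> bool)"
      \<comment> \<open>The empty set outside of I makes every \<open>C i\<close> closed, so that
        approximations can be chosen for all i at once.\<close>
      define C where "C i = (if i \<in> I then A i else {})" for i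
      have C: "closed (C i)" for i using A by (auto simp: C_def)
      then have [measurable]: "C i \<in> sets borel" for i by simp
      have "\<exists>f. (\<forall>n. continuous_on UNIV (f n)) \<and> (\<forall>n x. 0 \<le> f n x) \<and> (\<forall>n x. f n x \<le> 1) \<and>
          (\<forall>x. (\<lambda>n. f n x :: real) \<longlonglongrightarrow> indicator (C i) x)" for i
        by (rule closed_indicator_approx[OF C[of i]]) blast
      then obtain f where f: "\<And>i n. continuous_on UNIV (f i n)" "\<And>i n x. 0 \<le> f i n x" "\<And>i n x. f i n x \<le> 1"
        "\<And>i x. (\<lambda>n. f i n x :: real) \<longlonglongrightarrow> indicator (C i) x" by metis
      have [measurable]: "f i n \<in> borel_measurable borel" for i n
        using f(1) by (rule borel_measurable_continuous_onI)
      have fY[measurable]: "(\<lambda>\<omega>. f i n (Y i \<omega>)) \<in> borel_measurable M" if "i \<in> I" for i n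
        using Y[OF that] by measurable
      have cY[measurable]: "(\<lambda>\<omega>. indicator (C i) (Y i \<omega>) :: real) \<in> borel_measurable M" if "i \<in> I" for i
        using Y[OF that] by measurable
      have bounded: "\<bar>f i n x\<bar> \<le> 1" for i n x using f(2,3) by simp
      have prod_le: "\<bar>\<Prod>i\<in>I. f i n (x i)\<bar> \<le> 1" for x n
        unfolding abs_prod by (rule prod_le_1) (use bounded in auto)
      have "(\<lambda>n. \<integral>\<omega>. (\<Prod>i\<in>I. f i n (Y i \<omega>)) \<partial>M) \<longlonglongrightarrow> (\<integral>\<omega>. (\<Prod>i\<in>I. indicator (C i) (Y i \<omega>)) \<partial>M)"
        by (rule integral_dominated_convergence[where w="\<lambda>_. 1"])
           (use prod_le f(4) in \<open>auto intro!: borel_measurable_prod tendsto_prod\<close>)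
      moreover have "(\<lambda>n. \<Prod>i\<in>I. (\<integral>\<omega>. f i n (Y i \<omega>) \<partial>M)) \<longlonglongrightarrow> (\<Prod>i\<in>I. (\<integral>\<omega>. indicator (C i) (Y i \<omega>) \<partial>M))"
        by (intro tendsto_prod integral_dominated_convergence[where w="\<lambda>_. 1"]) (use bounded f(4) in auto)
      moreover have "(\<integral>\<omega>. (\<Prod>i\<in>I. f i n (Y i \<omega>)) \<partial>M) = (\<Prod>i\<in>I. (\<integral>\<omega>. f i n (Y i \<omega>) \<partial>M))" for n
        by (rule cont) (use f in auto)
      ultimately have "(\<integral>\<omega>. (\<Prod>i\<in>I. indicator (C i) (Y i \<omega>)) \<partial>M) = (\<Prod>i\<in>I. (\<integral>\<omega>. indicator (C i) (Y i \<omega>) \<partial>M) :: real)"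
        using LIMSEQ_unique by simp
      moreover have "(\<integral>\<omega>. indicator (C i) (Y i \<omega>) \<partial>M) = prob (Y i -` A i \<inter> space M)" if "i \<in> I" for i
      proof -
        have "(\<integral>\<omega>. indicator (C i) (Y i \<omega>) \<partial>M) = (\<integral>\<omega>. indicat_real (Y i -` A i \<inter> space M) \<omega> \<partial>M)"
          by (rule Bochner_Integration.integral_cong) (use that in \<open>auto simp: C_def indicator_def\<close>)
        then show ?thesis by simp
      qed
      moreover have "(\<integral>\<omega>. (\<Prod>i\<in>I. indicator (C i) (Y i \<omega>)) \<partial>M) = prob (\<Inter>j\<in>I. Y j -` A j \<inter> space M)"
      proof -
        have "(\<integral>\<omega>. (\<Prod>i\<in>I. indicator (C i) (Y i \<omega>)) \<partial>M) = (\<integral>\<omega>. indicat_real (\<Inter>j\<in>I. Y j -` A j \<inter> space M) \<omega> \<partial>M)"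
        proof (rule Bochner_Integration.integral_cong[OF refl])
          fix \<omega> assume "\<omega> \<in> space M"
          then show "(\<Prod>i\<in>I. indicator (C i) (Y i \<omega>)) = indicat_real (\<Inter>j\<in>I. Y j -` A j \<inter> space M) \<omega>"
            using I by (cases "\<forall>i\<in>I. Y i \<omega> \<in> A i")
              (auto simp: C_def indicator_def)
        qed
        moreover have "(\<Inter>j\<in>I. Y j -` A j \<inter> space M) \<inter> space M = (\<Inter>j\<in>I. Y j -` A j \<inter> space M)"
          using False by auto
        ultimately show ?thesis by simp
      qed
      ultimately show "prob (\<Inter>j\<in>I. Y j -` A j \<inter> space M) = (\<Prod>j\<in>I. prob (Y j -` A j \<inter> space M))"
        by simp
    qed
  qed (use Y in auto)
qed

section \<open>Levy processes with cadlag paths\<close>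

abbreviation dyadics :: "real set" where
  "dyadics \<equiv> \<Union>n. grid n"

abbreviation block :: "real \<Rightarrow> nat \<Rightarrow> real set" where
  "block \<delta> c \<equiv> dyadics \<inter> {real c * \<delta>..real (Suc c) * \<delta>}"

text \<open>The successor of the floor, rather than the ceiling, makes the approximation strictly
  larger than t even when t is itself a grid point. Right limits need this.\<close>

definition upper_index :: "nat \<Rightarrow> real \<Rightarrow> nat" where
  "upper_index n t = Suc (nat \<lfloor>t * 2 ^ n\<rfloor>)"

definition upper_dyadic :: "nat \<Rightarrow> real \<Rightarrow> real" where
  "upper_dyadic n t = real (upper_index n t) / 2 ^ n"

lemma upper_dyadic_in_grid: "upper_dyadic n t \<in> grid n"
  by (auto simp: upper_dyadic_def grid_def)

lemma upper_index_mono: "s \<le> t \<Longrightarrow> upper_index n s \<le> upper_index n t"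
  unfolding upper_index_def by (intro Suc_le_mono[THEN iffD2] nat_mono floor_mono mult_right_mono) auto

lemma upper_dyadic_bounds:
  assumes "0 \<le> t"
  shows "t < upper_dyadic n t" "upper_dyadic n t \<le> t + 1 / 2 ^ n"
proof -
  have eq: "real (upper_index n t) = of_int \<lfloor>t * 2 ^ n\<rfloor> + 1"
    using assms by (simp add: upper_index_def)
  have "t * 2 ^ n < real (upper_index n t)" unfolding eq by linarith
  then show "t < upper_dyadic n t" by (simp add: upper_dyadic_def field_simps)
  have "real (upper_index n t) \<le> t * 2 ^ n + 1" unfolding eq by linarith
  then show "upper_dyadic n t \<le> t + 1 / 2 ^ n" by (simp add: upper_dyadic_def field_simps)
qed

lemma upper_dyadic_tendsto:
  assumes "0 \<le> t"
  shows "(\<lambda>n. upper_dyadic n t) \<longlonglongrightarrow> t"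
    and "filterlim (\<lambda>n. upper_dyadic n t) (at t within (dyadics \<inter> {t<..})) sequentially"
proof -
  have "(\<lambda>n. t + 1 / 2 ^ n) \<longlonglongrightarrow> t + 0"
    by (intro tendsto_intros) (rule LIMSEQ_divide_realpow_zero, simp)
  then have lim: "(\<lambda>n. t + 1 / 2 ^ n) \<longlonglongrightarrow> t" by simp
  show *: "(\<lambda>n. upper_dyadic n t) \<longlonglongrightarrow> t"
    by (rule tendsto_sandwich[OF _ _ tendsto_const lim])
       (use upper_dyadic_bounds[OF assms] in \<open>auto intro!: always_eventually less_imp_le\<close>)
  show "filterlim (\<lambda>n. upper_dyadic n t) (at t within (dyadics \<inter> {t<..})) sequentially"
    unfolding filterlim_at using * upper_dyadic_bounds(1)[OF assms] upper_dyadic_in_grid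
    by (auto intro!: always_eventually)
       (metis less_irrefl)
qed

section \<open>One-sided limits along the dyadic numbers\<close>

lemma cauchy_filter_limit:
  fixes f :: "'b \<Rightarrow> 'a::complete_space"
  assumes "\<And>e. 0 < e \<Longrightarrow> \<exists>P. eventually P F \<and> (\<forall>x y. P x \<and> P y \<longrightarrow> dist (f x) (f y) < e)"
  shows "\<exists>L. (f \<longlongrightarrow> L) F"
proof (cases "F = bot")
  case False
  have "cauchy_filter (filtermap f F)"
    unfolding cauchy_filter_metric_filtermap using assms by blast
  moreover have "filtermap f F \<noteq> bot" using False by (simp add: filtermap_bot_iff)
  moreover have "filtermap f F \<le> principal UNIV" by simp
  ultimately have "\<exists>L\<in>UNIV. filtermap f F \<le> nhds L"
    using complete_UNIV[where 'a='a, unfolded complete_uniform, rule_format] by blast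
  then show ?thesis by (simp add: filterlim_def)
qed simp

text \<open>In each block the number of disjoint large increments is bounded. The block length may
  depend on i because the probability estimate holds only for blocks so short that increments above
  the given size are unlikely; the bound p may vary from block to block.\<close>

definition regular_path :: "(real \<Rightarrow> 'a::real_normed_vector) \<Rightarrow> bool" where
  "regular_path w \<longleftrightarrow> (\<forall>i::nat. \<exists>\<delta>>0. \<forall>c::nat. \<exists>p.
    \<not> osc (1 / Suc i) (\<lambda>s t. w t - w s) (block \<delta> c) p (real c * \<delta>))"

text \<open>Otherwise every right neighbourhood of t contains a large increment. Given p pairs after
  some a > t, one more fits between t and a. The pairs accumulate at t inside a single block, which
  regularity forbids.\<close>

lemma regular_path_close_right:
  assumes w: "regular_path w" and t: "0 \<le> t" and e: "0 < e"
  shows "\<exists>u>t. \<forall>q\<in>dyadics \<inter> {t<..<u}. \<forall>r\<in>dyadics \<inter> {t<..<u}. norm (w r - w q) < e"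
proof (rule ccontr)
  assume neg: "\<not> ?thesis"
  obtain i :: nat where i: "1 / Suc i < e" using e nat_approx_posE by blast
  obtain \<delta> where \<delta>: "\<delta> > 0" "\<And>c::nat. \<exists>p. \<not> osc (1 / Suc i) (\<lambda>s t. w t - w s)
      (block \<delta> c) p (real c * \<delta>)"
    using w unfolding regular_path_def by blast
  define c where "c = nat \<lfloor>t / \<delta>\<rfloor>"
  have "real c = of_int \<lfloor>t / \<delta>\<rfloor>" using t \<delta> by (simp add: c_def)
  then have "real c \<le> t / \<delta>" "t / \<delta> < real c + 1" by linarith+
  then have c: "real c * \<delta> \<le> t" "t < real (Suc c) * \<delta>" using \<delta> by (auto simp: field_simps)
  let ?T = "block \<delta> c"
  let ?osc = "osc (1 / Suc i) (\<lambda>s t. w t - w s) ?T"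
  have "\<exists>a>t. ?osc p a" for p
  proof (induction p)
    case 0 show ?case by (auto intro: exI[of _ "t + 1"])
  next
    case (Suc p)
    then obtain a where a: "a > t" "?osc p a" by blast
    define u where "u = min a (real (Suc c) * \<delta>)"
    have "u > t" using a c by (simp add: u_def)
    define S where "S = dyadics \<inter> {t<..<u}"
    have "\<not> (\<forall>q\<in>S. \<forall>r\<in>S. norm (w r - w q) < e)"
      using neg[unfolded not_ex, rule_format, of u] \<open>u > t\<close> by (simp add: S_def)
    then obtain q r where "q \<in> S" "r \<in> S" "\<not> norm (w r - w q) < e" by blast
    then have qr: "q \<in> dyadics" "t < q" "q < u" "r \<in> dyadics" "t < r" "r < u" "e \<le> norm (w r - w q)"
      by (auto simp: S_def)
    define x y where "x = min q r" and "y = max q r"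
    have "q \<noteq> r" using qr(7) e by auto
    then have xy: "x \<in> dyadics" "y \<in> dyadics" "t < x" "x < y" "y < u" "e \<le> norm (w y - w x)"
      using qr by (auto simp: x_def y_def min_def max_def norm_minus_commute)
    have "?osc p y" by (rule osc_mono[OF a(2) subset_refl]) (use xy in \<open>simp add: u_def\<close>)
    moreover have "x \<in> ?T" "y \<in> ?T" using xy c by (auto simp: u_def)
    ultimately have "?osc (Suc p) x"
      unfolding osc.simps using xy i by (intro bexI[of _ x] bexI[of _ y] conjI) auto
    then show ?case using xy by blast
  qed
  have "?osc p (real c * \<delta>)" for p
  proof -
    obtain a where a: "a > t" "?osc p a" using \<open>\<And>p. \<exists>a>t. ?osc p a\<close> by blast
    show ?thesis by (rule osc_mono[OF a(2) subset_refl]) (use a(1) c in simp)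
  qed
  then show False using \<delta>(2)[of c] by blast
qed

text \<open>Here large increments accumulate at t from below: after each pair another one fits
  between its end and t. Pairs are found in increasing order, hence an induction over all starting
  points a < t.\<close>

lemma regular_path_close_left:
  assumes w: "regular_path w" and t: "0 < t" and e: "0 < e"
  shows "\<exists>u<t. \<forall>q\<in>dyadics \<inter> {u<..<t}. \<forall>r\<in>dyadics \<inter> {u<..<t}. norm (w r - w q) < e"
proof (rule ccontr)
  assume neg: "\<not> ?thesis"
  obtain i :: nat where i: "1 / Suc i < e" using e nat_approx_posE by blast
  obtain \<delta> where \<delta>: "\<delta> > 0" "\<And>c::nat. \<exists>p. \<not> osc (1 / Suc i) (\<lambda>s t. w t - w s)
      (block \<delta> c) p (real c * \<delta>)"
    using w unfolding regular_path_def by blast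
  \<comment> \<open>This block satisfies c \<delta> < t, so it contains a left neighbourhood of t
    even when t is an end of a block.\<close>
  define c where "c = nat (\<lceil>t / \<delta>\<rceil> - 1)"
  have "0 < \<lceil>t / \<delta>\<rceil>" using t \<delta> by simp
  then have "real c = of_int \<lceil>t / \<delta>\<rceil> - 1" by (simp add: c_def)
  then have "real c < t / \<delta>" "t / \<delta> \<le> real c + 1" by linarith+
  then have c: "real c * \<delta> < t" "t \<le> real (Suc c) * \<delta>" using \<delta> by (auto simp: field_simps)
  let ?T = "block \<delta> c"
  let ?osc = "osc (1 / Suc i) (\<lambda>s t. w t - w s) ?T"
  have "?osc p a" if "a < t" for p a
    using that
  proof (induction p arbitrary: a)
    case (Suc p)
    define u where "u = max a (real c * \<delta>)"
    have "u < t" using Suc.prems c by (simp add: u_def)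
    define S where "S = dyadics \<inter> {u<..<t}"
    have "\<not> (\<forall>q\<in>S. \<forall>r\<in>S. norm (w r - w q) < e)"
      using neg[unfolded not_ex, rule_format, of u] \<open>u < t\<close> by (simp add: S_def)
    then obtain q r where "q \<in> S" "r \<in> S" "\<not> norm (w r - w q) < e" by blast
    then have qr: "q \<in> dyadics" "u < q" "q < t" "r \<in> dyadics" "u < r" "r < t" "e \<le> norm (w r - w q)"
      by (auto simp: S_def)
    define x y where "x = min q r" and "y = max q r"
    have "q \<noteq> r" using qr(7) e by auto
    then have xy: "x \<in> dyadics" "y \<in> dyadics" "u < x" "x < y" "y < t" "e \<le> norm (w y - w x)"
      using qr by (auto simp: x_def y_def min_def max_def norm_minus_commute)
    have "?osc p y" by (rule Suc.IH) (rule xy)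
    moreover have "x \<in> ?T" "y \<in> ?T" using xy c by (auto simp: u_def)
    ultimately show "?osc (Suc p) a"
      unfolding osc.simps using xy i by (intro bexI[of _ x] bexI[of _ y] conjI) (auto simp: u_def)
  qed simp
  then show False using \<delta>(2)[of c] c by blast
qed

lemma regular_path_right_limit:
  fixes w :: "real \<Rightarrow> 'a::euclidean_space"
  assumes w: "regular_path w" and t: "0 \<le> t"
  shows "\<exists>L. (w \<longlongrightarrow> L) (at t within (dyadics \<inter> {t<..}))"
proof (rule cauchy_filter_limit)
  fix e :: real assume "0 < e"
  from regular_path_close_right[OF w t this] obtain u
    where u: "u > t" "\<forall>q\<in>dyadics \<inter> {t<..<u}. \<forall>r\<in>dyadics \<inter> {t<..<u}. norm (w r - w q) < e"
    by (elim exE conjE)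
  have "eventually (\<lambda>q. q \<in> dyadics \<inter> {t<..<u}) (at t within (dyadics \<inter> {t<..}))"
    unfolding eventually_at using u(1) by (intro exI[of _ "u - t"]) (auto simp: dist_real_def)
  then show "\<exists>P. eventually P (at t within (dyadics \<inter> {t<..})) \<and> (\<forall>x y. P x \<and> P y \<longrightarrow> dist (w x) (w y) < e)"
    using u(2) by (intro exI[of _ "\<lambda>q. q \<in> dyadics \<inter> {t<..<u}"] conjI allI impI) (auto simp only: dist_norm)
qed

lemma regular_path_left_limit:
  fixes w :: "real \<Rightarrow> 'a::euclidean_space"
  assumes w: "regular_path w" and t: "0 < t"
  shows "\<exists>L. (w \<longlongrightarrow> L) (at t within (dyadics \<inter> {..<t}))"
proof (rule cauchy_filter_limit)
  fix e :: real assume "0 < e"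
  from regular_path_close_left[OF w t this] obtain u
    where u: "u < t" "\<forall>q\<in>dyadics \<inter> {u<..<t}. \<forall>r\<in>dyadics \<inter> {u<..<t}. norm (w r - w q) < e"
    by (elim exE conjE)
  have "eventually (\<lambda>q. q \<in> dyadics \<inter> {u<..<t}) (at t within (dyadics \<inter> {..<t}))"
    unfolding eventually_at using u(1) by (intro exI[of _ "t - u"]) (auto simp: dist_real_def)
  then show "\<exists>P. eventually P (at t within (dyadics \<inter> {..<t})) \<and> (\<forall>x y. P x \<and> P y \<longrightarrow> dist (w x) (w y) < e)"
    using u(2) by (intro exI[of _ "\<lambda>q. q \<in> dyadics \<inter> {u<..<t}"] conjI allI impI) (auto simp only: dist_norm)
qed

text \<open>Each value of x is a limit of w along dyadics just to the right. Closeness of w to a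
  point on the dyadics of an open interval therefore passes to x on that interval, and with it both
  kinds of limit.\<close>

lemma cadlag_path_right_limits:
  fixes w x :: "real \<Rightarrow> 'a::euclidean_space"
  assumes r: "\<And>t. 0 \<le> t \<Longrightarrow> (w \<longlongrightarrow> x t) (at t within (dyadics \<inter> {t<..}))"
    and l: "\<And>t. 0 < t \<Longrightarrow> \<exists>L. (w \<longlongrightarrow> L) (at t within (dyadics \<inter> {..<t}))"
  shows "cadlag_path x"
proof -
  have key: "dist (x s) L \<le> e"
    if s: "0 \<le> s" "u < s" "s < v" and near: "\<And>q. q \<in> dyadics \<Longrightarrow> u < q \<Longrightarrow> q < v \<Longrightarrow> dist (w q) L \<le> e"
    for s u v L e
  proof -
    have "(\<lambda>n. w (upper_dyadic n s)) \<longlonglongrightarrow> x s"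
      by (rule filterlim_compose[OF r upper_dyadic_tendsto(2)]) (use s in auto)
    then have lim: "(\<lambda>n. dist (w (upper_dyadic n s)) L) \<longlonglongrightarrow> dist (x s) L" by (intro tendsto_intros)
    have "eventually (\<lambda>n. upper_dyadic n s < v) sequentially"
      using order_tendstoD(2)[OF upper_dyadic_tendsto(1)[OF s(1)] s(3)] .
    then have "eventually (\<lambda>n. dist (w (upper_dyadic n s)) L \<le> e) sequentially"
    proof eventually_elim
      case (elim n)
      then show ?case
        using upper_dyadic_bounds(1)[OF s(1), of n] s(2) upper_dyadic_in_grid[of n s] by (intro near) auto
    qed
    then show ?thesis by (rule tendsto_upperbound[OF lim]) simp
  qed
  show ?thesis unfolding cadlag_path_def
  proof safe
    fix t :: real assume t: "0 \<le> t"
    show "(x \<longlongrightarrow> x t) (at_right t)"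
    proof (rule tendstoI)
      fix e :: real assume "0 < e"
      then have "eventually (\<lambda>q. dist (w q) (x t) < e / 2) (at t within (dyadics \<inter> {t<..}))"
        by (intro tendstoD[OF r[OF t]]) simp
      then obtain d where d: "d > 0" "\<And>q. q \<in> dyadics \<Longrightarrow> t < q \<Longrightarrow> q < t + d \<Longrightarrow> dist (w q) (x t) < e / 2"
        unfolding eventually_at by (force simp: dist_real_def)
      have "dist (x s) (x t) < e" if "t < s" "s < t + d" for s
        using key[of s t "t + d" "x t" "e / 2"] that t d(2) \<open>0 < e\<close> by (fastforce intro: less_imp_le)
      then show "eventually (\<lambda>s. dist (x s) (x t) < e) (at_right t)"
        unfolding eventually_at_right_field using d(1) by (intro exI[of _ "t + d"]) auto
    qed
  next
    fix t :: real assume t: "0 < t"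
    then obtain L where L: "(w \<longlongrightarrow> L) (at t within (dyadics \<inter> {..<t}))" using l by blast
    show "\<exists>l. (x \<longlongrightarrow> l) (at_left t)"
    proof (intro exI tendstoI)
      fix e :: real assume "0 < e"
      then have "eventually (\<lambda>q. dist (w q) L < e / 2) (at t within (dyadics \<inter> {..<t}))"
        by (intro tendstoD[OF L]) simp
      then obtain d where d: "d > 0" "\<And>q. q \<in> dyadics \<Longrightarrow> t - d < q \<Longrightarrow> q < t \<Longrightarrow> dist (w q) L < e / 2"
        unfolding eventually_at by (force simp: dist_real_def)
      have "dist (x s) L < e" if "max 0 (t - d) < s" "s < t" for s
        using key[of s "t - d" t L "e / 2"] that t d(2) \<open>0 < e\<close> by (fastforce intro: less_imp_le)
      then show "eventually (\<lambda>s. dist (x s) L < e) (at_left t)"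
        unfolding eventually_at_left_field using d(1) t by (intro exI[of _ "max 0 (t - d)"]) auto
    qed
  qed
qed

section \<open>The process of right limits of a dyadic walk\<close>

lemma (in prob_space) char_fun_AE_limit:
  fixes X :: "nat \<Rightarrow> 'a \<Rightarrow> 'b::euclidean_space"
  assumes [measurable]: "\<And>n. X n \<in> borel_measurable M" "Y \<in> borel_measurable M"
    and lim: "AE \<omega> in M. (\<lambda>n. X n \<omega>) \<longlonglongrightarrow> Y \<omega>"
  shows "(\<lambda>n. char_fun (distr M borel (X n)) z) \<longlonglongrightarrow> char_fun (distr M borel Y) z"
proof -
  have "(\<lambda>n. \<integral>\<omega>. iexp (z \<bullet> X n \<omega>) \<partial>M) \<longlonglongrightarrow> (\<integral>\<omega>. iexp (z \<bullet> Y \<omega>) \<partial>M)"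
  proof (rule integral_dominated_convergence[where w="\<lambda>_. 1"])
    show "AE \<omega> in M. (\<lambda>n. iexp (z \<bullet> X n \<omega>)) \<longlonglongrightarrow> iexp (z \<bullet> Y \<omega>)"
      using lim by eventually_elim (intro tendsto_intros)
  qed auto
  then show ?thesis by (simp add: char_fun_distr)
qed

locale dyadic_levy_walk = prob_space M for M :: "'w measure" +
  fixes W :: "real \<Rightarrow> 'w \<Rightarrow> 'a::euclidean_space" and \<psi> :: "'a \<Rightarrow> complex"
  assumes W_measurable: "q \<in> grid n \<Longrightarrow> W q \<in> borel_measurable M"
    and indep_increments:
      "indep_vars (\<lambda>_. borel) (\<lambda>k \<omega>. W (real (Suc k) / 2 ^ n) \<omega> - W (real k / 2 ^ n) \<omega>) {..<m}"
    and char_fun_increment: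
      "char_fun (distr M borel (\<lambda>\<omega>. W (real (Suc k) / 2 ^ n) \<omega> - W (real k / 2 ^ n) \<omega>)) z = exp (\<psi> z / 2 ^ n)"
    and continuous_\<psi>: "continuous_on UNIV \<psi>"
begin

definition incr :: "nat \<Rightarrow> nat \<Rightarrow> 'w \<Rightarrow> 'a" where
  "incr n k \<omega> = W (real (Suc k) / 2 ^ n) \<omega> - W (real k / 2 ^ n) \<omega>"

lemma sum_incr:
  assumes "j \<le> k"
  shows "(\<Sum>i\<in>{j..<k}. incr n i \<omega>) = W (real k / 2 ^ n) \<omega> - W (real j / 2 ^ n) \<omega>"
  unfolding incr_def using sum_Suc_diff'[OF assms, of "\<lambda>k. W (real k / 2 ^ n) \<omega>"] .

lemma indep_incr: "indep_vars (\<lambda>_. borel) (incr n) {..<m}"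
  using indep_increments[of n m] by (simp add: incr_def[abs_def])

lemma incr_measurable [measurable]: "incr n k \<in> borel_measurable M"
  using indep_incr[of n "Suc k"] by (auto simp: indep_vars_def)

lemma char_fun_sum_incr:
  assumes "j \<le> k"
  shows "char_fun (distr M borel (\<lambda>\<omega>. \<Sum>i\<in>{j..<k}. incr n i \<omega>)) z =
    exp (of_real (real k / 2 ^ n - real j / 2 ^ n) * \<psi> z)"
proof -
  have ind: "indep_vars (\<lambda>_. borel) (incr n) {j..<k}"
    by (rule indep_vars_subset[OF indep_incr[of n k]]) auto
  have "char_fun (distr M borel (\<lambda>\<omega>. \<Sum>i\<in>{j..<k}. incr n i \<omega>)) z = (\<Prod>i\<in>{j..<k}. exp (\<psi> z / 2 ^ n))"
    unfolding char_fun_sum_indep[OF finite_atLeastLessThan ind]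
    using char_fun_increment by (simp add: incr_def[abs_def])
  also have "\<dots> = exp (of_nat (k - j) * (\<psi> z / 2 ^ n))"
    unfolding exp_of_nat_mult by simp
  also have "of_nat (k - j) * (\<psi> z / 2 ^ n) = of_real (real k / 2 ^ n - real j / 2 ^ n) * \<psi> z"
    using assms by (simp add: of_nat_diff field_simps)
  finally show ?thesis .
qed

lemma char_fun_W_diff:
  assumes "j \<le> k"
  shows "char_fun (distr M borel (\<lambda>\<omega>. W (real k / 2 ^ n) \<omega> - W (real j / 2 ^ n) \<omega>)) z =
    exp (of_real (real k / 2 ^ n - real j / 2 ^ n) * \<psi> z)"
  using char_fun_sum_incr[OF assms, of n z] by (simp only: sum_incr[OF assms])

definition osc_event :: "real \<Rightarrow> real \<Rightarrow> nat \<Rightarrow> nat \<Rightarrow> 'w set" where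
  "osc_event \<epsilon> \<delta> c p =
    {\<omega>\<in>space M. osc \<epsilon> (\<lambda>s t. W t \<omega> - W s \<omega>) (block \<delta> c) p (real c * \<delta>)}"

text \<open>The bound 1/4 for single increments gives (1/4) / (1 - 1/4) = 1/3 in
  \<open>prob_osc_le\<close>, uniformly over all grids. Continuity from below extends the estimate
  to all dyadic times of the block.\<close>

lemma prob_osc_dyadics_le:
  assumes \<epsilon>: "0 < \<epsilon>"
    and \<delta>: "\<And>\<kappa> t. \<kappa> \<in> distributions \<Longrightarrow> 0 \<le> t \<Longrightarrow> t \<le> 1 / 2 ^ l \<Longrightarrow>
      (\<And>z. char_fun \<kappa> z = exp (of_real t * \<psi> z)) \<Longrightarrow> measure \<kappa> {x. \<epsilon> < norm x} \<le> 1 / 4"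
  shows "osc_event (4 * \<epsilon>) (1 / 2 ^ l) c p \<in> sets M"
    and "prob (osc_event (4 * \<epsilon>) (1 / 2 ^ l) c p) \<le> (1 / 3) ^ p"
proof -
  let ?I = "{real c * (1 / 2 ^ l)..real (Suc c) * (1 / 2 ^ l)}" and ?a = "real c * (1 / 2 ^ l)"
  let ?D = "\<lambda>\<omega> s t. W t \<omega> - W s \<omega>" and ?A = "osc_event (4 * \<epsilon>) (1 / 2 ^ l) c p"
  \<comment> \<open>From level l on the ends of the block are grid points: at level n + l they have
    the indices c 2^n and (c + 1) 2^n.\<close>
  define T where "T n = grid (n + l) \<inter> ?I" for n
  have inc: "incseq T"
  proof (rule incseq_SucI)
    show "T n \<subseteq> T (Suc n)" for n using grid_Suc[of "n + l"] by (auto simp: T_def)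
  qed
  have T_UN: "(\<Union>n. T n) = dyadics \<inter> ?I"
  proof
    show "dyadics \<inter> ?I \<subseteq> (\<Union>n. T n)"
    proof
      fix q assume q: "q \<in> dyadics \<inter> ?I"
      then obtain n where "q \<in> grid n" by blast
      then have "q \<in> T n" using grid_mono[of n "n + l"] q by (auto simp: T_def)
      then show "q \<in> (\<Union>n. T n)" by blast
    qed
  qed (auto simp: T_def)
  have countable: "countable (T n)" for n by (auto simp: T_def grid_def)
  define B where "B n = {\<omega>\<in>space M. osc (4 * \<epsilon>) (?D \<omega>) (T n) p ?a}" for n
  have B_sets: "B n \<in> sets M" for n
    unfolding B_def by (intro osc_measurable countable borel_measurable_diff W_measurable[of _ "n + l"]) (auto simp: T_def)
  have B_inc: "incseq B"
    using inc by (auto simp: incseq_def B_def intro: osc_mono)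
  have A_eq: "?A = (\<Union>n. B n)"
  proof
    show "?A \<subseteq> (\<Union>n. B n)" unfolding osc_event_def T_UN[symmetric]
    proof
      fix \<omega> assume "\<omega> \<in> {\<omega>\<in>space M. osc (4 * \<epsilon>) (?D \<omega>) (\<Union>n. T n) p ?a}"
      then have \<omega>: "\<omega> \<in> space M" "osc (4 * \<epsilon>) (?D \<omega>) (\<Union>n. T n) p ?a" by simp_all
      from osc_incseq[OF inc \<omega>(2)] obtain n where "osc (4 * \<epsilon>) (?D \<omega>) (T n) p ?a" by (rule exE)
      with \<omega>(1) have "\<omega> \<in> B n" by (simp add: B_def)
      then show "\<omega> \<in> (\<Union>n. B n)" by blast
    qed
    show "(\<Union>n. B n) \<subseteq> ?A" unfolding osc_event_def T_UN[symmetric]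
    proof
      fix \<omega> assume "\<omega> \<in> (\<Union>n. B n)"
      then obtain n where "\<omega> \<in> B n" by blast
      then have \<omega>: "\<omega> \<in> space M" "osc (4 * \<epsilon>) (?D \<omega>) (T n) p ?a" by (simp_all add: B_def)
      have "osc (4 * \<epsilon>) (?D \<omega>) (\<Union>n. T n) p ?a" by (rule osc_mono[OF \<omega>(2)]) auto
      with \<omega>(1) show "\<omega> \<in> {\<omega>\<in>space M. osc (4 * \<epsilon>) (?D \<omega>) (\<Union>n. T n) p ?a}" by simp
    qed
  qed
  show "?A \<in> sets M" unfolding A_eq using B_sets by auto
  have bound: "prob (B n) \<le> (1 / 3) ^ p" for n
  proof -
    define g where "g k = real k / 2 ^ (n + l)" for k :: nat
    have g: "strict_mono g" by (auto simp: strict_mono_def g_def divide_strict_right_mono)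
    define a m where "a = c * 2 ^ n" and "m = Suc c * 2 ^ n"
    have ga: "g a = ?a" and gm: "g m = real (Suc c) * (1 / 2 ^ l)"
      by (simp_all add: g_def a_def m_def power_add field_simps)
    have "T n = g ` {a..m}"
    proof
      show "T n \<subseteq> g ` {a..m}"
      proof
        fix q assume "q \<in> T n"
        then obtain k where k: "q = g k" "g a \<le> g k" "g k \<le> g m"
          unfolding ga gm by (auto simp: T_def grid_def g_def)
        then show "q \<in> g ` {a..m}" using strict_mono_less_eq[OF g] by auto
      qed
      show "g ` {a..m} \<subseteq> T n"
      proof
        fix q assume "q \<in> g ` {a..m}"
        then obtain k where k: "q = g k" "a \<le> k" "k \<le> m" by auto
        then have "g a \<le> q" "q \<le> g m" using strict_mono_less_eq[OF g] by auto
        moreover have "q \<in> grid (n + l)" using k by (auto simp: g_def grid_def)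
        ultimately show "q \<in> T n" unfolding ga gm T_def by simp
      qed
    qed
    then have "osc (4 * \<epsilon>) (?D \<omega>) (T n) p ?a \<longleftrightarrow> osc (4 * \<epsilon>) (\<lambda>j k. ?D \<omega> (g j) (g k)) {a..m} p a" for \<omega>
      unfolding ga[symmetric] using osc_image[OF g] by simp
    also have "osc (4 * \<epsilon>) (\<lambda>j k. ?D \<omega> (g j) (g k)) {a..m} p a \<longleftrightarrow>
        osc (4 * \<epsilon>) (\<lambda>j k. \<Sum>i\<in>{j..<k}. incr (n + l) i \<omega>) {a..m} p a" for \<omega>
      by (rule osc_cong) (simp add: sum_incr g_def)
    finally have eq: "B n = {\<omega>\<in>space M. osc (4 * \<epsilon>) (\<lambda>j k. \<Sum>i\<in>{j..<k}. incr (n + l) i \<omega>) {a..m} p a}"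
      by (simp add: B_def)
    have "prob (B n) \<le> ((1 / 4) / (1 - 1 / 4)) ^ p"
      unfolding eq
    proof (rule prob_osc_le[OF indep_incr _ _ \<epsilon>])
      fix j k assume jk: "a \<le> j" "j \<le> k" "k \<le> m"
      let ?S = "\<lambda>\<omega>. \<Sum>i\<in>{j..<k}. incr (n + l) i \<omega>"
      have "g k - g j \<le> g m - g a" using jk strict_mono_less_eq[OF g] by (intro diff_mono) auto
      also have "\<dots> = 1 / 2 ^ l" unfolding ga gm by (simp add: field_simps)
      finally have le: "real k / 2 ^ (n + l) - real j / 2 ^ (n + l) \<le> 1 / 2 ^ l" by (simp add: g_def)
      have ge: "0 \<le> real k / 2 ^ (n + l) - real j / 2 ^ (n + l)" using jk by (simp add: divide_right_mono)
      have "measure (distr M borel ?S) {x. \<epsilon> < norm x} \<le> 1 / 4"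
        by (rule \<delta>[OF _ ge le char_fun_sum_incr]) (use jk in \<open>auto intro!: distr_in_distributions prob_space_axioms\<close>)
      also have "measure (distr M borel ?S) {x. \<epsilon> < norm x} = prob {\<omega>\<in>space M. \<epsilon> < norm (?S \<omega>)}"
        by (subst measure_distr) (auto simp: vimage_def intro!: arg_cong[where f=prob])
      finally show "prob {\<omega>\<in>space M. \<epsilon> < norm (?S \<omega>)} \<le> 1 / 4" .
    qed (auto simp: a_def m_def)
    then show ?thesis by simp
  qed
  have "(\<lambda>n. prob (B n)) \<longlonglongrightarrow> prob ?A"
    unfolding A_eq by (rule finite_Lim_measure_incseq) (use B_sets B_inc in auto)
  then show "prob ?A \<le> (1 / 3) ^ p" by (rule LIMSEQ_le_const2) (use bound in auto)
qed

lemma AE_regular_path: "AE \<omega> in M. regular_path (\<lambda>t. W t \<omega>)"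
  unfolding regular_path_def AE_all_countable
proof
  fix i :: nat
  \<comment> \<open>The factor 4 compensates the one in \<open>prob_osc_le\<close>.\<close>
  define \<epsilon> where "\<epsilon> = 1 / (4 * real (Suc i))"
  have \<epsilon>: "0 < \<epsilon>" "4 * \<epsilon> = 1 / real (Suc i)" by (auto simp: \<epsilon>_def field_simps)
  obtain \<delta> where \<delta>: "0 < \<delta>"
    "\<And>\<kappa> t. \<kappa> \<in> distributions \<Longrightarrow> 0 \<le> t \<Longrightarrow> t \<le> \<delta> \<Longrightarrow>
      (\<And>z. char_fun \<kappa> z = exp (of_real t * \<psi> z)) \<Longrightarrow> measure \<kappa> {x. \<epsilon> < norm x} \<le> 1 / 4"
    using exponent_small_time[OF continuous_\<psi> \<epsilon>(1), of "1/4"] by (metis zero_less_divide_1_iff zero_less_numeral)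
  obtain l where l: "(1 / 2) ^ l < \<delta>" using real_arch_pow_inv[OF \<delta>(1), of "1/2"] by auto
  define A where "A = osc_event (4 * \<epsilon>) (1 / 2 ^ l)"
  have A: "A c p \<in> sets M" "prob (A c p) \<le> (1 / 3) ^ p" for c p
  proof -
    have *: "\<And>\<kappa> t. \<kappa> \<in> distributions \<Longrightarrow> 0 \<le> t \<Longrightarrow> t \<le> 1 / 2 ^ l \<Longrightarrow>
      (\<And>z. char_fun \<kappa> z = exp (of_real t * \<psi> z)) \<Longrightarrow> measure \<kappa> {x. \<epsilon> < norm x} \<le> 1 / 4"
      using \<delta>(2) l by (simp add: power_one_over)
    show "A c p \<in> sets M" unfolding A_def by (rule prob_osc_dyadics_le(1)[OF \<epsilon>(1) *])
    show "prob (A c p) \<le> (1 / 3) ^ p" unfolding A_def by (rule prob_osc_dyadics_le(2)[OF \<epsilon>(1) *])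
  qed
  have "AE \<omega> in M. \<exists>p. \<omega> \<notin> A c p" for c
  proof -
    have "prob (\<Inter>p. A c p) \<le> (1 / 3) ^ p" for p
      by (rule order_trans[OF finite_measure_mono A(2)]) (use A in auto)
    moreover have "(\<lambda>p. (1 / 3 :: real) ^ p) \<longlonglongrightarrow> 0" by (rule LIMSEQ_power_zero) simp
    ultimately have "prob (\<Inter>p. A c p) \<le> 0" by (intro LIMSEQ_le_const) auto
    then have "prob (\<Inter>p. A c p) = 0" by (simp add: measure_le_0_iff)
    then have "(\<Inter>p. A c p) \<in> null_sets M" using A by (auto simp: null_sets_def emeasure_eq_measure)
    from AE_not_in[OF this] show ?thesis by simp
  qed
  then have "AE \<omega> in M. \<forall>c. \<exists>p. \<omega> \<notin> A c p" by (simp add: AE_all_countable)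
  then show "AE \<omega> in M. \<exists>\<delta>>0. \<forall>c::nat. \<exists>p.
    \<not> osc (1 / Suc i) (\<lambda>s t. W t \<omega> - W s \<omega>) (block \<delta> c) p (real c * \<delta>)"
  proof (rule AE_mp, intro AE_I2 impI)
    fix \<omega> assume "\<omega> \<in> space M" "\<forall>c. \<exists>p. \<omega> \<notin> A c p"
    then show "\<exists>\<delta>>0. \<forall>c::nat. \<exists>p.
      \<not> osc (1 / Suc i) (\<lambda>s t. W t \<omega> - W s \<omega>) (block \<delta> c) p (real c * \<delta>)"
      unfolding A_def osc_event_def \<epsilon>(2) by (intro exI[of _ "1 / 2 ^ l"]) auto
  qed
qed

text \<open>The limit is taken along one sequence of times, the same for all paths, which makes
  \<open>X t\<close> measurable. On regular paths it is the right limit along all dyadics.\<close>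

definition X :: "real \<Rightarrow> 'w \<Rightarrow> 'a" where
  "X t \<omega> = lim (\<lambda>n. W (upper_dyadic n t) \<omega>)"

lemma W_upper_measurable [measurable]: "W (upper_dyadic n t) \<in> borel_measurable M"
  by (rule W_measurable[OF upper_dyadic_in_grid])

lemma X_measurable [measurable]: "X t \<in> borel_measurable M"
  unfolding X_def[abs_def] by measurable

lemma regular_path_X:
  assumes "regular_path (\<lambda>t. W t \<omega>)" "0 \<le> t"
  shows "((\<lambda>t. W t \<omega>) \<longlongrightarrow> X t \<omega>) (at t within (dyadics \<inter> {t<..}))"
    and "(\<lambda>n. W (upper_dyadic n t) \<omega>) \<longlonglongrightarrow> X t \<omega>"
proof -
  obtain L where L: "((\<lambda>t. W t \<omega>) \<longlongrightarrow> L) (at t within (dyadics \<inter> {t<..}))"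
    using regular_path_right_limit[OF assms] by blast
  have lim: "(\<lambda>n. W (upper_dyadic n t) \<omega>) \<longlonglongrightarrow> L"
    by (rule filterlim_compose[OF L upper_dyadic_tendsto(2)[OF assms(2)]])
  then have "X t \<omega> = L" unfolding X_def by (rule limI)
  with L lim show "((\<lambda>t. W t \<omega>) \<longlongrightarrow> X t \<omega>) (at t within (dyadics \<inter> {t<..}))"
    "(\<lambda>n. W (upper_dyadic n t) \<omega>) \<longlonglongrightarrow> X t \<omega>" by simp_all
qed

lemma AE_cadlag: "AE \<omega> in M. cadlag_path (\<lambda>t. X t \<omega>)"
  using AE_regular_path
  by eventually_elim (rule cadlag_path_right_limits[OF regular_path_X(1) regular_path_left_limit])

lemma AE_X_limit: "0 \<le> t \<Longrightarrow> AE \<omega> in M. (\<lambda>n. W (upper_dyadic n t) \<omega>) \<longlonglongrightarrow> X t \<omega>"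
  using AE_regular_path by (auto elim!: eventually_mono intro: regular_path_X(2))

lemma AE_X_diff_limit:
  assumes "0 \<le> s" "0 \<le> t"
  shows "AE \<omega> in M. (\<lambda>n. W (upper_dyadic n t) \<omega> - W (upper_dyadic n s) \<omega>) \<longlonglongrightarrow> X t \<omega> - X s \<omega>"
  using AE_X_limit[OF assms(1)] AE_X_limit[OF assms(2)] by eventually_elim (rule tendsto_diff)

lemma char_fun_X_diff:
  assumes "0 \<le> s" "s \<le> t"
  shows "char_fun (distr M borel (\<lambda>\<omega>. X t \<omega> - X s \<omega>)) z = exp (of_real (t - s) * \<psi> z)"
proof -
  have "0 \<le> t" using assms by simp
  let ?D = "\<lambda>n \<omega>. W (upper_dyadic n t) \<omega> - W (upper_dyadic n s) \<omega>"
  have "(\<lambda>n. char_fun (distr M borel (?D n)) z) \<longlonglongrightarrow> char_fun (distr M borel (\<lambda>\<omega>. X t \<omega> - X s \<omega>)) z"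
    by (rule char_fun_AE_limit[OF _ _ AE_X_diff_limit[OF assms(1) \<open>0 \<le> t\<close>]]) measurable
  moreover have "char_fun (distr M borel (?D n)) z = exp (of_real (upper_dyadic n t - upper_dyadic n s) * \<psi> z)" for n
    unfolding upper_dyadic_def by (rule char_fun_W_diff[OF upper_index_mono[OF assms(2)]])
  moreover have "(\<lambda>n. exp (of_real (upper_dyadic n t - upper_dyadic n s) * \<psi> z)) \<longlonglongrightarrow> exp (of_real (t - s) * \<psi> z)"
    by (intro tendsto_intros upper_dyadic_tendsto(1) assms(1) \<open>0 \<le> t\<close>)
  ultimately show ?thesis using LIMSEQ_unique by simp
qed

lemma indep_X_increments:
  assumes t0: "0 \<le> t 0" and t: "\<And>i. i < n \<Longrightarrow> t i < t (Suc i)"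
  shows "indep_vars (\<lambda>_. borel) (\<lambda>i \<omega>. X (t (Suc i)) \<omega> - X (t i) \<omega>) {..<n}"
proof (rule indep_vars_limit[where X="\<lambda>m i \<omega>. W (upper_dyadic m (t (Suc i))) \<omega> - W (upper_dyadic m (t i)) \<omega>"])
  have mono: "t i \<le> t j" if "i \<le> j" "j \<le> n" for i j
    using that by (induction j rule: dec_induct) (auto intro: order_trans[OF _ less_imp_le[OF t]])
  have pos: "0 \<le> t i" if "i \<le> n" for i using mono[of 0 i] that t0 by simp
  show "AE \<omega> in M. (\<lambda>m. W (upper_dyadic m (t (Suc i))) \<omega> - W (upper_dyadic m (t i)) \<omega>)
      \<longlonglongrightarrow> X (t (Suc i)) \<omega> - X (t i) \<omega>" if "i \<in> {..<n}" for i
    by (rule AE_X_diff_limit) (use that pos in auto)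
  fix m
  define a where "a i = upper_index m (t i)" for i
  have a: "a i \<le> a j" if "i \<le> j" "j \<le> n" for i j
    unfolding a_def by (rule upper_index_mono) (rule mono[OF that])
  \<comment> \<open>On a coarse grid neighbouring times may have the same upper index. The block is
    then empty and the increment is 0.\<close>
  define K where "K i = {a i..<a (Suc i)}" for i
  have "K i \<inter> K j = {}" if "i < j" "j < n" for i j
    using a[of "Suc i" j] that by (auto simp: K_def)
  then have disj: "disjoint_family_on K {..<n}"
    unfolding disjoint_family_on_def by (metis Int_commute lessThan_iff nat_neq_iff)
  have "indep_vars (\<lambda>i. PiM (K i) (\<lambda>_. borel)) (\<lambda>i \<omega>. restrict (\<lambda>k. incr m k \<omega>) (K i)) {..<n}"
  proof (rule indep_vars_restrict[OF indep_incr[of m "a n"] _ disj])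
    fix i assume "i \<in> {..<n}"
    then show "K i \<subseteq> {..<a n}" using a[of "Suc i" n] by (auto simp: K_def)
  qed
  then have "indep_vars (\<lambda>_. borel) (\<lambda>i \<omega>. (\<lambda>x. \<Sum>k\<in>K i. x k) (restrict (\<lambda>k. incr m k \<omega>) (K i))) {..<n}"
    by (rule indep_vars_compose2) measurable
  moreover have "(\<Sum>k\<in>K i. restrict (\<lambda>k. incr m k \<omega>) (K i) k) =
      W (upper_dyadic m (t (Suc i))) \<omega> - W (upper_dyadic m (t i)) \<omega>" if "i < n" for i \<omega>
    using sum_incr[OF a[of i "Suc i"], of m \<omega>] that by (simp add: K_def upper_dyadic_def a_def)
  ultimately show "indep_vars (\<lambda>_. borel)
      (\<lambda>i \<omega>. W (upper_dyadic m (t (Suc i))) \<omega> - W (upper_dyadic m (t i)) \<omega>) {..<n}"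
    by (subst indep_vars_cong[where J="{..<n}"]) (auto simp: fun_eq_iff)
qed auto

lemma X_diff_in_distributions: "distr M borel (\<lambda>\<omega>. X t \<omega> - X s \<omega>) \<in> distributions"
  by (intro distr_in_distributions prob_space_axioms) measurable

lemma stochastically_continuous:
  assumes s: "0 \<le> s"
  shows "tendsto_in_prob M X (X s) (at s within {0..})"
  unfolding tendsto_in_prob_def
proof safe
  fix \<epsilon> :: real assume \<epsilon>: "0 < \<epsilon>"
  show "((\<lambda>t. prob {\<omega> \<in> space M. norm (X t \<omega> - X s \<omega>) > \<epsilon>}) \<longlongrightarrow> 0) (at s within {0..})"
  proof (rule tendstoI)
    fix e :: real assume e: "0 < e"
    obtain \<delta> where \<delta>: "0 < \<delta>"
      "\<And>\<kappa> t. \<kappa> \<in> distributions \<Longrightarrow> 0 \<le> t \<Longrightarrow> t \<le> \<delta> \<Longrightarrow>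
        (\<And>z. char_fun \<kappa> z = exp (of_real t * \<psi> z)) \<Longrightarrow> measure \<kappa> {x. \<epsilon> < norm x} \<le> e / 2"
      using exponent_small_time[OF continuous_\<psi> \<epsilon>, of "e / 2"] e by (metis half_gt_zero)
    have le: "prob {\<omega> \<in> space M. norm (X v \<omega> - X u \<omega>) > \<epsilon>} \<le> e / 2" if "0 \<le> u" "u \<le> v" "v \<le> u + \<delta>" for u v
    proof -
      have "measure (distr M borel (\<lambda>\<omega>. X v \<omega> - X u \<omega>)) {x. \<epsilon> < norm x} \<le> e / 2"
        by (rule \<delta>(2)[OF X_diff_in_distributions _ _ char_fun_X_diff]) (use that in auto)
      also have "measure (distr M borel (\<lambda>\<omega>. X v \<omega> - X u \<omega>)) {x. \<epsilon> < norm x} =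
          prob {\<omega> \<in> space M. norm (X v \<omega> - X u \<omega>) > \<epsilon>}"
        by (subst measure_distr) (auto simp: vimage_def intro!: arg_cong[where f=prob])
      finally show ?thesis .
    qed
    have "prob {\<omega> \<in> space M. norm (X t \<omega> - X s \<omega>) > \<epsilon>} \<le> e / 2" if "0 \<le> t" "dist t s < \<delta>" for t
    proof (cases "s \<le> t")
      case True
      then show ?thesis using that s by (intro le) (auto simp: dist_real_def)
    next
      case False
      then show ?thesis using that s le[of t s] by (auto simp: dist_real_def norm_minus_commute)
    qed
    then show "eventually (\<lambda>t. dist (prob {\<omega> \<in> space M. norm (X t \<omega> - X s \<omega>) > \<epsilon>}) 0 < e) (at s within {0..})"
      unfolding eventually_at using \<delta>(1) e by (intro exI[of _ \<delta>]) fastforce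
  qed
qed

lemma stationary:
  assumes "0 \<le> s" "0 \<le> t"
  shows "distr M borel (\<lambda>\<omega>. X (s + t) \<omega> - X s \<omega>) = distr M borel (\<lambda>\<omega>. X t \<omega> - X 0 \<omega>)"
proof (rule char_fun_unique[OF X_diff_in_distributions X_diff_in_distributions])
  fix z
  show "char_fun (distr M borel (\<lambda>\<omega>. X (s + t) \<omega> - X s \<omega>)) z =
      char_fun (distr M borel (\<lambda>\<omega>. X t \<omega> - X 0 \<omega>)) z"
    using char_fun_X_diff[of s "s + t" z] char_fun_X_diff[of 0 t z] assms by simp
qed

lemma char_fun_X:
  assumes W0: "\<And>\<omega>. W 0 \<omega> = 0" and t: "0 \<le> t"
  shows "char_fun (distr M borel (X t)) z = exp (of_real t * \<psi> z)"
proof -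
  have "(\<lambda>n. char_fun (distr M borel (W (upper_dyadic n t))) z) \<longlonglongrightarrow> char_fun (distr M borel (X t)) z"
    by (rule char_fun_AE_limit[OF _ _ AE_X_limit[OF t]]) measurable
  moreover have "char_fun (distr M borel (W (upper_dyadic n t))) z = exp (of_real (upper_dyadic n t) * \<psi> z)" for n
    unfolding upper_dyadic_def using char_fun_W_diff[of 0 "upper_index n t" n z] by (simp add: W0)
  moreover have "(\<lambda>n. exp (of_real (upper_dyadic n t) * \<psi> z)) \<longlonglongrightarrow> exp (of_real t * \<psi> z)"
    by (intro tendsto_intros upper_dyadic_tendsto(1) t)
  ultimately show ?thesis using LIMSEQ_unique by simp
qed

text \<open>As \<open>X 0\<close> is a limit along positive times, the value of \<open>W 0\<close>
  does not decide it; but its characteristic function is constantly 1, so its law is the unit mass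
  at 0.\<close>

lemma AE_X_0:
  assumes "\<And>\<omega>. W 0 \<omega> = 0"
  shows "AE \<omega> in M. X 0 \<omega> = 0"
proof -
  have "distr M borel (X 0) = return borel 0"
    by (rule char_fun_unique[OF distr_in_distributions[OF prob_space_axioms X_measurable] return_in_distributions])
       (simp add: char_fun_X[OF assms] char_fun_return)
  moreover have "AE x in return borel 0. x = (0::'a)" by (subst AE_return) auto
  ultimately have "AE x in distr M borel (X 0). x = 0" by (simp only:)
  then show ?thesis by (subst (asm) AE_distr_iff) auto
qed

lemma levy_process_X:
  assumes "\<And>\<omega>. W 0 \<omega> = 0"
  shows "levy_process M X"
  unfolding levy_process_def
  using prob_space_axioms X_measurable AE_X_0[OF assms] indep_X_increments stationary
    stochastically_continuous AE_cadlag by simp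

end

text \<open>Taking all roots of order 2^n from the same exponent makes them compatible, since the
  square of exp (\<psi> / 2^(n+1)) is exp (\<psi> / 2^n).\<close>

theorem levy_process_exists:
  fixes \<mu> :: "'a::ordered_euclidean_space measure"
  assumes \<mu>: "\<mu> \<in> inf_divisible" and \<psi>: "levy_exponent \<mu> \<psi>"
  obtains M :: "(real \<Rightarrow> 'a) measure" and X where
    "levy_process M X" "\<And>t z. 0 \<le> t \<Longrightarrow> char_fun (distr M borel (X t)) z = exp (of_real t * \<psi> z)"
proof -
  have "\<exists>\<nu>. \<nu> \<in> distributions \<and> (\<forall>z. char_fun \<nu> z = exp (\<psi> z / 2 ^ n))" for n :: nat
    using levy_exponent_root_exists[OF \<mu> \<psi>, of "2 ^ n"] by auto
  then obtain \<nu> where \<nu>: "\<And>n. \<nu> n \<in> distributions" "\<And>n z. char_fun (\<nu> n) z = exp (\<psi> z / 2 ^ n)" by metis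
  have sq: "char_fun (\<nu> (Suc n)) z ^ 2 = char_fun (\<nu> n) z" for n z
    unfolding \<nu>(2) by (simp add: exp_double[symmetric])
  show ?thesis
  proof (rule dyadic_levy_walk_exists[where \<nu>=\<nu>, OF \<nu>(1) sq])
    fix M :: "(real \<Rightarrow> 'a) measure" and W
    assume M: "prob_space M" and W: "\<And>q n. q \<in> grid n \<Longrightarrow> W q \<in> borel_measurable M" "\<And>\<omega>. W 0 \<omega> = 0"
      "\<And>n m. prob_space.indep_vars M (\<lambda>_. borel) (\<lambda>k \<omega>. W (real (Suc k) / 2 ^ n) \<omega> - W (real k / 2 ^ n) \<omega>) {..<m}"
      "\<And>n k. distr M borel (\<lambda>\<omega>. W (real (Suc k) / 2 ^ n) \<omega> - W (real k / 2 ^ n) \<omega>) = \<nu> n"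
    interpret dyadic_levy_walk M W \<psi>
    proof (intro dyadic_levy_walk.intro dyadic_levy_walk_axioms.intro M W)
      show "continuous_on UNIV \<psi>" using \<psi> by (simp add: levy_exponent_def)
      fix n k z
      show "char_fun (distr M borel (\<lambda>\<omega>. W (real (Suc k) / 2 ^ n) \<omega> - W (real k / 2 ^ n) \<omega>)) z = exp (\<psi> z / 2 ^ n)"
        unfolding W(4) by (rule \<nu>(2))
    qed
    show ?thesis by (rule that[OF levy_process_X[OF W(2)] char_fun_X[OF W(2)]])
  qed
qed

section \<open>The range of the mapping\<close>

text \<open>The increment since the last integer has the law of \<open>X s\<close> for some s in
  [0, 1]. Scaled by b^-n, with n that integer, its characteristic function at z is exp (s \<psi> (z
  / b^n)), which tends to 1 uniformly in s and in bounded z because \<psi> is continuous and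
  vanishes at 0.\<close>

lemma tendsto_in_prob_remainder:
  fixes X :: "real \<Rightarrow> 'w \<Rightarrow> 'a::euclidean_space"
  assumes L: "levy_process M X" and b: "1 < b" and \<epsilon>: "0 < \<epsilon>"
    and \<psi>: "continuous_on UNIV \<psi>" "\<psi> 0 = 0"
    and char_X: "\<And>t z. 0 \<le> t \<Longrightarrow> char_fun (distr M borel (X t)) z = exp (of_real t * \<psi> z)"
  shows "((\<lambda>t. measure M {\<omega>\<in>space M. \<epsilon> < norm (inverse b ^ nat \<lfloor>t\<rfloor> *\<^sub>R (X t \<omega> - X (of_int \<lfloor>t\<rfloor>) \<omega>))}) \<longlongrightarrow> 0) at_top"
proof (rule tendstoI)
  fix e :: real assume "0 < e"
  interpret prob_space M using L by (rule levy_processD)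
  obtain u \<eta> where u: "0 < u" "0 < \<eta>"
    "\<And>\<kappa> :: 'a measure. \<kappa> \<in> distributions \<Longrightarrow>
      (\<And>z. norm z \<le> u \<Longrightarrow> norm (char_fun \<kappa> z - 1) \<le> \<eta>) \<Longrightarrow> measure \<kappa> {x. norm x > \<epsilon>} \<le> e / 2"
    using char_fun_near_1_imp_small[OF \<epsilon>, of "e / 2"] \<open>0 < e\<close> by (metis half_gt_zero)
  obtain r where r: "0 < r" "\<And>w::complex. norm w < r \<Longrightarrow> norm (exp w - 1) < \<eta>"
    using exp_near_1[OF u(2)] by blast
  have "isCont \<psi> 0" using \<psi>(1) by (simp add: continuous_on_eq_continuous_at)
  then obtain d where d: "0 < d" "\<And>z. norm z < d \<Longrightarrow> norm (\<psi> z) < r"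
    using r(1) unfolding continuous_at_eps_delta by (auto simp: dist_norm \<psi>(2))
  have "(\<lambda>n. inverse b ^ n) \<longlonglongrightarrow> 0" by (rule LIMSEQ_power_zero) (use b in \<open>simp add: inverse_less_1_iff\<close>)
  then have "(\<lambda>n. inverse b ^ n * u) \<longlonglongrightarrow> 0 * u" by (rule tendsto_mult_right)
  then have "eventually (\<lambda>n. inverse b ^ n * u < d) sequentially"
    using d(1) by (intro order_tendstoD(2)) auto
  moreover have "filterlim (\<lambda>t::real. nat \<lfloor>t\<rfloor>) sequentially at_top"
    by (rule filterlim_compose[OF filterlim_nat_sequentially filterlim_floor_sequentially])
  ultimately have "eventually (\<lambda>t::real. inverse b ^ nat \<lfloor>t\<rfloor> * u < d) at_top"
    by (rule eventually_compose_filterlim)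
  with eventually_ge_at_top[of "0::real"]
  show "eventually (\<lambda>t. dist (measure M {\<omega>\<in>space M. \<epsilon> < norm (inverse b ^ nat \<lfloor>t\<rfloor> *\<^sub>R (X t \<omega> - X (of_int \<lfloor>t\<rfloor>) \<omega>))}) 0 < e) at_top"
  proof eventually_elim
    case (elim t)
    define n where "n = nat \<lfloor>t\<rfloor>"
    have n: "real n = of_int \<lfloor>t\<rfloor>" using elim(1) by (simp add: n_def)
    define s where "s = t - real n"
    have s: "0 \<le> s" "s \<le> 1" using n by (simp_all add: s_def) linarith+
    have [measurable]: "X t \<in> borel_measurable M" "X (real n) \<in> borel_measurable M" "X s \<in> borel_measurable M"
      using levy_processD(2)[OF L] elim(1) s by auto
    let ?D = "\<lambda>\<omega>. inverse b ^ n *\<^sub>R (X t \<omega> - X (real n) \<omega>)"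
    have law: "distr M borel (\<lambda>\<omega>. X t \<omega> - X (real n) \<omega>) = distr M borel (X s)"
      using levy_process_increment_law[OF L, of "real n" s] s by (simp add: s_def)
    have d1: "distr M borel (\<lambda>\<omega>. X t \<omega> - X (real n) \<omega>) \<in> distributions"
      by (intro distr_in_distributions prob_space_axioms) measurable
    have "distr M borel ?D = distr (distr M borel (\<lambda>\<omega>. X t \<omega> - X (real n) \<omega>)) borel (\<lambda>x. inverse b ^ n *\<^sub>R x)"
      by (subst distr_distr) (auto simp: o_def)
    then have char_D: "char_fun (distr M borel ?D) z = exp (of_real s * \<psi> (inverse b ^ n *\<^sub>R z))" for z
      using s by (simp only: char_fun_scaleR[OF d1]) (simp add: law char_X)
    have "measure (distr M borel ?D) {x. norm x > \<epsilon>} \<le> e / 2"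
    proof (rule u(3))
      show "distr M borel ?D \<in> distributions" by (intro distr_in_distributions prob_space_axioms) measurable
      fix z :: 'a assume z: "norm z \<le> u"
      have "norm (inverse b ^ n *\<^sub>R z) \<le> inverse b ^ n * u" using z b by (simp add: mult_left_mono)
      also have "\<dots> < d" using elim(2) by (simp add: n_def)
      finally have "norm (\<psi> (inverse b ^ n *\<^sub>R z)) < r" by (rule d(2))
      moreover have "s * norm (\<psi> (inverse b ^ n *\<^sub>R z)) \<le> 1 * norm (\<psi> (inverse b ^ n *\<^sub>R z))"
        using s by (intro mult_right_mono) auto
      ultimately have "norm (of_real s * \<psi> (inverse b ^ n *\<^sub>R z)) < r" using s by (simp add: norm_mult)
      then show "norm (char_fun (distr M borel ?D) z - 1) \<le> \<eta>" unfolding char_D using r(2) by (intro less_imp_le)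
    qed
    also have "measure (distr M borel ?D) {x. norm x > \<epsilon>} = measure M {\<omega>\<in>space M. \<epsilon> < norm (?D \<omega>)}"
      by (subst measure_distr) (auto simp: vimage_def intro!: arg_cong[where f=prob])
    finally show ?case using \<open>0 < e\<close> unfolding n[symmetric] n_def[symmetric] by simp
  qed
qed

lemma (in prob_space) AE_limit_imp_tendsto_in_prob:
  fixes X :: "nat \<Rightarrow> 'a \<Rightarrow> 'b::euclidean_space"
  assumes [measurable]: "\<And>n. X n \<in> borel_measurable M" "Y \<in> borel_measurable M"
    and lim: "AE \<omega> in M. (\<lambda>n. X n \<omega>) \<longlonglongrightarrow> Y \<omega>"
  shows "tendsto_in_prob M X Y sequentially"
  unfolding tendsto_in_prob_def
proof safe
  fix \<epsilon> :: real assume \<epsilon>: "0 < \<epsilon>"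
  let ?A = "\<lambda>n. {\<omega> \<in> space M. norm (X n \<omega> - Y \<omega>) > \<epsilon>}"
  have "(\<lambda>n. \<integral>\<omega>. indicat_real (?A n) \<omega> \<partial>M) \<longlonglongrightarrow> (\<integral>\<omega>. 0 \<partial>M)"
  proof (rule integral_dominated_convergence[where w="\<lambda>_. 1"])
    show "AE \<omega> in M. (\<lambda>n. indicat_real (?A n) \<omega>) \<longlonglongrightarrow> 0"
      using lim
    proof eventually_elim
      case (elim \<omega>)
      have "eventually (\<lambda>n. dist (X n \<omega>) (Y \<omega>) < \<epsilon>) sequentially" using elim \<epsilon> by (rule tendstoD)
      then have "eventually (\<lambda>n. indicat_real (?A n) \<omega> = 0) sequentially"
        by eventually_elim (auto simp: dist_norm indicator_def)
      then show ?case by (rule tendsto_eventually)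
    qed
  qed (auto simp: indicator_def)
  then show "(\<lambda>n. measure M (?A n)) \<longlonglongrightarrow> 0" by simp
qed

text \<open>Up to the last integer the integral is a partial sum of an almost surely convergent
  series, and what follows is the remainder that tends to 0 in probability. Each of the two parts
  gets half of \<epsilon>.\<close>

lemma law_of_integral_exists:
  fixes \<mu> :: "'a::ordered_euclidean_space measure"
  assumes \<mu>: "\<mu> \<in> inf_divisible" and log: "log_moment \<mu> < \<infinity>" and b: "1 < b"
  obtains \<nu> where "law_of_integral b \<mu> \<nu>"
proof -
  have \<mu>d: "\<mu> \<in> distributions" using \<mu> by (rule inf_divisibleD)
  obtain \<psi> where \<psi>: "levy_exponent \<mu> \<psi>" using levy_exponent_exists[OF \<mu>] .
  obtain M :: "(real \<Rightarrow> 'a) measure" and X where L: "levy_process M X"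
    and char_X: "\<And>t z. 0 \<le> t \<Longrightarrow> char_fun (distr M borel (X t)) z = exp (of_real t * \<psi> z)"
    using levy_process_exists[OF \<mu> \<psi>] by blast
  interpret prob_space M using L by (rule levy_processD)
  have X_meas[measurable]: "X t \<in> borel_measurable M" if "0 \<le> t" for t using levy_processD(2)[OF L that] .
  have X1: "distr M borel (X 1) = \<mu>"
    by (rule char_fun_unique[OF _ \<mu>d])
       (use \<psi> char_X[of 1] in \<open>auto simp: levy_exponent_def intro!: distr_in_distributions prob_space_axioms\<close>)
  define \<xi> where "\<xi> j \<omega> = X (real j + 1) \<omega> - X (real j) \<omega>" for j :: nat and \<omega>
  have \<xi>_meas[measurable]: "\<xi> j \<in> borel_measurable M" for j unfolding \<xi>_def[abs_def] by measurable
  have law: "distr M borel (\<xi> j) = \<mu>" for j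
    using levy_process_increment_law[OF L, of "real j" 1] by (simp add: \<xi>_def[abs_def] X1)
  define S where "S n \<omega> = (\<Sum>j<n. inverse b ^ j *\<^sub>R \<xi> j \<omega>)" for n \<omega>
  have [measurable]: "S n \<in> borel_measurable M" for n unfolding S_def[abs_def] by measurable
  define Y where "Y \<omega> = lim (\<lambda>n. S n \<omega>)" for \<omega>
  have [measurable]: "Y \<in> borel_measurable M" unfolding Y_def[abs_def] by measurable
  have "AE \<omega> in M. summable (\<lambda>j. inverse b ^ j *\<^sub>R \<xi> j \<omega>)"
    by (rule log_moment_imp_summable[OF \<mu>d log b prob_space_axioms \<xi>_meas law])
  then have "AE \<omega> in M. (\<lambda>n. S n \<omega>) \<longlonglongrightarrow> Y \<omega>"
  proof eventually_elim
    case (elim \<omega>)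
    then have "convergent (\<lambda>n. S n \<omega>)" by (simp add: S_def summable_iff_convergent)
    then show ?case unfolding Y_def by (simp add: convergent_LIMSEQ_iff)
  qed
  then have lim_S: "tendsto_in_prob M S Y sequentially" by (intro AE_limit_imp_tendsto_in_prob) auto
  have "tendsto_in_prob M (step_integral b X) Y at_top"
    unfolding tendsto_in_prob_def
  proof safe
    fix \<epsilon> :: real assume \<epsilon>: "0 < \<epsilon>"
    define R where "R t \<omega> = inverse b ^ nat \<lfloor>t\<rfloor> *\<^sub>R (X t \<omega> - X (of_int \<lfloor>t\<rfloor>) \<omega>)" for t \<omega>
    let ?p = "\<lambda>t::real. prob {\<omega>\<in>space M. \<epsilon> / 2 < norm (S (nat \<lfloor>t\<rfloor>) \<omega> - Y \<omega>)}"
    let ?q = "\<lambda>t. prob {\<omega>\<in>space M. \<epsilon> / 2 < norm (R t \<omega>)}"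
    have floor: "filterlim (\<lambda>t::real. nat \<lfloor>t\<rfloor>) sequentially at_top"
      by (rule filterlim_compose[OF filterlim_nat_sequentially filterlim_floor_sequentially])
    have p_nat: "(\<lambda>n. prob {\<omega>\<in>space M. \<epsilon> / 2 < norm (S n \<omega> - Y \<omega>)}) \<longlonglongrightarrow> 0"
      using lim_S[unfolded tendsto_in_prob_def, rule_format, of "\<epsilon> / 2"] \<epsilon> by simp
    have p: "(?p \<longlongrightarrow> 0) at_top" by (rule filterlim_compose[OF p_nat floor])
    have q: "(?q \<longlongrightarrow> 0) at_top"
      unfolding R_def using \<psi> \<epsilon>
      by (intro tendsto_in_prob_remainder[OF L b _ _ _ char_X]) (auto simp: levy_exponent_def)
    show "((\<lambda>t. prob {\<omega> \<in> space M. norm (step_integral b X t \<omega> - Y \<omega>) > \<epsilon>}) \<longlongrightarrow> 0) at_top"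
    proof (rule tendsto_sandwich[where f="\<lambda>_. 0"])
      show "((\<lambda>t. ?p t + ?q t) \<longlongrightarrow> 0) at_top" using tendsto_add[OF p q] by simp
      show "eventually (\<lambda>t. prob {\<omega> \<in> space M. norm (step_integral b X t \<omega> - Y \<omega>) > \<epsilon>} \<le> ?p t + ?q t) at_top"
        using eventually_ge_at_top[of "0::real"]
      proof eventually_elim
        case (elim t)
        then have [measurable]: "X t \<in> borel_measurable M" "X (of_int \<lfloor>t\<rfloor>) \<in> borel_measurable M"
          by (auto intro!: X_meas)
        then have [measurable]: "R t \<in> borel_measurable M" unfolding R_def[abs_def] by measurable
        have eq: "step_integral b X t \<omega> = S (nat \<lfloor>t\<rfloor>) \<omega> + R t \<omega>" for \<omega>
          by (simp add: step_integral_def S_def \<xi>_def R_def)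
        have "{\<omega> \<in> space M. norm (step_integral b X t \<omega> - Y \<omega>) > \<epsilon>} \<subseteq>
          {\<omega>\<in>space M. \<epsilon> / 2 < norm (S (nat \<lfloor>t\<rfloor>) \<omega> - Y \<omega>)} \<union> {\<omega>\<in>space M. \<epsilon> / 2 < norm (R t \<omega>)}"
        proof safe
          fix \<omega> assume "\<epsilon> < norm (step_integral b X t \<omega> - Y \<omega>)" "\<not> \<epsilon> / 2 < norm (R t \<omega>)"
          moreover have "norm (step_integral b X t \<omega> - Y \<omega>) \<le> norm (S (nat \<lfloor>t\<rfloor>) \<omega> - Y \<omega>) + norm (R t \<omega>)"
            unfolding eq using norm_triangle_ineq[of "S (nat \<lfloor>t\<rfloor>) \<omega> - Y \<omega>" "R t \<omega>"] by (simp add: algebra_simps)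
          ultimately show "\<epsilon> / 2 < norm (S (nat \<lfloor>t\<rfloor>) \<omega> - Y \<omega>)" by linarith
        qed
        then have "prob {\<omega> \<in> space M. norm (step_integral b X t \<omega> - Y \<omega>) > \<epsilon>} \<le>
          prob ({\<omega>\<in>space M. \<epsilon> / 2 < norm (S (nat \<lfloor>t\<rfloor>) \<omega> - Y \<omega>)} \<union> {\<omega>\<in>space M. \<epsilon> / 2 < norm (R t \<omega>)})"
          by (rule finite_measure_mono) measurable
        also have "\<dots> \<le> ?p t + ?q t" by (rule measure_Un_le) measurable
        finally show ?case .
      qed
    qed (auto intro!: always_eventually)
  qed
  then have "law_of_integral b \<mu> (distr M borel Y)"
    unfolding law_of_integral_def using L X1 \<open>Y \<in> borel_measurable M\<close> by blast
  then show ?thesis by (rule that)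
qed

section \<open>Consequences of the product formula\<close>

lemma char_fun_product_lower_bound:
  assumes \<mu>: "\<mu> \<in> distributions" and \<nu>: "\<nu> \<in> distributions"
    and lim: "\<And>z. (\<lambda>n. \<Prod>j<n. char_fun \<mu> (inverse b ^ j *\<^sub>R z)) \<longlonglongrightarrow> char_fun \<nu> z"
  obtains \<delta> where "0 < \<delta>"
    "\<And>N z. norm z \<le> \<delta> \<Longrightarrow> 1 / 2 \<le> (\<Prod>j<N. norm (char_fun \<mu> (inverse b ^ j *\<^sub>R z)))"
proof -
  have "isCont (char_fun \<nu>) 0"
    using continuous_char_fun[OF \<nu>] by (simp add: continuous_on_eq_continuous_at)
  then obtain d where d: "0 < d" "\<And>z. norm z < d \<Longrightarrow> norm (char_fun \<nu> z - 1) < 1 / 2"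
    unfolding continuous_at_eps_delta
    by (auto simp: dist_norm char_fun_zero[OF \<nu>] dest: spec[of _ "1/2"])
  show ?thesis
  proof (rule that[of "d / 2"])
    fix N and z :: 'a assume "norm z \<le> d / 2"
    then have "norm (char_fun \<nu> z - 1) < 1 / 2" using d by simp
    then have half: "1 / 2 \<le> norm (char_fun \<nu> z)"
      using norm_triangle_ineq2[of 1 "char_fun \<nu> z"] by (simp add: norm_minus_commute)
    let ?P = "\<lambda>n. \<Prod>j<n. norm (char_fun \<mu> (inverse b ^ j *\<^sub>R z))"
    have "?P \<longlonglongrightarrow> norm (char_fun \<nu> z)"
      using tendsto_norm[OF lim[of z]] by (simp add: prod_norm)
    \<comment> \<open>Every factor has modulus at most 1, so no partial product falls below the
      limit, and a bound for the limit holds for all N at once.\<close>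
    moreover have "decseq ?P"
    proof (rule decseq_SucI)
      fix n
      have "?P n * norm (char_fun \<mu> (inverse b ^ n *\<^sub>R z)) \<le> ?P n * 1"
        by (intro mult_left_mono norm_char_fun_le_1[OF \<mu>] prod_nonneg) auto
      then show "?P (Suc n) \<le> ?P n" by simp
    qed
    ultimately have "norm (char_fun \<nu> z) \<le> ?P N" by (intro decseq_ge)
    with half show "1 / 2 \<le> ?P N" by simp
  qed (use d in simp)
qed

text \<open>The definition only makes a root a distribution. To have a Levy process it must be
  infinitely divisible itself, and the root of order n m of \<mu> serves as its m-th root.\<close>

lemma inf_divisible_root:
  assumes \<mu>: "\<mu> \<in> inf_divisible" and n: "n \<ge> 1"
  obtains \<kappa> where "\<kappa> \<in> inf_divisible" "\<And>z. char_fun \<mu> z = char_fun \<kappa> z ^ n"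
proof -
  obtain \<psi> where \<psi>: "levy_exponent \<mu> \<psi>" using levy_exponent_exists[OF \<mu>] .
  obtain \<kappa> where \<kappa>: "\<kappa> \<in> distributions" "\<And>z. char_fun \<kappa> z = exp (\<psi> z / of_nat n)"
    using levy_exponent_root_exists[OF \<mu> \<psi> n] by blast
  show ?thesis
  proof (rule that)
    show "char_fun \<mu> z = char_fun \<kappa> z ^ n" for z
      using \<psi> n by (simp add: \<kappa>(2) levy_exponent_def exp_of_nat_mult[symmetric])
    show "\<kappa> \<in> inf_divisible"
      unfolding inf_divisible_def
    proof (intro CollectI conjI allI impI \<kappa>(1))
      fix m :: nat assume m: "m \<ge> 1"
      have "n * m \<ge> 1" using n m by simp
      obtain \<theta> where \<theta>: "\<theta> \<in> distributions" "\<And>z. char_fun \<theta> z = exp (\<psi> z / of_nat (n * m))"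
        using levy_exponent_root_exists[OF \<mu> \<psi> \<open>n * m \<ge> 1\<close>] by blast
      have "\<kappa> = convolution_power \<theta> m"
      proof (rule char_fun_unique[OF \<kappa>(1) convolution_power_in_distributions[OF \<theta>(1)]])
        show "char_fun \<kappa> z = char_fun (convolution_power \<theta> m) z" for z
          using m by (simp add: char_fun_convolution_power[OF \<theta>(1)] \<kappa>(2) \<theta>(2) exp_of_nat_mult[symmetric])
      qed
      with \<theta>(1) show "\<exists>\<nu>\<in>distributions. \<kappa> = convolution_power \<nu> m" by blast
    qed
  qed
qed

text \<open>This puts every law with an existing integral into \<open>inf_divisible_log\<close>, so
  that nothing in the range is missed by restricting to that class.\<close>

lemma law_of_integral_log_moment:
  fixes \<mu> :: "'a::euclidean_space measure"
  assumes "law_of_integral b \<mu> \<nu>" and b: "1 < b"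
  shows "log_moment \<mu> < \<infinity>"
proof -
  note law = law_of_integral_char_fun[OF assms(1)]
  obtain \<delta> where "0 < \<delta>" "\<And>N z. norm z \<le> \<delta> \<Longrightarrow> 1 / 2 \<le> (\<Prod>j<N. norm (char_fun \<mu> (inverse b ^ j *\<^sub>R z)))"
    using char_fun_product_lower_bound[OF law] by blast
  then show ?thesis by (intro log_moment_finite[OF law(1) b, of \<delta> "1 / 2"]) auto
qed

text \<open>The n-th root of \<nu> is the law of the integral for the n-th root \<kappa> of \<mu>.
  That this integral exists is the actual content; afterwards both laws have the same product
  limit.\<close>

lemma law_of_integral_inf_divisible:
  fixes \<mu> :: "'a::ordered_euclidean_space measure"
  assumes law_int: "law_of_integral b \<mu> \<nu>" and \<mu>: "\<mu> \<in> inf_divisible" and b: "1 < b"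
  shows "\<nu> \<in> inf_divisible"
  unfolding inf_divisible_def
proof (intro CollectI conjI allI impI)
  note law = law_of_integral_char_fun[OF law_int]
  show "\<nu> \<in> distributions" by (rule law)
  fix n :: nat assume n: "n \<ge> 1"
  obtain \<kappa> where \<kappa>: "\<kappa> \<in> inf_divisible" "\<And>z. char_fun \<mu> z = char_fun \<kappa> z ^ n"
    using inf_divisible_root[OF \<mu> n] by blast
  have \<kappa>d: "\<kappa> \<in> distributions" using \<kappa>(1) by (rule inf_divisibleD)
  obtain \<delta> where \<delta>: "0 < \<delta>"
    "\<And>N z. norm z \<le> \<delta> \<Longrightarrow> 1 / 2 \<le> (\<Prod>j<N. norm (char_fun \<mu> (inverse b ^ j *\<^sub>R z)))"
    using char_fun_product_lower_bound[OF law] by blast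
  have "log_moment \<kappa> < \<infinity>"
  proof (rule log_moment_finite[OF \<kappa>d b \<delta>(1), of "1 / 2"])
    fix N and z :: 'a assume "norm z \<le> \<delta>"
    let ?p = "\<Prod>j<N. norm (char_fun \<kappa> (inverse b ^ j *\<^sub>R z))"
    have "1 / 2 \<le> ?p ^ n"
      using \<delta>(2)[OF \<open>norm z \<le> \<delta>\<close>, of N] by (simp add: \<kappa>(2) norm_power prod_power_distrib)
    \<comment> \<open>As \<open>?p\<close> lies in [0, 1], its n-th power is at most
      \<open>?p\<close>, so the bound 1/2 for \<mu> serves \<kappa> as well.\<close>
    also have "\<dots> \<le> ?p ^ 1"
      by (intro power_decreasing n prod_nonneg prod_le_1) (auto intro: norm_char_fun_le_1[OF \<kappa>d])
    finally show "1 / 2 \<le> ?p" by simp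
  qed simp
  then obtain \<theta> where \<theta>: "law_of_integral b \<kappa> \<theta>" using law_of_integral_exists[OF \<kappa>(1) _ b] by blast
  note law' = law_of_integral_char_fun[OF \<theta>]
  have "\<nu> = convolution_power \<theta> n"
  proof (rule char_fun_unique[OF law(2) convolution_power_in_distributions[OF law'(2)]])
    fix z
    have "(\<lambda>N. (\<Prod>j<N. char_fun \<kappa> (inverse b ^ j *\<^sub>R z)) ^ n) \<longlonglongrightarrow> char_fun \<theta> z ^ n"
      by (intro tendsto_power law')
    then have "(\<lambda>N. \<Prod>j<N. char_fun \<mu> (inverse b ^ j *\<^sub>R z)) \<longlonglongrightarrow> char_fun \<theta> z ^ n"
      by (simp add: \<kappa>(2) prod_power_distrib)
    from LIMSEQ_unique[OF law(3) this]
    show "char_fun \<nu> z = char_fun (convolution_power \<theta> n) z"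
      by (simp add: char_fun_convolution_power[OF law'(2)])
  qed
  with law'(2) show "\<exists>\<theta>\<in>distributions. \<nu> = convolution_power \<theta> n" by blast
qed

lemma law_of_integral_semi_selfdecomposable:
  fixes \<mu> :: "'a::ordered_euclidean_space measure"
  assumes law_int: "law_of_integral b \<mu> \<nu>" and \<mu>: "\<mu> \<in> inf_divisible" and b: "1 < b"
  shows "\<nu> \<in> semi_selfdecomposable b"
proof -
  note law = law_of_integral_char_fun[OF law_int]
  have "char_fun \<nu> z = char_fun \<nu> (inverse b *\<^sub>R z) * char_fun \<mu> z" for z
  proof (rule LIMSEQ_unique)
    show "(\<lambda>n. \<Prod>j<Suc n. char_fun \<mu> (inverse b ^ j *\<^sub>R z)) \<longlonglongrightarrow> char_fun \<nu> z"
      by (rule LIMSEQ_Suc[OF law(3)])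
    have "(\<lambda>n. (\<Prod>j<n. char_fun \<mu> (inverse b ^ j *\<^sub>R (inverse b *\<^sub>R z))) * char_fun \<mu> z)
        \<longlonglongrightarrow> char_fun \<nu> (inverse b *\<^sub>R z) * char_fun \<mu> z"
      by (intro tendsto_mult law(3) tendsto_const)
    \<comment> \<open>The factor j = 0 is \<open>char_fun \<mu> z\<close>, and the others form the
      product for z / b.\<close>
    then show "(\<lambda>n. \<Prod>j<Suc n. char_fun \<mu> (inverse b ^ j *\<^sub>R z)) \<longlonglongrightarrow> char_fun \<nu> (inverse b *\<^sub>R z) * char_fun \<mu> z"
      unfolding prod.lessThan_Suc_shift by (simp add: mult_ac)
  qed
  then show ?thesis
    unfolding semi_selfdecomposable_def using law_of_integral_inf_divisible[OF assms] \<mu> by blast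
qed

lemma semi_selfdecomposable_law_of_integral:
  fixes \<nu> :: "'a::ordered_euclidean_space measure"
  assumes \<nu>: "\<nu> \<in> semi_selfdecomposable b" and b: "1 < b"
  obtains \<rho> where "\<rho> \<in> inf_divisible" "law_of_integral b \<rho> \<nu>"
proof -
  obtain \<rho> where \<rho>: "\<rho> \<in> inf_divisible"
    and eq: "\<And>z. char_fun \<nu> z = char_fun \<nu> (inverse b *\<^sub>R z) * char_fun \<rho> z"
    and \<nu>i: "\<nu> \<in> inf_divisible"
    using \<nu> unfolding semi_selfdecomposable_def by blast
  have \<nu>d: "\<nu> \<in> distributions" and \<rho>d: "\<rho> \<in> distributions" using \<nu>i \<rho> by (auto dest: inf_divisibleD)
  have iter: "char_fun \<nu> z = char_fun \<nu> (inverse b ^ n *\<^sub>R z) * (\<Prod>j<n. char_fun \<rho> (inverse b ^ j *\<^sub>R z))" for n z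
  proof (induction n)
    case (Suc n)
    then show ?case using eq[of "inverse b ^ n *\<^sub>R z"] by (simp add: mult_ac)
  qed simp
  have lim: "(\<lambda>n. \<Prod>j<n. char_fun \<rho> (inverse b ^ j *\<^sub>R z)) \<longlonglongrightarrow> char_fun \<nu> z" for z
  proof -
    have "(\<lambda>n. inverse b ^ n) \<longlonglongrightarrow> 0" by (rule LIMSEQ_power_zero) (use b in \<open>simp add: inverse_less_1_iff\<close>)
    then have "(\<lambda>n. inverse b ^ n *\<^sub>R z) \<longlonglongrightarrow> 0 *\<^sub>R z" by (rule tendsto_scaleR[OF _ tendsto_const])
    then have "(\<lambda>n. char_fun \<nu> (inverse b ^ n *\<^sub>R z)) \<longlonglongrightarrow> 1"
      using continuous_on_tendsto_compose[OF continuous_char_fun[OF \<nu>d], of _ 0]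
      by (simp add: char_fun_zero[OF \<nu>d])
    then have "(\<lambda>n. char_fun \<nu> z / char_fun \<nu> (inverse b ^ n *\<^sub>R z)) \<longlonglongrightarrow> char_fun \<nu> z / 1"
      by (intro tendsto_intros) auto
    \<comment> \<open>The division is legitimate because the characteristic function of the
      infinitely divisible \<nu> has no zeros.\<close>
    moreover have "char_fun \<nu> z / char_fun \<nu> (inverse b ^ n *\<^sub>R z) = (\<Prod>j<n. char_fun \<rho> (inverse b ^ j *\<^sub>R z))" for n
      using iter[of z n] inf_divisible_char_fun_nonzero[OF \<nu>i, of "inverse b ^ n *\<^sub>R z"] by (simp add: field_simps)
    ultimately show ?thesis by simp
  qed
  obtain \<delta> where "0 < \<delta>" "\<And>N z. norm z \<le> \<delta> \<Longrightarrow> 1 / 2 \<le> (\<Prod>j<N. norm (char_fun \<rho> (inverse b ^ j *\<^sub>R z)))"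
    using char_fun_product_lower_bound[OF \<rho>d \<nu>d lim] by blast
  then have "log_moment \<rho> < \<infinity>" by (intro log_moment_finite[OF \<rho>d b, of \<delta> "1 / 2"]) auto
  then obtain \<nu>' where \<nu>': "law_of_integral b \<rho> \<nu>'" using law_of_integral_exists[OF \<rho> _ b] by blast
  have "\<nu>' = \<nu>"
    by (rule char_fun_unique[OF law_of_integral_char_fun(2)[OF \<nu>'] \<nu>d
          LIMSEQ_unique[OF law_of_integral_char_fun(3)[OF \<nu>'] lim]])
  with \<rho> \<nu>' show ?thesis using that by blast
qed

text \<open>Uniqueness of the law eliminates THE, and the partial map can be treated as a
  relation.\<close>

lemma Phi_eq_Some_iff:
  "Phi b \<mu> = Some \<nu> \<longleftrightarrow> \<mu> \<in> inf_divisible \<and> law_of_integral b \<mu> \<nu>"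
proof -
  have "(THE \<nu>. law_of_integral b \<mu> \<nu>) = \<nu>" if "law_of_integral b \<mu> \<nu>" for \<nu>
    using that by (rule the_equality) (rule law_of_integral_unique[OF _ that])
  then show ?thesis by (auto simp: Phi_def)
qed

lemma inf_divisible_log_iff:
  "\<mu> \<in> inf_divisible_log \<longleftrightarrow> \<mu> \<in> inf_divisible \<and> log_moment \<mu> < \<infinity>"
  by (simp add: inf_divisible_log_def log_moment_def)

text \<open>The first equation concerns the range over the whole domain of the partial map. The
  second is the image of the class with logarithmic moments; \<open>Some\<close> on its right-hand
  side also says that the map is defined on all of that class.\<close>

theorem corollary3p4:
  fixes b :: real
  assumes "b > 1"
  shows "ran (Phi b) = (semi_selfdecomposable b :: (real ^ 'd) measure set) \<and>
    Phi b ` (inf_divisible_log :: (real ^ 'd) measure set) = Some ` semi_selfdecomposable b"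
proof
  let ?L = "semi_selfdecomposable b :: (real ^ 'd) measure set"
  have range: "\<nu> \<in> ?L" if "Phi b \<mu> = Some \<nu>" for \<mu> \<nu>
    using that law_of_integral_semi_selfdecomposable[OF _ _ assms] by (auto simp: Phi_eq_Some_iff)
  have onto: "\<exists>\<rho>\<in>inf_divisible_log. Phi b \<rho> = Some \<nu>" if \<nu>: "\<nu> \<in> ?L" for \<nu>
  proof -
    obtain \<rho> where "\<rho> \<in> inf_divisible" "law_of_integral b \<rho> \<nu>"
      using semi_selfdecomposable_law_of_integral[OF \<nu> assms] by blast
    then show ?thesis
      using law_of_integral_log_moment[OF _ assms] by (intro bexI[of _ \<rho>]) (auto simp: Phi_eq_Some_iff inf_divisible_log_iff)
  qed
  have total: "\<exists>\<nu>. Phi b \<mu> = Some \<nu>" if "\<mu> \<in> inf_divisible_log" for \<mu> :: "(real ^ 'd) measure"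
    using that law_of_integral_exists[OF _ _ assms, of \<mu>] by (auto simp: Phi_eq_Some_iff inf_divisible_log_iff)
  show "ran (Phi b) = ?L"
    using range onto by (auto simp: ran_def) blast
  show "Phi b ` (inf_divisible_log :: (real ^ 'd) measure set) = Some ` ?L"
  proof (intro equalityI subsetI)
    fix y assume "y \<in> Phi b ` (inf_divisible_log :: (real ^ 'd) measure set)"
    then show "y \<in> Some ` ?L" using total range by fastforce
  next
    fix y assume "y \<in> Some ` ?L"
    then show "y \<in> Phi b ` (inf_divisible_log :: (real ^ 'd) measure set)" by (auto dest!: onto intro: rev_image_eqI)
  qed
qed

end
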